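(* Let $n\ge 2$, let $O$ be a $2^n\times 2^n$ positive semidefinite Hermitian matrix, let $\rho$ be an $n$-qubit state, and let $\gamma,\delta\in(0,1)$. Suppose the auxiliary states $\zeta$ in the state-based classical shadow procedure are sampled from a relative $\epsilon$-approximate state $3$-design. Then a collection of $LK$ independent classical shadows, with $$K=2\log(2/\delta),\qquad L=\frac{34}{\gamma^2}\left(3\mathrm{Tr}(O_0^2)+10\epsilon\,\mathrm{Tr}(O)^2\right),$$ yields the median-of-means estimate $\hat o(L,K)$ satisfying $$\Pr\left[\,|\hat o(L,K)-\mathrm{Tr}(O\rho)|\le \gamma+2\epsilon\,\mathrm{Tr}(O)\right]\ge 1-\delta .$$
   Context: State-based classical shadow procedure: registers $R_1,R_2$ of $n$ qubits each; $R_1$ holds the unknown input state $\rho$, $R_2$ holds a pure state $|\zeta\rangle$ sampled from a distribution $\mathcal S$ over pure states (with known classical description). Apply $n$ CNOT gates qubit by qubit with the qubits of $R_1$ as controls and those of $R_2$ as targets, then apply $H^{\otimes n}$ to $R_1$, then measure $R_1$ and $R_2$ in the computational basis obtaining $z\in\{0,1\}^n$ and $x\in\{0,1\}^n$. Let $|\zeta_{x,z}\rangle=X^xZ^z|\zeta\rangle$ (where $X^x=\bigotimes_j X^{x_j}$, $Z^z=\bigotimes_j Z^{z_j}$), and let $|\zeta^*_{x,z}\rangle$ denote its entrywise complex conjugate in the computational basis. The classical shadow is $\hat\rho=(2^n+1)|\zeta^*_{x,z}\rangle\langle\zeta^*_{x,z}|-I$, and each shadow gives the estimate $\mathrm{Tr}(O\hat\rho)$.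 The estimator $\hat o(L,K)$ is the median of $K$ means, each mean taken over $L$ estimates $\mathrm{Tr}(O\hat\rho)$ from independent shadows. $O_0=O-\frac{\mathrm{Tr}(O)}{2^n}I$ is the traceless part of $O$. Let $\mu$ be the Haar measure on $n$-qubit pure states. A distribution $\mathcal K$ over classical strings together with states $|\psi_k\rangle$ is a relative $\epsilon$-approximate state $t$-design if $(1-\epsilon)\int|\phi\rangle\langle\phi|^{\otimes t}d\mu(\phi)\preceq \mathbb E_{k\leftarrow\mathcal K}[|\psi_k\rangle\langle\psi_k|^{\otimes t}]\preceq(1+\epsilon)\int|\phi\rangle\langle\phi|^{\otimes t}d\mu(\phi)$, where $A\preceq B$ means $B-A$ is positive semidefinite. *)

theory Defs
  imports "Jordan_Normal_Form.Matrix" "HOL-Probability.Probability"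
begin

unbundle bit_operations_syntax

definition adj :: "complex mat \<Rightarrow> complex mat" where
  "adj A = Matrix.mat (dim_col A) (dim_row A) (\<lambda>(i,j). cnj (A $$ (j,i)))"

definition mtrace :: "complex mat \<Rightarrow> complex" where
  "mtrace A = (\<Sum>i<dim_row A. A $$ (i,i))"

definition hermitian_mat :: "complex mat \<Rightarrow> bool" where
  "hermitian_mat A \<longleftrightarrow> square_mat A \<and> adj A = A"

definition psd_mat :: "complex mat \<Rightarrow> bool" where
  "psd_mat A \<longleftrightarrow> hermitian_mat A \<and>
     (\<forall>v \<in> carrier_vec (dim_row A).
        0 \<le> Re (\<Sum>i<dim_row A. cnj (v $ i) * (A *\<^sub>v v) $ i))"

definition loewner_le :: "complex mat \<Rightarrow> complex mat \<Rightarrow> bool" where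
  "loewner_le A B \<longleftrightarrow> dim_row A = dim_row B \<and> dim_col A = dim_col B \<and> psd_mat (B - A)"

definition density_mat :: "nat \<Rightarrow> complex mat \<Rightarrow> bool" where
  "density_mat n \<rho> \<longleftrightarrow> \<rho> \<in> carrier_mat (2^n) (2^n) \<and> psd_mat \<rho> \<and> mtrace \<rho> = 1"

definition unit_state :: "nat \<Rightarrow> complex Matrix.vec \<Rightarrow> bool" where
  "unit_state d v \<longleftrightarrow> v \<in> carrier_vec d \<and> (\<Sum>i<d. (cmod (v $ i))^2) = 1"

definition outer :: "complex Matrix.vec \<Rightarrow> complex mat" where
  "outer v = Matrix.mat (dim_vec v) (dim_vec v) (\<lambda>(i,j). v $ i * cnj (v $ j))"

definition kron :: "complex mat \<Rightarrow> complex mat \<Rightarrow> complex mat" where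
  "kron A B = Matrix.mat (dim_row A * dim_row B) (dim_col A * dim_col B)
     (\<lambda>(i,j). A $$ (i div dim_row B, j div dim_col B) * B $$ (i mod dim_row B, j mod dim_col B))"

definition traceless_part :: "complex mat \<Rightarrow> complex mat" where
  "traceless_part Obs = Obs - (mtrace Obs / of_nat (dim_row Obs)) \<cdot>\<^sub>m 1\<^sub>m (dim_row Obs)"

text \<open>Digit k (base d) of a multi-index I < d^t; the t-fold tensor power of the rank-one
  operator |phi><phi| on C^d has entry prod_k phi(i_k) conj(phi(j_k)).\<close>
definition digit :: "nat \<Rightarrow> nat \<Rightarrow> nat \<Rightarrow> nat" where
  "digit d I k = (I div d ^ k) mod d"

definition tensor_pow_entry :: "nat \<Rightarrow> nat \<Rightarrow> (nat \<Rightarrow> complex) \<Rightarrow> nat \<Rightarrow> nat \<Rightarrow> complex" where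
  "tensor_pow_entry d t phi I J = (\<Prod>k<t. phi (digit d I k) * cnj (phi (digit d J k)))"

text \<open>Haar (unitarily invariant, uniform) measure on pure states of C^d: the pushforward of the
  normalized Lebesgue measure on the unit ball of C^d (~ R^{2d}) under the radial projection
  v \<mapsto> v/|v| onto the unit sphere.\<close>
definition cvec_space :: "nat \<Rightarrow> (nat \<Rightarrow> complex) measure" where
  "cvec_space d = PiM {..<d} (\<lambda>_. (lborel :: complex measure))"

definition vnorm :: "nat \<Rightarrow> (nat \<Rightarrow> complex) \<Rightarrow> real" where
  "vnorm d v = sqrt (\<Sum>i<d. (cmod (v i))^2)"

definition haar_state_measure :: "nat \<Rightarrow> (nat \<Rightarrow> complex) measure" where
  "haar_state_measure d =
     distr (uniform_measure (cvec_space d) {v \<in> space (cvec_space d). vnorm d v \<le> 1})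
           (cvec_space d)
           (\<lambda>v. \<lambda>i\<in>{..<d}. v i / complex_of_real (vnorm d v))"

definition haar_moment :: "nat \<Rightarrow> nat \<Rightarrow> complex mat" where
  "haar_moment d t = Matrix.mat (d^t) (d^t)
     (\<lambda>(I,J). \<integral>phi. tensor_pow_entry d t phi I J \<partial>haar_state_measure d)"

definition ensemble_moment :: "nat \<Rightarrow> nat \<Rightarrow> 'k pmf \<Rightarrow> ('k \<Rightarrow> complex Matrix.vec) \<Rightarrow> complex mat" where
  "ensemble_moment d t K psi = Matrix.mat (d^t) (d^t)
     (\<lambda>(I,J). \<integral>k. tensor_pow_entry d t (\<lambda>i. psi k $ i) I J \<partial>measure_pmf K)"

definition relative_approx_design ::
    "nat \<Rightarrow> nat \<Rightarrow> real \<Rightarrow> 'k pmf \<Rightarrow> ('k \<Rightarrow> complex Matrix.vec) \<Rightarrow> bool" where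
  "relative_approx_design d t \<epsilon> K psi \<longleftrightarrow>
     loewner_le (complex_of_real (1 - \<epsilon>) \<cdot>\<^sub>m haar_moment d t) (ensemble_moment d t K psi) \<and>
     loewner_le (ensemble_moment d t K psi) (complex_of_real (1 + \<epsilon>) \<cdot>\<^sub>m haar_moment d t)"

text \<open>Conventions: an n-qubit basis state |b> is indexed by b < 2^n, qubit j being bit j of b.
  The joint register R1 R2 has basis |a>|b> indexed by a * 2^n + b.\<close>

definition popcount :: "nat \<Rightarrow> nat" where
  "popcount m = card {j. bit m j}"

definition hadamard :: "complex mat" where
  "hadamard = Matrix.mat 2 2 (\<lambda>(i,j). (if i = 1 \<and> j = 1 then -1 else 1) / complex_of_real (sqrt 2))"

fun hadamard_pow :: "nat \<Rightarrow> complex mat" where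
  "hadamard_pow 0 = 1\<^sub>m 1"
| "hadamard_pow (Suc n) = kron hadamard (hadamard_pow n)"

text \<open>n CNOTs, qubit j of R1 controlling qubit j of R2: |a>|b> \<mapsto> |a>|a xor b>.\<close>
definition cnot_layer :: "nat \<Rightarrow> complex mat" where
  "cnot_layer n = Matrix.mat (2^n * 2^n) (2^n * 2^n)
     (\<lambda>(i,j). if i = (j div 2^n) * 2^n + ((j div 2^n) XOR (j mod 2^n)) then 1 else 0)"

definition shadow_circuit :: "nat \<Rightarrow> complex mat" where
  "shadow_circuit n = kron (hadamard_pow n) (1\<^sub>m (2^n)) * cnot_layer n"

definition outcome_prob :: "nat \<Rightarrow> complex mat \<Rightarrow> complex Matrix.vec \<Rightarrow> nat \<times> nat \<Rightarrow> real" where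
  "outcome_prob n \<rho> \<zeta> zx = (case zx of (z, x) \<Rightarrow>
     if z < 2^n \<and> x < 2^n then
       Re ((shadow_circuit n * kron \<rho> (outer \<zeta>) * adj (shadow_circuit n)) $$ (z * 2^n + x, z * 2^n + x))
     else 0)"

definition outcome_pmf :: "nat \<Rightarrow> complex mat \<Rightarrow> complex Matrix.vec \<Rightarrow> (nat \<times> nat) pmf" where
  "outcome_pmf n \<rho> \<zeta> = embed_pmf (outcome_prob n \<rho> \<zeta>)"

definition pauli_X :: "nat \<Rightarrow> nat \<Rightarrow> complex mat" where
  "pauli_X n x = Matrix.mat (2^n) (2^n) (\<lambda>(i,j). if i = j XOR x then 1 else 0)"

definition pauli_Z :: "nat \<Rightarrow> nat \<Rightarrow> complex mat" where
  "pauli_Z n z = Matrix.mat (2^n) (2^n) (\<lambda>(i,j). if i = j then (-1) ^ popcount (z AND j) else 0)"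

definition conj_vec :: "complex Matrix.vec \<Rightarrow> complex Matrix.vec" where
  "conj_vec v = Matrix.vec (dim_vec v) (\<lambda>i. cnj (v $ i))"

definition classical_shadow :: "nat \<Rightarrow> complex Matrix.vec \<Rightarrow> nat \<Rightarrow> nat \<Rightarrow> complex mat" where
  "classical_shadow n \<zeta> x z =
     of_nat (2^n + 1) \<cdot>\<^sub>m outer (conj_vec (pauli_X n x *\<^sub>v (pauli_Z n z *\<^sub>v \<zeta>))) - 1\<^sub>m (2^n)"

text \<open>Distribution of a single estimate Tr(Obs rho_hat) (real since Obs, rho_hat Hermitian).\<close>
definition single_estimate ::
    "nat \<Rightarrow> 'k pmf \<Rightarrow> ('k \<Rightarrow> complex Matrix.vec) \<Rightarrow> complex mat \<Rightarrow> complex mat \<Rightarrow> real pmf" where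
  "single_estimate n S psi Obs \<rho> =
     do { k \<leftarrow> S;
          (z, x) \<leftarrow> outcome_pmf n \<rho> (psi k);
          return_pmf (Re (mtrace (Obs * classical_shadow n (psi k) x z))) }"

fun iid_pmf :: "nat \<Rightarrow> 'a pmf \<Rightarrow> 'a list pmf" where
  "iid_pmf 0 p = return_pmf []"
| "iid_pmf (Suc m) p = do { x \<leftarrow> p; xs \<leftarrow> iid_pmf m p; return_pmf (x # xs) }"

definition mean_list :: "real list \<Rightarrow> real" where
  "mean_list xs = sum_list xs / real (length xs)"

definition median_list :: "real list \<Rightarrow> real" where
  "median_list xs = (let s = sort xs; m = length xs in
     if odd m then s ! (m div 2) else (s ! (m div 2 - 1) + s ! (m div 2)) / 2)"

definition median_of_means :: "nat \<Rightarrow> nat \<Rightarrow> real pmf \<Rightarrow> real pmf" where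
  "median_of_means L K p = map_pmf median_list (iid_pmf K (map_pmf mean_list (iid_pmf L p)))"

end

theory Submission
  imports Defs
begin

text \<open>The circuit yields the outcome (z, x) with probability <w|rho|w> / N, where N = 2^n and
  w = zeta*_{x,z}, and the estimate is then (N + 1) <w|O|w> - Tr O. Its mean and its second moment
  are thus averages over the design of products <w|P|w> <w|Q|w> <w|R|w>. For rank-one P, Q, R such a
  product is a quadratic form of the third moment operator at a product vector, so the design
  condition sandwiches it between (1 - eps) and (1 + eps) times its Haar value; writing positive
  semidefinite matrices as sums of rank-one ones extends this to rho, O and I. Expanding the centred
  square around Tr O / N into such products bounds the variance by 3 Tr(O_0^2) + 13 eps Tr(O)^2. The
  13 in place of 10 is harmless: the constant 34 leaves enough room, since a failure probability of
  1/25 per mean already suffices for the median. The Haar moments follow from the invariance of the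
  measure under phases and plane rotations.\<close>

section \<open>Invariance of the Haar measure on states\<close>

text \<open>The design condition controls products of nonnegative forms only, whereas the variance
  concerns the indefinite matrix O_0. Hence the expansion into forms of O and I. The term with a
  negative sign must take the lower design bound, so the errors of the three terms add up instead of
  cancelling: 13 = 6 + 5 + 2. At the Haar value the expansion collapses back to O_0, so no eps-free
  multiple of Tr(O)^2 survives.

  For a fixed outcome (z, x) the Pauli operator and the conjugation are moved onto the matrices. The
  Haar value does not see them, so all N^2 outcomes obey the same bounds.

  Full unitary invariance of the measure is not established. The phase \<i> on one coordinate
  detects any mismatch of indices, since an index occurs at most three times on either side of a
  third moment and \<i> has order 4. A right-angle rotation exchanges coordinates. The rotation with
  cosine 3/5 and sine 4/5, averaged with its inverse, fixes the ratios of the remaining moments, and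
  the unit norm fixes their scale.\<close>

lemma sets_cvec_space [measurable_cong]:
  "sets (cvec_space d) = sets (PiM {..<d} (\<lambda>_. borel))"
  unfolding cvec_space_def by (rule sets_PiM_cong) auto

lemma space_cvec_space: "space (cvec_space d) = PiE {..<d} (\<lambda>_. UNIV)"
  unfolding cvec_space_def by (simp add: space_PiM)

lemma measurable_cvec_component [measurable]:
  "i < d \<Longrightarrow> (\<lambda>v. v i) \<in> borel_measurable (cvec_space d)"
  unfolding measurable_cong_sets[OF sets_cvec_space refl] by simp

lemma measurable_vnorm [measurable]: "vnorm d \<in> borel_measurable (cvec_space d)"
  unfolding vnorm_def by measurable

lemma product_sigma_finite_lborel: "product_sigma_finite (\<lambda>_. lborel)"
  unfolding product_sigma_finite_def by (auto intro: sigma_finite_lborel)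

section \<open>Lebesgue measure on C^d, one coordinate at a time\<close>

lemma nn_integral_cvec_split:
  assumes p: "p < d" and f: "f \<in> borel_measurable (cvec_space d)"
  shows "(\<integral>\<^sup>+v. f v \<partial>cvec_space d) =
    (\<integral>\<^sup>+x. \<integral>\<^sup>+y. f (x(p := y)) \<partial>lborel \<partial>PiM ({..<d} - {p}) (\<lambda>_. lborel))"
proof -
  have eq: "{..<d} = insert p ({..<d} - {p})" using p by auto
  have "cvec_space d = PiM (insert p ({..<d} - {p})) (\<lambda>_. lborel)"
    unfolding cvec_space_def using eq by simp
  moreover have "f \<in> borel_measurable (PiM (insert p ({..<d} - {p})) (\<lambda>_. lborel))"
    using f eq unfolding cvec_space_def by simp
  ultimately show ?thesis
    using product_sigma_finite.product_nn_integral_insert[OF product_sigma_finite_lborel, of "{..<d} - {p}" p f]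
    by simp
qed

text \<open>Phrased with nonnegative integrals instead of \<open>distr\<close>: composition becomes
  substitution, and Tonelli applies with no integrability to check.\<close>

definition vol_preserving :: "nat \<Rightarrow> ((nat \<Rightarrow> complex) \<Rightarrow> nat \<Rightarrow> complex) \<Rightarrow> bool" where
  "vol_preserving d T \<longleftrightarrow> T \<in> cvec_space d \<rightarrow>\<^sub>M cvec_space d \<and>
     (\<forall>f \<in> borel_measurable (cvec_space d).
        (\<integral>\<^sup>+v. f (T v) \<partial>cvec_space d) = (\<integral>\<^sup>+v. (f v :: ennreal) \<partial>cvec_space d))"

lemma vol_preserving_comp:
  assumes "vol_preserving d T" "vol_preserving d U"
  shows "vol_preserving d (\<lambda>v. T (U v))"
proof -
  have m: "T \<in> cvec_space d \<rightarrow>\<^sub>M cvec_space d" "U \<in> cvec_space d \<rightarrow>\<^sub>M cvec_space d"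
    using assms unfolding vol_preserving_def by auto
  have "(\<integral>\<^sup>+v. f (T (U v)) \<partial>cvec_space d) = (\<integral>\<^sup>+v. (f v :: ennreal) \<partial>cvec_space d)"
    if f: "f \<in> borel_measurable (cvec_space d)" for f
  proof -
    have "(\<lambda>v. f (T v)) \<in> borel_measurable (cvec_space d)" using f m(1) by measurable
    then have "(\<integral>\<^sup>+v. f (T (U v)) \<partial>cvec_space d) = (\<integral>\<^sup>+v. f (T v) \<partial>cvec_space d)"
      using assms(2) unfolding vol_preserving_def by auto
    also have "\<dots> = (\<integral>\<^sup>+v. f v \<partial>cvec_space d)"
      using assms(1) f unfolding vol_preserving_def by auto
    finally show ?thesis .
  qed
  then show ?thesis unfolding vol_preserving_def using m by (auto intro: measurable_compose)
qed

lemma measurable_cvec_upd: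
  assumes "p < d" and g: "g \<in> borel_measurable (cvec_space d)"
  shows "(\<lambda>v. v(p := g v)) \<in> cvec_space d \<rightarrow>\<^sub>M cvec_space d"
  unfolding measurable_cong_sets[OF refl sets_cvec_space]
proof (rule measurable_PiM_single')
  fix i assume "i \<in> {..<d}"
  then show "(\<lambda>v. (v(p := g v)) i) \<in> borel_measurable (cvec_space d)"
    using g by (cases "i = p") auto
next
  show "(\<lambda>v. v(p := g v)) \<in> space (cvec_space d) \<rightarrow> ({..<d} \<rightarrow>\<^sub>E space borel)"
    using \<open>p < d\<close> by (auto simp: space_cvec_space PiE_def extensional_def)
qed

text \<open>By Tonelli the other coordinates can be frozen, and only the inner integral over
  coordinate \<open>p\<close> changes. The first argument of \<open>g\<close> may carry the other
  coordinates but not \<open>v p\<close>, which is what \<open>indep\<close> expresses.\<close>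

lemma vol_preserving_upd:
  assumes p: "p < d"
    and meas: "(\<lambda>v. g v (v p)) \<in> borel_measurable (cvec_space d)"
    and indep: "\<And>v y. g (v(p := y)) = g v"
    and inv: "\<And>v f. f \<in> borel_measurable borel \<Longrightarrow>
       (\<integral>\<^sup>+y. f (g v y) \<partial>lborel) = (\<integral>\<^sup>+y. (f y :: ennreal) \<partial>lborel)"
  shows "vol_preserving d (\<lambda>v. v(p := g v (v p)))"
proof -
  let ?T = "\<lambda>v. v(p := g v (v p))"
  have T: "?T \<in> cvec_space d \<rightarrow>\<^sub>M cvec_space d"
    by (rule measurable_cvec_upd[OF p meas])
  have "(\<integral>\<^sup>+v. f (?T v) \<partial>cvec_space d) = (\<integral>\<^sup>+v. (f v :: ennreal) \<partial>cvec_space d)"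
    if f: "f \<in> borel_measurable (cvec_space d)" for f
  proof -
    have "(\<lambda>v. f (?T v)) \<in> borel_measurable (cvec_space d)" using f T by measurable
    from nn_integral_cvec_split[OF p this]
    have "(\<integral>\<^sup>+v. f (?T v) \<partial>cvec_space d) =
      (\<integral>\<^sup>+x. \<integral>\<^sup>+y. f (x(p := g x y)) \<partial>lborel \<partial>PiM ({..<d} - {p}) (\<lambda>_. lborel))"
      by (simp add: indep)
    also have "\<dots> = (\<integral>\<^sup>+x. \<integral>\<^sup>+y. f (x(p := y)) \<partial>lborel \<partial>PiM ({..<d} - {p}) (\<lambda>_. lborel))"
    proof (rule nn_integral_cong)
      fix x assume x: "x \<in> space (PiM ({..<d} - {p}) (\<lambda>_. lborel :: complex measure))"
      have "(\<lambda>y. f (x(p := y))) \<in> borel_measurable borel"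
      proof (rule measurable_compose[OF _ f])
        show "(\<lambda>y. x(p := y)) \<in> borel \<rightarrow>\<^sub>M cvec_space d"
          unfolding measurable_cong_sets[OF refl sets_cvec_space]
        proof (rule measurable_PiM_single')
          fix i assume "i \<in> {..<d}"
          then show "(\<lambda>y. (x(p := y)) i) \<in> borel \<rightarrow>\<^sub>M (borel :: complex measure)"
            by (cases "i = p") auto
        next
          show "(\<lambda>y. x(p := y)) \<in> space borel \<rightarrow> ({..<d} \<rightarrow>\<^sub>E space borel)"
            using x p by (auto simp: space_PiM PiE_def extensional_def)
        qed
      qed
      then show "(\<integral>\<^sup>+y. f (x(p := g x y)) \<partial>lborel) = (\<integral>\<^sup>+y. f (x(p := y)) \<partial>lborel)"
        by (rule inv[of "\<lambda>y. f (x(p := y))"])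
    qed
    also have "\<dots> = (\<integral>\<^sup>+v. f v \<partial>cvec_space d)"
      by (rule nn_integral_cvec_split[OF p f, symmetric])
    finally show ?thesis .
  qed
  then show ?thesis unfolding vol_preserving_def using T by auto
qed

text \<open>While \<open>v q\<close> is frozen, the update is a translation of the coordinate
  \<open>p\<close>.\<close>

lemma vol_preserving_shear:
  assumes "p < d" "q < d" "p \<noteq> q"
  shows "vol_preserving d (\<lambda>v. v(p := v p + t * v q))"
proof -
  have "vol_preserving d (\<lambda>v. v(p := (\<lambda>w y. y + t * w q) v (v p)))"
  proof (rule vol_preserving_upd)
    fix v :: "nat \<Rightarrow> complex" and f :: "complex \<Rightarrow> ennreal"
    assume f: "f \<in> borel_measurable borel"
    have "(\<integral>\<^sup>+y. f (y + t * v q) \<partial>lborel) = (\<integral>\<^sup>+y. f y \<partial>distr lborel borel ((+) (t * v q)))"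
      using f by (subst nn_integral_distr) (auto simp: add.commute)
    then show "(\<integral>\<^sup>+y. f (y + t * v q) \<partial>lborel) = (\<integral>\<^sup>+y. f y \<partial>lborel)"
      by (simp add: lborel_distr_plus)
  qed (use assms in auto)
  then show ?thesis by simp
qed

text \<open>A quarter turn maps axis-parallel boxes to axis-parallel boxes with exchanged sides, so
  it is enough to compare volumes of boxes. A general angle does not allow this.\<close>

lemma lborel_distr_times_ii: "distr lborel borel ((*) \<i>) = (lborel :: complex measure)"
proof (rule lborel_eqI[symmetric])
  fix l u :: complex
  assume le: "\<And>b. b \<in> Basis \<Longrightarrow> l \<bullet> b \<le> u \<bullet> b"
  have le': "Re l \<le> Re u" "Im l \<le> Im u" using le[of 1] le[of \<i>] by (auto simp: Basis_complex_def)
  have [measurable]: "(*) \<i> \<in> borel_measurable borel" by simp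
  have eq: "(*) \<i> -` box l u = box (Complex (Im l) (- Re u)) (Complex (Im u) (- Re l))"
    by (auto simp: box_def Basis_complex_def)
  have "emeasure (distr lborel borel ((*) \<i>)) (box l u)
      = emeasure lborel (box (Complex (Im l) (- Re u)) (Complex (Im u) (- Re l)))"
    by (subst emeasure_distr) (auto simp: eq)
  also have "\<dots> = (\<Prod>b\<in>Basis. (Complex (Im u) (- Re l) - Complex (Im l) (- Re u)) \<bullet> b)"
    using le' by (intro emeasure_lborel_box) (auto simp: Basis_complex_def)
  also have "\<dots> = (\<Prod>b\<in>Basis. (u - l) \<bullet> b)"
    by (simp add: Basis_complex_def mult.commute)
  finally show "emeasure (distr lborel borel ((*) \<i>)) (box l u) = (\<Prod>b\<in>Basis. (u - l) \<bullet> b)" .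
qed auto

lemma vol_preserving_phase:
  assumes "p < d"
  shows "vol_preserving d (\<lambda>v. v(p := \<i> * v p))"
proof -
  have "vol_preserving d (\<lambda>v. v(p := (\<lambda>w y. \<i> * y) v (v p)))"
  proof (rule vol_preserving_upd)
    fix v :: "nat \<Rightarrow> complex" and f :: "complex \<Rightarrow> ennreal"
    assume f: "f \<in> borel_measurable borel"
    have "(\<integral>\<^sup>+y. f (\<i> * y) \<partial>lborel) = (\<integral>\<^sup>+y. f y \<partial>distr lborel borel ((*) \<i>))"
      using f by (subst nn_integral_distr) auto
    then show "(\<integral>\<^sup>+y. f (\<i> * y) \<partial>lborel) = (\<integral>\<^sup>+y. f y \<partial>lborel)"
      by (simp add: lborel_distr_times_ii)
  qed (use assms in auto)
  then show ?thesis by simp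
qed

definition rot :: "nat \<Rightarrow> nat \<Rightarrow> real \<Rightarrow> real \<Rightarrow> (nat \<Rightarrow> complex) \<Rightarrow> nat \<Rightarrow> complex" where
  "rot p q c s v = v(p := c * v p - s * v q, q := s * v p + c * v q)"

text \<open>A rotation is a product of three shears, so its invariance needs no change of variables.\<close>
lemma vol_preserving_rot:
  assumes "p < d" "q < d" "p \<noteq> q" "s \<noteq> 0" "c\<^sup>2 + s\<^sup>2 = 1"
  shows "vol_preserving d (rot p q c s)"
proof -
  \<comment> \<open>With c = cos a and s = sin a this is - tan (a / 2), the coefficient of the two
    outer shears in the classical factorisation of a rotation; the middle shear has coefficient
    s.\<close>
  define t :: complex where "t = of_real ((c - 1) / s)"
  have ts: "t * s = c - 1" using assms(4) by (simp add: t_def)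
  have "c * c = 1 - s * s" using assms(5) by (simp add: power2_eq_square)
  then have cc: "complex_of_real c * c = 1 - of_real s * of_real s"
    by (metis of_real_1 of_real_diff of_real_mult)
  have "s * (t + c * t + s) = (of_real s :: complex) * 0"
  proof -
    have "s * (t + c * t + s) = t * s + c * (t * s) + of_real s * of_real s" by (simp add: algebra_simps)
    also have "\<dots> = (of_real c * of_real c + of_real s * of_real s) - 1"
      unfolding ts by (simp add: algebra_simps)
    also have "\<dots> = 0" unfolding cc by simp
    finally show ?thesis by simp
  qed
  then have tc: "t + c * t = - s" using assms(4) by (simp add: add_eq_0_iff2)
  have eq: "rot p q c s v = (\<lambda>v. v(p := v p + t * v q)) ((\<lambda>v. v(q := v q + of_real s * v p))
      ((\<lambda>v. v(p := v p + t * v q)) v))" for v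
  proof
    fix i
    have 1: "v p + t * v q + t * (v q + s * (v p + t * v q)) = c * v p - s * v q"
    proof -
      have "v p + t * v q + t * (v q + s * (v p + t * v q))
          = v p + (t * s) * v p + (t + t * s * t + t) * v q" by (simp add: algebra_simps)
      also have "\<dots> = c * v p + (t + c * t) * v q" unfolding ts by (simp add: algebra_simps)
      finally show ?thesis by (simp add: tc)
    qed
    have 2: "v q + s * (v p + t * v q) = s * v p + c * v q"
    proof -
      have "v q + s * (v p + t * v q) = s * v p + (1 + t * s) * v q" by (simp add: algebra_simps)
      then show ?thesis unfolding ts by simp
    qed
    show "rot p q c s v i = (\<lambda>v. v(p := v p + t * v q)) ((\<lambda>v. v(q := v q + of_real s * v p))
      ((\<lambda>v. v(p := v p + t * v q)) v)) i"
      using assms(3) by (auto simp: rot_def 2 1[unfolded 2])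
  qed
  note pq = vol_preserving_shear[OF assms(1-3), of t]
  note qp = vol_preserving_shear[OF assms(2) assms(1) assms(3)[symmetric], of "of_real s"]
  from vol_preserving_comp[OF pq vol_preserving_comp[OF qp pq]]
show ?thesis unfolding eq[abs_def] .
qed

section \<open>The radial projection and the symmetries that survive it\<close>

definition unit_ball :: "nat \<Rightarrow> (nat \<Rightarrow> complex) set" where
  "unit_ball d = {v \<in> space (cvec_space d). vnorm d v \<le> 1}"

definition radial :: "nat \<Rightarrow> (nat \<Rightarrow> complex) \<Rightarrow> nat \<Rightarrow> complex" where
  "radial d v = (\<lambda>i\<in>{..<d}. v i / complex_of_real (vnorm d v))"

lemma haar_alt: "haar_state_measure d =
    distr (uniform_measure (cvec_space d) (unit_ball d)) (cvec_space d) (radial d)"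
  unfolding haar_state_measure_def unit_ball_def radial_def ..

lemma sets_haar [measurable_cong]: "sets (haar_state_measure d) = sets (cvec_space d)"
  unfolding haar_alt by simp

lemma unit_ball_sets [measurable]: "unit_ball d \<in> sets (cvec_space d)"
  unfolding unit_ball_def by measurable

lemma radial_measurable [measurable]: "radial d \<in> cvec_space d \<rightarrow>\<^sub>M cvec_space d"
  unfolding measurable_cong_sets[OF refl sets_cvec_space] radial_def
  by measurable

lemma nn_integral_haar:
  assumes [measurable]: "f \<in> borel_measurable (cvec_space d)"
  shows "(\<integral>\<^sup>+v. f v \<partial>haar_state_measure d) =
    (\<integral>\<^sup>+v. f (radial d v) * indicator (unit_ball d) v \<partial>cvec_space d) / emeasure (cvec_space d) (unit_ball d)"
  unfolding haar_alt by (subst nn_integral_distr) (auto simp: nn_integral_uniform_measure)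

definition haar_symmetry :: "nat \<Rightarrow> ((nat \<Rightarrow> complex) \<Rightarrow> nat \<Rightarrow> complex) \<Rightarrow> bool" where
  "haar_symmetry d T \<longleftrightarrow> vol_preserving d T \<and>
     (\<forall>v \<in> space (cvec_space d). vnorm d (T v) = vnorm d v \<and> radial d (T v) = T (radial d v))"

text \<open>Substituting \<open>T v\<close> for \<open>v\<close> changes neither the volume nor the
  ball, and since \<open>T\<close> commutes with \<open>radial\<close> it can be pulled through the
  projection.\<close>

lemma distr_haar_symmetry:
  assumes "haar_symmetry d T"
  shows "distr (haar_state_measure d) (haar_state_measure d) T = haar_state_measure d"
proof (rule measure_eqI)
  have T [measurable]: "T \<in> cvec_space d \<rightarrow>\<^sub>M cvec_space d"
    and vp: "\<And>f. f \<in> borel_measurable (cvec_space d) \<Longrightarrow>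
      (\<integral>\<^sup>+v. f (T v) \<partial>cvec_space d) = (\<integral>\<^sup>+v. (f v :: ennreal) \<partial>cvec_space d)"
    using assms unfolding haar_symmetry_def vol_preserving_def by auto
  have iso: "vnorm d (T v) = vnorm d v" "radial d (T v) = T (radial d v)"
    if "v \<in> space (cvec_space d)" for v
    using assms that unfolding haar_symmetry_def by auto
  fix A assume "A \<in> sets (distr (haar_state_measure d) (haar_state_measure d) T)"
  then have A [measurable]: "A \<in> sets (cvec_space d)" by (simp add: sets_haar)
  let ?f = "\<lambda>v. indicator A (radial d v) * indicator (unit_ball d) v :: ennreal"
  have "emeasure (distr (haar_state_measure d) (haar_state_measure d) T) A
     = (\<integral>\<^sup>+v. indicator A v \<partial>distr (haar_state_measure d) (haar_state_measure d) T)"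
    by (subst nn_integral_indicator) (auto simp: A sets_haar)
  also have "\<dots> = (\<integral>\<^sup>+v. indicator A (T v) \<partial>haar_state_measure d)"
    by (subst nn_integral_distr) (auto cong: measurable_cong_sets)
  also have "\<dots> = (\<integral>\<^sup>+v. indicator A (T (radial d v)) * indicator (unit_ball d) v \<partial>cvec_space d)
      / emeasure (cvec_space d) (unit_ball d)"
    by (rule nn_integral_haar) measurable
  also have "(\<integral>\<^sup>+v. indicator A (T (radial d v)) * indicator (unit_ball d) v \<partial>cvec_space d)
      = (\<integral>\<^sup>+v. ?f (T v) \<partial>cvec_space d)"
  proof (rule nn_integral_cong)
    fix v assume v: "v \<in> space (cvec_space d)"
    then have "T v \<in> space (cvec_space d)" using measurable_space[OF T] by auto
    then show "indicator A (T (radial d v)) * indicator (unit_ball d) v = ?f (T v)"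
      using v iso[OF v] by (auto simp: unit_ball_def indicator_def)
  qed
  also have "\<dots> = (\<integral>\<^sup>+v. ?f v \<partial>cvec_space d)"
    by (rule vp) measurable
  also have "\<dots> / emeasure (cvec_space d) (unit_ball d) = (\<integral>\<^sup>+v. indicator A v \<partial>haar_state_measure d)"
    by (rule nn_integral_haar[symmetric]) measurable
  also have "\<dots> = emeasure (haar_state_measure d) A"
    by (subst nn_integral_indicator) (auto simp: A sets_haar)
  finally show "emeasure (distr (haar_state_measure d) (haar_state_measure d) T) A
    = emeasure (haar_state_measure d) A" .
qed simp

lemma integral_haar_symmetry:
  fixes f :: "(nat \<Rightarrow> complex) \<Rightarrow> 'b :: {banach, second_countable_topology}"
  assumes "haar_symmetry d T" and f: "f \<in> borel_measurable (cvec_space d)"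
  shows "(\<integral>v. f (T v) \<partial>haar_state_measure d) = (\<integral>v. f v \<partial>haar_state_measure d)"
proof -
  have [measurable]: "T \<in> cvec_space d \<rightarrow>\<^sub>M cvec_space d"
    using assms unfolding haar_symmetry_def vol_preserving_def by auto
  note f[measurable]
  have "(\<integral>v. f v \<partial>distr (haar_state_measure d) (haar_state_measure d) T)
      = (\<integral>v. f (T v) \<partial>haar_state_measure d)"
    by (rule integral_distr) measurable
  then show ?thesis using distr_haar_symmetry[OF assms(1)] by simp
qed

lemma haar_symmetry_phase:
  assumes p: "p < d"
  shows "haar_symmetry d (\<lambda>v. v(p := \<i> * v p))"
proof -
  have n: "vnorm d (v(p := \<i> * v p)) = vnorm d v" for v
    unfolding vnorm_def by (intro arg_cong[where f=sqrt] sum.cong) (auto simp: norm_mult)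
  have "radial d (v(p := \<i> * v p)) = (radial d v)(p := \<i> * radial d v p)" for v
    using p by (auto simp: radial_def n)
  then show ?thesis
    unfolding haar_symmetry_def using vol_preserving_phase[OF p] n by auto
qed

lemma cmod_rot_sum:
  fixes x y :: complex and c s :: real
  assumes "c\<^sup>2 + s\<^sup>2 = 1"
  shows "(cmod (c * x - s * y))\<^sup>2 + (cmod (s * x + c * y))\<^sup>2 = (cmod x)\<^sup>2 + (cmod y)\<^sup>2"
proof -
  have "(cmod (c * x - s * y))\<^sup>2 + (cmod (s * x + c * y))\<^sup>2
      = (c\<^sup>2 + s\<^sup>2) * ((cmod x)\<^sup>2 + (cmod y)\<^sup>2)"
    unfolding cmod_power2 by (simp add: power2_eq_square algebra_simps)
  then show ?thesis using assms by simp
qed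

lemma haar_symmetry_rot:
  assumes "p < d" "q < d" "p \<noteq> q" "s \<noteq> 0" "c\<^sup>2 + s\<^sup>2 = 1"
  shows "haar_symmetry d (rot p q c s)"
proof -
  have eq: "{..<d} = insert p (insert q ({..<d} - {p, q}))" using assms by auto
  have n: "vnorm d (rot p q c s v) = vnorm d v" for v
  proof -
    have "(\<Sum>i<d. (cmod (rot p q c s v i))\<^sup>2) = (\<Sum>i<d. (cmod (v i))\<^sup>2)"
      using assms(3) cmod_rot_sum[OF assms(5), of "v p" "v q"]
      by (subst (1 2) eq) (auto simp: rot_def intro!: sum.cong)
    then show ?thesis unfolding vnorm_def by simp
  qed
  have "radial d (rot p q c s v) = rot p q c s (radial d v)" for v
    using assms(1-3) unfolding radial_def n
    by (auto simp: rot_def fun_eq_iff diff_divide_distrib add_divide_distrib)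
  then show ?thesis
    unfolding haar_symmetry_def using vol_preserving_rot[OF assms] n by auto
qed

text \<open>Makes the uniform measure a probability measure. The ball is squeezed between two
  polydiscs, whose volume is a power of the area of a disc; with the radius 1 / (d + 1) the d
  squares sum to at most 1.\<close>

lemma unit_ball_emeasure:
  shows "emeasure (cvec_space d) (unit_ball d) \<noteq> 0" "emeasure (cvec_space d) (unit_ball d) \<noteq> \<infinity>"
proof -
  define r :: real where "r = 1 / (real d + 1)"
  have r: "r > 0" by (simp add: r_def)
  let ?A = "PiE {..<d} (\<lambda>_. ball (0::complex) r)" and ?B = "PiE {..<d} (\<lambda>_. ball (0::complex) 2)"
  have em: "emeasure (cvec_space d) (PiE {..<d} (\<lambda>_. ball (0::complex) t)) = (emeasure lborel (ball (0::complex) t)) ^ d" for t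
    unfolding cvec_space_def
    by (subst product_sigma_finite.emeasure_PiM[OF product_sigma_finite_lborel]) auto
  have "?A \<subseteq> unit_ball d"
  proof
    fix v assume v: "v \<in> ?A"
    have "(\<Sum>i<d. (cmod (v i))\<^sup>2) \<le> (\<Sum>i<d. r\<^sup>2)"
      using v by (intro sum_mono power_mono) (auto simp: PiE_def Pi_def intro: less_imp_le)
    also have "\<dots> = real d / (real d + 1)\<^sup>2" by (simp add: r_def power_divide)
    also have "\<dots> \<le> 1" by (simp add: divide_le_eq power2_eq_square algebra_simps)
    finally have "vnorm d v \<le> 1" unfolding vnorm_def by simp
    then show "v \<in> unit_ball d" using v by (auto simp: unit_ball_def space_cvec_space PiE_def)
  qed
  moreover have "?A \<in> sets (cvec_space d)" unfolding sets_cvec_space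
    by (intro sets_PiM_I_finite) auto
  ultimately have "emeasure (cvec_space d) ?A \<le> emeasure (cvec_space d) (unit_ball d)"
    by (intro emeasure_mono) auto
  moreover have "emeasure (cvec_space d) ?A \<noteq> 0"
  proof -
    have "emeasure lborel (ball (0::complex) r) \<noteq> 0"
    proof
      assume "emeasure lborel (ball (0::complex) r) = 0"
      then have "ball (0::complex) r \<in> null_sets lborel" by auto
      then have "negligible (ball (0::complex) r)" using null_sets_completionI negligible_iff_null_sets by blast
      then show False using r by (simp add: open_not_negligible)
    qed
    then show ?thesis unfolding em by simp
  qed
  ultimately show "emeasure (cvec_space d) (unit_ball d) \<noteq> 0" by auto
  have "unit_ball d \<subseteq> ?B"
  proof
    fix v assume v: "v \<in> unit_ball d"
    have "cmod (v i) < 2" if i: "i < d" for i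
    proof -
      have "(cmod (v i))\<^sup>2 \<le> (\<Sum>i<d. (cmod (v i))\<^sup>2)" using i by (intro member_le_sum) auto
      also have "\<dots> \<le> 1" using v unfolding unit_ball_def vnorm_def by simp
      finally have "cmod (v i) \<le> 1" by (simp add: abs_square_le_1[of "cmod (v i)"])
      then show ?thesis by simp
    qed
    then show "v \<in> ?B" using v by (auto simp: unit_ball_def space_cvec_space PiE_def)
  qed
  then have "emeasure (cvec_space d) (unit_ball d) \<le> emeasure (cvec_space d) ?B"
    by (intro emeasure_mono) (auto simp: sets_cvec_space intro!: sets_PiM_I_finite)
  moreover have "emeasure (cvec_space d) ?B < \<infinity>"
    unfolding em using emeasure_lborel_ball_finite[of "0::complex" 2] by (simp add: power_less_top_ennreal)
  ultimately show "emeasure (cvec_space d) (unit_ball d) \<noteq> \<infinity>" by auto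
qed

lemma prob_space_haar: "prob_space (haar_state_measure d)"
  unfolding haar_alt
  by (intro prob_space.prob_space_distr prob_space_uniform_measure unit_ball_emeasure)
     (auto cong: measurable_cong_sets)

lemma vnorm_eq_0_iff: "vnorm d v = 0 \<longleftrightarrow> (\<forall>i<d. v i = 0)"
  unfolding vnorm_def by (auto simp: sum_nonneg_eq_0_iff)

lemma radial_norm:
  "(\<Sum>i<d. (cmod (radial d v i))\<^sup>2) = (if vnorm d v = 0 then 0 else 1)"
proof -
  have "(\<Sum>i<d. (cmod (radial d v i))\<^sup>2) = (\<Sum>i<d. (cmod (v i))\<^sup>2 / (vnorm d v)\<^sup>2)"
    by (intro sum.cong) (auto simp: radial_def norm_divide power_divide)
  also have "\<dots> = (vnorm d v)\<^sup>2 / (vnorm d v)\<^sup>2"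
    unfolding sum_divide_distrib[symmetric] by (simp add: vnorm_def sum_nonneg)
  finally show ?thesis by auto
qed

text \<open>Only the zero vector fails to be normalised, because division by zero gives 0 there. It
  lies in the set of vectors with vanishing coordinate 0, a product set with one null
  factor.\<close>

lemma AE_haar_norm:
  assumes "d > 0"
  shows "AE v in haar_state_measure d. (\<Sum>i<d. (cmod (v i))\<^sup>2) = 1"
proof -
  let ?Z = "PiE {..<d} (\<lambda>i. if i = 0 then {0::complex} else UNIV)"
  have "?Z \<in> null_sets (cvec_space d)"
  proof (rule null_setsI)
    have "emeasure (cvec_space d) ?Z = (\<Prod>i<d. emeasure lborel (if i = 0 then {0::complex} else UNIV))"
      unfolding cvec_space_def
      by (subst product_sigma_finite.emeasure_PiM[OF product_sigma_finite_lborel]) auto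
    also have "\<dots> = 0" using assms by (intro prod_zero) (auto intro!: bexI[of _ 0])
    finally show "emeasure (cvec_space d) ?Z = 0" .
    show "?Z \<in> sets (cvec_space d)" unfolding sets_cvec_space
      by (intro sets_PiM_I_finite) auto
  qed
  then have "AE v in cvec_space d. v \<notin> ?Z" by (rule AE_not_in)
  then have ae: "AE v in cvec_space d. (\<Sum>i<d. (cmod (radial d v i))\<^sup>2) = 1"
    by (rule AE_mp) (auto intro!: AE_I2 simp: radial_norm vnorm_eq_0_iff space_cvec_space PiE_def split: if_splits)
  show ?thesis
    unfolding haar_alt
  proof (subst AE_distr_iff)
    show "AE v in uniform_measure (cvec_space d) (unit_ball d). (\<Sum>i<d. (cmod (radial d v i))\<^sup>2) = 1"
      by (rule AE_uniform_measureI) (use ae in auto)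
  qed (auto cong: measurable_cong_sets)
qed

section \<open>Third moments of the Haar measure\<close>

text \<open>A class closed under the operations that build polynomials in the coordinates and their
  conjugates, so that integrability of every moment follows by introduction rules. The bound holds
  almost everywhere only, since the measure lives on all of C^d and not on the sphere as a
  type.\<close>

definition haar_bounded :: "nat \<Rightarrow> ((nat \<Rightarrow> complex) \<Rightarrow> 'b :: {banach, second_countable_topology, real_normed_field}) \<Rightarrow> bool" where
  "haar_bounded d f \<longleftrightarrow> f \<in> borel_measurable (cvec_space d) \<and>
     (\<exists>B. AE v in haar_state_measure d. norm (f v) \<le> B)"

lemma haar_bounded_integrable:
  assumes "haar_bounded d f"
  shows "integrable (haar_state_measure d) f"
proof -
  interpret prob_space "haar_state_measure d" by (rule prob_space_haar)
  obtain B where "AE v in haar_state_measure d. norm (f v) \<le> B"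
    using assms unfolding haar_bounded_def by auto
  moreover have "f \<in> borel_measurable (haar_state_measure d)"
    using assms unfolding haar_bounded_def by (auto cong: measurable_cong_sets simp: sets_haar)
  ultimately show ?thesis by (rule integrable_const_bound)
qed

lemma haar_bounded_const: "haar_bounded d (\<lambda>_. c)"
  unfolding haar_bounded_def by auto

lemma haar_bounded_mult:
  assumes "haar_bounded d f" "haar_bounded d g"
  shows "haar_bounded d (\<lambda>v. f v * g v)"
proof -
  obtain B C where B: "AE v in haar_state_measure d. norm (f v) \<le> B"
    and C: "AE v in haar_state_measure d. norm (g v) \<le> C"
    using assms unfolding haar_bounded_def by auto
  from B C have "AE v in haar_state_measure d. norm (f v * g v) \<le> \<bar>B\<bar> * \<bar>C\<bar>"
    by eventually_elim (auto simp: norm_mult intro!: mult_mono)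
  then show ?thesis using assms unfolding haar_bounded_def by auto
qed

lemma haar_bounded_add:
  assumes "haar_bounded d f" "haar_bounded d g"
  shows "haar_bounded d (\<lambda>v. f v + g v)"
proof -
  obtain B C where B: "AE v in haar_state_measure d. norm (f v) \<le> B"
    and C: "AE v in haar_state_measure d. norm (g v) \<le> C"
    using assms unfolding haar_bounded_def by auto
  from B C have "AE v in haar_state_measure d. norm (f v + g v) \<le> B + C"
    by eventually_elim (rule norm_triangle_mono)
  then show ?thesis using assms unfolding haar_bounded_def by auto
qed

lemma haar_bounded_power: "haar_bounded d f \<Longrightarrow> haar_bounded d (\<lambda>v. f v ^ m)"
  by (induction m) (auto intro: haar_bounded_const haar_bounded_mult)

lemma haar_bounded_sum:
  "(\<And>i. i \<in> A \<Longrightarrow> haar_bounded d (f i)) \<Longrightarrow> haar_bounded d (\<lambda>v. \<Sum>i\<in>A. f i v)"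
  by (induction A rule: infinite_finite_induct) (auto intro: haar_bounded_const haar_bounded_add)

lemma haar_bounded_prod:
  "(\<And>i. i \<in> A \<Longrightarrow> haar_bounded d (f i)) \<Longrightarrow> haar_bounded d (\<lambda>v. \<Prod>i\<in>A. f i v)"
  by (induction A rule: infinite_finite_induct) (auto intro: haar_bounded_const haar_bounded_mult)

lemma AE_haar_component_le:
  assumes "i < d"
  shows "AE v in haar_state_measure d. cmod (v i) \<le> 1"
proof -
  have "AE v in haar_state_measure d. (\<Sum>i<d. (cmod (v i))\<^sup>2) = 1"
    using assms by (intro AE_haar_norm) auto
  then show ?thesis
  proof eventually_elim
    case (elim v)
    have "(cmod (v i))\<^sup>2 \<le> (\<Sum>i<d. (cmod (v i))\<^sup>2)" using assms by (intro member_le_sum) auto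
    then show ?case using elim by (simp add: abs_square_le_1[of "cmod (v i)"])
  qed
qed

lemma haar_bounded_component: "i < d \<Longrightarrow> haar_bounded d (\<lambda>v. v i)"
  unfolding haar_bounded_def using AE_haar_component_le by auto

lemma haar_bounded_cnj: "haar_bounded d f \<Longrightarrow> haar_bounded d (\<lambda>v. cnj (f v))"
  unfolding haar_bounded_def
  by (auto intro!: measurable_compose[OF _ borel_measurable_continuous_onI[of cnj]] continuous_on_cnj continuous_on_id)

lemma haar_bounded_cmod: "haar_bounded d f \<Longrightarrow> haar_bounded d (\<lambda>v. cmod (f v))"
  unfolding haar_bounded_def by auto

lemma haar_bounded_Re:
  assumes "haar_bounded d f" shows "haar_bounded d (\<lambda>v. Re (f v))"
proof -
  obtain B where "AE v in haar_state_measure d. cmod (f v) \<le> B"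
    using assms unfolding haar_bounded_def by auto
  then have "AE v in haar_state_measure d. norm (Re (f v)) \<le> B"
    by eventually_elim (metis abs_Re_le_cmod order_trans real_norm_def)
  then show ?thesis using assms unfolding haar_bounded_def by auto
qed

lemmas haar_bounded_intros = haar_bounded_const haar_bounded_mult haar_bounded_add haar_bounded_power
  haar_bounded_sum haar_bounded_prod haar_bounded_component haar_bounded_cnj haar_bounded_cmod haar_bounded_Re

abbreviation hE :: "nat \<Rightarrow> ((nat \<Rightarrow> complex) \<Rightarrow> 'b :: {banach, second_countable_topology}) \<Rightarrow> 'b" where
  "hE d f \<equiv> integral\<^sup>L (haar_state_measure d) f"

lemma hE_rot:
  assumes "p < d" "q < d" "p \<noteq> q" "s \<noteq> 0" "c\<^sup>2 + s\<^sup>2 = 1" "haar_bounded d f"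
  shows "hE d (\<lambda>v. f (rot p q c s v)) = hE d f"
  using integral_haar_symmetry[OF haar_symmetry_rot[OF assms(1-5)]] assms(6)
  unfolding haar_bounded_def by blast

lemma hE_phase:
  assumes "p < d" "haar_bounded d f"
  shows "hE d (\<lambda>v. f (v(p := \<i> * v p))) = hE d f"
  using integral_haar_symmetry[OF haar_symmetry_phase[OF assms(1)]] assms(2)
  unfolding haar_bounded_def by blast

section \<open>Third moments of the squared moduli\<close>

definition wt :: "nat \<Rightarrow> (nat \<Rightarrow> complex) \<Rightarrow> real" where
  "wt i v = (cmod (v i))\<^sup>2"

lemma haar_bounded_wt: "i < d \<Longrightarrow> haar_bounded d (wt i)"
  unfolding wt_def by (intro haar_bounded_intros)

lemma wt_rot:
  assumes "p \<noteq> q"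
  shows "wt p (rot p q c s v) = c\<^sup>2 * wt p v + s\<^sup>2 * wt q v - 2 * c * s * Re (v p * cnj (v q))"
    and "k \<noteq> p \<Longrightarrow> k \<noteq> q \<Longrightarrow> wt k (rot p q c s v) = wt k v"
    and "wt p (rot p q 0 1 v) = wt q v" "wt q (rot p q 0 1 v) = wt p v"
  using assms unfolding wt_def rot_def cmod_power2
  by (auto simp: power2_eq_square algebra_simps)

text \<open>A right-angle rotation exchanges two coordinates up to a sign that \<open>wt\<close>
  does not see, so exchanging coordinates needs no invariance proof of its own.\<close>

lemma hE_swap:
  assumes "p < d" "q < d" "p \<noteq> q" "haar_bounded d f"
  shows "hE d (\<lambda>v. f (rot p q 0 1 v)) = hE d f"
  using assms by (intro hE_rot) auto

text \<open>The phase \<open>v q \<mapsto> \<i> * v q\<close> turns the real part of \<open>v p * cnj (v q)\<close> into its imaginary part.\<close>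
lemma hE_Re_squared:
  assumes pq: "p < d" "q < d" "p \<noteq> q" and "r < d"
  shows "hE d (\<lambda>v. wt r v * (Re (v p * cnj (v q)))\<^sup>2) = hE d (\<lambda>v. wt r v * wt p v * wt q v) / 2"
proof -
  let ?R = "\<lambda>v. wt r v * (Re (v p * cnj (v q)))\<^sup>2"
  let ?I = "\<lambda>v. ?R (v(q := \<i> * v q))"
  have bd: "haar_bounded d ?R"
    using assms by (intro haar_bounded_intros haar_bounded_wt)
  have I: "?I v = wt r v * wt p v * wt q v - ?R v" for v
    using assms(3) by (simp add: wt_def cmod_power2 norm_mult) (simp add: power2_eq_square algebra_simps)
  have bp: "haar_bounded d (\<lambda>v. wt r v * wt p v * wt q v)"
    using assms by (intro haar_bounded_intros haar_bounded_wt)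
  have "hE d ?R = hE d ?I" by (rule hE_phase[OF pq(2) bd, symmetric])
  also have "\<dots> = hE d (\<lambda>v. wt r v * wt p v * wt q v - ?R v)" unfolding I ..
  also have "\<dots> = hE d (\<lambda>v. wt r v * wt p v * wt q v) - hE d ?R"
    by (intro Bochner_Integration.integral_diff haar_bounded_integrable bd bp)
  finally show ?thesis by simp
qed

lemma hE_wt_swap:
  assumes pq: "p < d" "q < d" "p \<noteq> q"
  shows "hE d (\<lambda>v. wt p v ^ 3) = hE d (\<lambda>v. wt q v ^ 3)"
    and "hE d (\<lambda>v. wt p v ^ 2 * wt q v) = hE d (\<lambda>v. wt q v ^ 2 * wt p v)"
    and "k < d \<Longrightarrow> k \<noteq> p \<Longrightarrow> k \<noteq> q \<Longrightarrow> hE d (\<lambda>v. wt k v * wt p v ^ 2) = hE d (\<lambda>v. wt k v * wt q v ^ 2)"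
  using hE_swap[OF pq, of "\<lambda>v. wt q v ^ 3"] hE_swap[OF pq, of "\<lambda>v. wt q v ^ 2 * wt p v"]
    hE_swap[OF pq, of "\<lambda>v. wt k v * wt q v ^ 2"] pq
  by (simp_all add: wt_rot haar_bounded_intros haar_bounded_wt)

text \<open>Adding a rotation and its inverse cancels the odd powers of the cross term
  \<open>Re (v p * cnj (v q))\<close> once a power is expanded. The triple 3, 4, 5 keeps the
  coefficients rational. The first argument of \<open>f\<close> carries factors at coordinates that
  the rotation leaves alone.\<close>

lemma hE_wt_rot:
  assumes pq: "p < d" "q < d" "p \<noteq> q" and f: "haar_bounded d (\<lambda>v. f v (wt p v))"
    and inv: "\<And>v c s. f (rot p q c s v) = f v"
  shows "2 * hE d (\<lambda>v. f v (wt p v)) =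
     hE d (\<lambda>v. f v (9/25 * wt p v + 16/25 * wt q v - 24/25 * Re (v p * cnj (v q))) +
       (f v (9/25 * wt p v + 16/25 * wt q v + 24/25 * Re (v p * cnj (v q))) :: real))"
proof -
  have m: "rot p q c s \<in> cvec_space d \<rightarrow>\<^sub>M cvec_space d" if "c\<^sup>2 + s\<^sup>2 = 1" "s \<noteq> 0" for c s
    using haar_symmetry_rot[OF pq] that unfolding haar_symmetry_def vol_preserving_def by auto
  have i: "integrable (haar_state_measure d) (\<lambda>v. f (rot p q c s v) (wt p (rot p q c s v)))"
    if cs: "c\<^sup>2 + s\<^sup>2 = 1" "s \<noteq> 0" for c s
  proof -
    have "integrable (distr (haar_state_measure d) (haar_state_measure d) (rot p q c s)) (\<lambda>v. f v (wt p v))"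
      using distr_haar_symmetry[OF haar_symmetry_rot[OF pq cs(2,1)]] haar_bounded_integrable[OF f] by simp
    then show ?thesis
      by (rule integrable_distr[rotated]) (use m[OF cs] in \<open>auto cong: measurable_cong_sets simp: sets_haar\<close>)
  qed
  have cs1: "(3/5::real)\<^sup>2 + (4/5)\<^sup>2 = 1" and cs2: "(3/5::real)\<^sup>2 + (- 4/5)\<^sup>2 = 1"
    by (simp_all add: power2_eq_square)
  have "2 * hE d (\<lambda>v. f v (wt p v)) = hE d (\<lambda>v. f (rot p q (3/5) (4/5) v) (wt p (rot p q (3/5) (4/5) v)))
     + hE d (\<lambda>v. f (rot p q (3/5) (- 4/5) v) (wt p (rot p q (3/5) (- 4/5) v)))"
    using hE_rot[OF pq _ cs1 f] hE_rot[OF pq _ cs2 f] by simp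
  also have "\<dots> = hE d (\<lambda>v. f (rot p q (3/5) (4/5) v) (wt p (rot p q (3/5) (4/5) v))
     + f (rot p q (3/5) (- 4/5) v) (wt p (rot p q (3/5) (- 4/5) v)))"
    by (intro Bochner_Integration.integral_add[symmetric] i cs1 cs2) auto
  also have "\<dots> = hE d (\<lambda>v. f v (9/25 * wt p v + 16/25 * wt q v - 24/25 * Re (v p * cnj (v q))) +
       f v (9/25 * wt p v + 16/25 * wt q v + 24/25 * Re (v p * cnj (v q))))"
    unfolding inv wt_rot(1)[OF pq(3)] by (simp add: power2_eq_square)
  finally show ?thesis .
qed

text \<open>Let X be the moment with the square and Y the one with three distinct indices.
  Exchanging p and q turns both squares into X, and \<open>hE_Re_squared\<close> turns the cross
  term into Y / 2, so the rotation identity reads 1250 X = 674 X + 1152 Y.\<close>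

lemma hE_wt_2_1:
  assumes pq: "p < d" "q < d" "p \<noteq> q" and k: "k < d" "k \<noteq> p" "k \<noteq> q"
  shows "hE d (\<lambda>v. wt k v * wt p v ^ 2) = 2 * hE d (\<lambda>v. wt k v * wt p v * wt q v)"
proof -
  let ?R = "\<lambda>v. wt k v * (Re (v p * cnj (v q)))\<^sup>2"
  have bd: "haar_bounded d (\<lambda>v. wt k v * wt p v ^ 2)" "haar_bounded d (\<lambda>v. wt k v * wt q v ^ 2)"
    "haar_bounded d (\<lambda>v. wt k v * wt p v * wt q v)" "haar_bounded d ?R"
    using assms by (intro haar_bounded_intros haar_bounded_wt; simp)+
  note int = bd[THEN haar_bounded_integrable]
  have "2 * hE d (\<lambda>v. wt k v * wt p v ^ 2) =
     hE d (\<lambda>v. wt k v * (9/25 * wt p v + 16/25 * wt q v - 24/25 * Re (v p * cnj (v q)))^2 +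
       wt k v * (9/25 * wt p v + 16/25 * wt q v + 24/25 * Re (v p * cnj (v q)))^2)"
    by (rule hE_wt_rot[OF pq, of "\<lambda>v x. wt k v * x ^ 2"]) (use bd k pq in \<open>auto simp: wt_rot\<close>)
  also have "\<dots> = hE d (\<lambda>v. 162/625 * (wt k v * wt p v ^ 2) + 512/625 * (wt k v * wt q v ^ 2)
     + 576/625 * (wt k v * wt p v * wt q v) + 1152/625 * ?R v)"
    by (intro Bochner_Integration.integral_cong refl) (simp add: power2_eq_square algebra_simps)
  also have "\<dots> = 162/625 * hE d (\<lambda>v. wt k v * wt p v ^ 2) + 512/625 * hE d (\<lambda>v. wt k v * wt q v ^ 2)
     + 576/625 * hE d (\<lambda>v. wt k v * wt p v * wt q v) + 1152/625 * hE d ?R"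
    using int by simp
  finally show ?thesis
    using hE_wt_swap(3)[OF pq k] hE_Re_squared[OF pq k(1)] by simp
qed

text \<open>The same comparison for cubes: with X the moment of the cube and Y the moment of square
  times weight, it reads 31250 X = 9650 X + 64800 Y.\<close>

lemma hE_wt_3:
  assumes pq: "p < d" "q < d" "p \<noteq> q"
  shows "hE d (\<lambda>v. wt p v ^ 3) = 3 * hE d (\<lambda>v. wt p v ^ 2 * wt q v)"
proof -
  let ?R = "\<lambda>k v. wt k v * (Re (v p * cnj (v q)))\<^sup>2"
  have bd: "haar_bounded d (\<lambda>v. wt p v ^ 3)" "haar_bounded d (\<lambda>v. wt q v ^ 3)"
    "haar_bounded d (\<lambda>v. wt p v ^ 2 * wt q v)" "haar_bounded d (\<lambda>v. wt q v ^ 2 * wt p v)"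
    "haar_bounded d (?R p)" "haar_bounded d (?R q)"
    using assms by (intro haar_bounded_intros haar_bounded_wt; simp)+
  note int = bd[THEN haar_bounded_integrable]
  have id: "(9/25 * x + 16/25 * y - 24/25 * r)^3 + (9/25 * x + 16/25 * y + 24/25 * r)^3
     = 1458/15625 * (x ^ 3) + 8192/15625 * (y ^ 3) + 7776/15625 * (x ^ 2 * y)
     + 13824/15625 * (y ^ 2 * x) + 31104/15625 * (x * r\<^sup>2) + 55296/15625 * (y * r\<^sup>2)" for x y r :: real
    by (simp add: power2_eq_square power3_eq_cube field_simps)
  have "2 * hE d (\<lambda>v. wt p v ^ 3) =
     hE d (\<lambda>v. (9/25 * wt p v + 16/25 * wt q v - 24/25 * Re (v p * cnj (v q)))^3 +
       (9/25 * wt p v + 16/25 * wt q v + 24/25 * Re (v p * cnj (v q)))^3)"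
    by (rule hE_wt_rot[OF pq, of "\<lambda>v x. x ^ 3"]) (use bd pq in auto)
  also have "\<dots> = hE d (\<lambda>v. 1458/15625 * (wt p v ^ 3) + 8192/15625 * (wt q v ^ 3)
     + 7776/15625 * (wt p v ^ 2 * wt q v) + 13824/15625 * (wt q v ^ 2 * wt p v)
     + 31104/15625 * ?R p v + 55296/15625 * ?R q v)"
    unfolding id ..
  also have "\<dots> = 1458/15625 * hE d (\<lambda>v. wt p v ^ 3) + 8192/15625 * hE d (\<lambda>v. wt q v ^ 3)
     + 7776/15625 * hE d (\<lambda>v. wt p v ^ 2 * wt q v) + 13824/15625 * hE d (\<lambda>v. wt q v ^ 2 * wt p v)
     + 31104/15625 * hE d (?R p) + 55296/15625 * hE d (?R q)"
    using int by simp
  finally have eq: "2 * hE d (\<lambda>v. wt p v ^ 3) = 1458/15625 * hE d (\<lambda>v. wt p v ^ 3) + 8192/15625 * hE d (\<lambda>v. wt q v ^ 3)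
     + 7776/15625 * hE d (\<lambda>v. wt p v ^ 2 * wt q v) + 13824/15625 * hE d (\<lambda>v. wt q v ^ 2 * wt p v)
     + 31104/15625 * hE d (?R p) + 55296/15625 * hE d (?R q)" .
  have "hE d (?R p) = hE d (\<lambda>v. wt p v ^ 2 * wt q v) / 2"
    using hE_Re_squared[OF pq pq(1)] by (simp add: power2_eq_square)
  moreover have "hE d (?R q) = hE d (\<lambda>v. wt q v ^ 2 * wt p v) / 2"
    using hE_Re_squared[OF pq pq(2)] by (simp add: power2_eq_square mult.commute mult.left_commute)
  ultimately show ?thesis
    using eq hE_wt_swap(1,2)[OF pq] by simp
qed

text \<open>The reciprocal of 6 times the dimension of the symmetric subspace of the third tensor
  power of C^d. The factor 6 turns the symmetric projector into the plain sum of the six permutation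
  operators.\<close>

definition haar_const :: "nat \<Rightarrow> real" where
  "haar_const d = 1 / (real d * (real d + 1) * (real d + 2))"

text \<open>An entry of the sum of the six permutation operators. Permutations are counted with
  multiplicity, so coinciding indices give values above 1.\<close>

definition perm_count :: "nat \<Rightarrow> nat \<Rightarrow> nat \<Rightarrow> nat \<Rightarrow> nat \<Rightarrow> nat \<Rightarrow> nat" where
  "perm_count i j k a b c = of_bool (a = i \<and> b = j \<and> c = k) + of_bool (a = i \<and> b = k \<and> c = j)
     + of_bool (a = j \<and> b = i \<and> c = k) + of_bool (a = j \<and> b = k \<and> c = i)
     + of_bool (a = k \<and> b = i \<and> c = j) + of_bool (a = k \<and> b = j \<and> c = i)"

abbreviation perm3 :: "nat \<Rightarrow> nat \<Rightarrow> nat \<Rightarrow> nat \<Rightarrow> nat \<Rightarrow> nat \<Rightarrow> bool" where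
  "perm3 i j k a b c \<equiv> (a = i \<and> b = j \<and> c = k) \<or> (a = i \<and> b = k \<and> c = j) \<or> (a = j \<and> b = i \<and> c = k)
     \<or> (a = j \<and> b = k \<and> c = i) \<or> (a = k \<and> b = i \<and> c = j) \<or> (a = k \<and> b = j \<and> c = i)"

lemma hE_wt_cases:
  assumes d: "d \<ge> 3" and p: "p < d"
  shows "hE d (\<lambda>v. wt p v ^ 3) = hE d (\<lambda>v. wt 0 v ^ 3)"
    and "q < d \<Longrightarrow> q \<noteq> p \<Longrightarrow> hE d (\<lambda>v. wt p v ^ 2 * wt q v) = hE d (\<lambda>v. wt 0 v ^ 3) / 3"
    and "q < d \<Longrightarrow> q \<noteq> p \<Longrightarrow> k < d \<Longrightarrow> k \<noteq> p \<Longrightarrow> k \<noteq> q \<Longrightarrow>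
      hE d (\<lambda>v. wt p v * wt q v * wt k v) = hE d (\<lambda>v. wt 0 v ^ 3) / 6"
proof -
  have A: "hE d (\<lambda>v. wt p v ^ 3) = hE d (\<lambda>v. wt 0 v ^ 3)" if "p < d" for p
    using hE_wt_swap(1)[of p d 0] that d by (cases "p = 0") auto
  have B: "hE d (\<lambda>v. wt p v ^ 2 * wt q v) = hE d (\<lambda>v. wt 0 v ^ 3) / 3" if "p < d" "q < d" "q \<noteq> p" for p q
    using hE_wt_3[of p d q] A[of p] that by auto
  show "hE d (\<lambda>v. wt p v ^ 3) = hE d (\<lambda>v. wt 0 v ^ 3)" by (rule A[OF p])
  show "hE d (\<lambda>v. wt p v ^ 2 * wt q v) = hE d (\<lambda>v. wt 0 v ^ 3) / 3" if "q < d" "q \<noteq> p"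
    using B p that by auto
  show "hE d (\<lambda>v. wt p v * wt q v * wt k v) = hE d (\<lambda>v. wt 0 v ^ 3) / 6"
    if "q < d" "q \<noteq> p" "k < d" "k \<noteq> p" "k \<noteq> q"
    using hE_wt_2_1[of q d k p] B[of q p] that p by (simp add: mult.commute)
qed

text \<open>The count of permutations fixing a triple is 6, 2 or 1, the product of the factorials of
  the multiplicities. The moments stand in the same ratio, so one formula covers every pattern of
  coincidences.\<close>

lemma hE_wt_product_aux:
  assumes d: "d \<ge> 3" and ijk: "i < d" "j < d" "k < d"
  shows "hE d (\<lambda>v. wt i v * wt j v * wt k v) = hE d (\<lambda>v. wt 0 v ^ 3) / 6 * real (perm_count i j k i j k)"
proof -
  note W = hE_wt_cases[OF d]
  consider "i = j" "j = k" | "i = j" "j \<noteq> k" | "i = k" "i \<noteq> j" | "j = k" "i \<noteq> j"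
    | "i \<noteq> j" "j \<noteq> k" "i \<noteq> k" by blast
  then show ?thesis
  proof cases
    case 1
    then have "(\<lambda>v. wt i v * wt j v * wt k v) = (\<lambda>v. wt i v ^ 3)" by (simp add: power3_eq_cube)
    then show ?thesis using 1 W(1)[OF ijk(1)] by (simp add: perm_count_def)
  next
    case 2
    then have "(\<lambda>v. wt i v * wt j v * wt k v) = (\<lambda>v. wt i v ^ 2 * wt k v)" by (simp add: power2_eq_square)
    then show ?thesis using 2 W(2)[OF ijk(1), of k] ijk by (simp add: perm_count_def)
  next
    case 3
    then have "(\<lambda>v. wt i v * wt j v * wt k v) = (\<lambda>v. wt i v ^ 2 * wt j v)" by (simp add: power2_eq_square mult_ac)
    then show ?thesis using 3 W(2)[OF ijk(1), of j] ijk by (simp add: perm_count_def)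
  next
    case 4
    then have "(\<lambda>v. wt i v * wt j v * wt k v) = (\<lambda>v. wt j v ^ 2 * wt i v)" by (simp add: power2_eq_square mult_ac)
    then show ?thesis using 4 W(2)[OF ijk(2), of i] ijk by (simp add: perm_count_def)
  next
    case 5
    then show ?thesis using W(3)[OF ijk(1), of j k] ijk by (simp add: perm_count_def)
  qed
qed

text \<open>A permutation of three positions fixes d ^ c triples, where c is its number of cycles:
  one identity, three transpositions and two 3-cycles give d^3 + 3 d^2 + 2 d.\<close>

lemma sum_perm_count:
  "(\<Sum>i<d. \<Sum>j<d. \<Sum>k<d. real (perm_count i j k i j k)) = real d * (real d + 1) * (real d + 2)"
proof -
  have sb: "(\<Sum>k<d. of_bool (j = k) :: real) = 1" if "j < d" for j
    using that by (simp add: of_bool_def)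
  have pc: "real (perm_count i j k i j k) = 1 + of_bool (j = k) + of_bool (i = j) + of_bool (i = k)
      + 2 * (of_bool (i = j) * of_bool (j = k))" for i j k
    by (auto simp: perm_count_def)
  have k: "(\<Sum>k<d. real (perm_count i j k i j k)) = real d + 2 + (real d + 2) * of_bool (i = j)"
    if "i < d" "j < d" for i j
    unfolding pc sum.distrib sum_distrib_left[symmetric] sb[OF that(1)] sb[OF that(2)]
    by (simp add: algebra_simps)
  have j: "(\<Sum>j<d. \<Sum>k<d. real (perm_count i j k i j k)) = (real d + 1) * (real d + 2)"
    if i: "i < d" for i
  proof -
    have "(\<Sum>j<d. \<Sum>k<d. real (perm_count i j k i j k))
        = (\<Sum>j<d. real d + 2 + (real d + 2) * of_bool (i = j))"
      by (intro sum.cong refl k i) auto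
    also have "\<dots> = (real d + 1) * (real d + 2)"
      unfolding sum.distrib sum_distrib_left[symmetric] sb[OF i] by (simp add: algebra_simps)
    finally show ?thesis .
  qed
  have "(\<Sum>i<d. \<Sum>j<d. \<Sum>k<d. real (perm_count i j k i j k)) = (\<Sum>i<d. (real d + 1) * (real d + 2))"
    by (intro sum.cong refl j) auto
  then show ?thesis by simp
qed

text \<open>The one free constant is determined by integrating the cube of the sum of all weights,
  which is 1 almost everywhere.\<close>

lemma hE_wt_product:
  assumes d: "d \<ge> 3" and ijk: "i < d" "j < d" "k < d"
  shows "hE d (\<lambda>v. wt i v * wt j v * wt k v) = haar_const d * real (perm_count i j k i j k)"
proof -
  interpret prob_space "haar_state_measure d" by (rule prob_space_haar)
  let ?A = "hE d (\<lambda>v. wt 0 v ^ 3) / 6"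
  have "1 = hE d (\<lambda>v. 1 :: real)" using prob_space by simp
  also have "\<dots> = hE d (\<lambda>v. \<Sum>i<d. \<Sum>j<d. \<Sum>k<d. wt i v * wt j v * wt k v)"
  proof (rule Bochner_Integration.integral_cong_AE)
    show "(\<lambda>v. \<Sum>i<d. \<Sum>j<d. \<Sum>k<d. wt i v * wt j v * wt k v) \<in> borel_measurable (haar_state_measure d)"
      by (intro borel_measurable_integrable haar_bounded_integrable haar_bounded_intros haar_bounded_wt) auto
    have "AE v in haar_state_measure d. (\<Sum>i<d. wt i v) = 1"
      using AE_haar_norm[of d] d unfolding wt_def by auto
    then show "AE v in haar_state_measure d. 1 = (\<Sum>i<d. \<Sum>j<d. \<Sum>k<d. wt i v * wt j v * wt k v)"
      by eventually_elim (simp add: sum_distrib_left[symmetric])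
  qed auto
  also have "\<dots> = (\<Sum>i<d. \<Sum>j<d. \<Sum>k<d. hE d (\<lambda>v. wt i v * wt j v * wt k v))"
    by (subst Bochner_Integration.integral_sum,
        (intro haar_bounded_integrable haar_bounded_intros haar_bounded_wt; simp),
        intro sum.cong refl)+
  also have "\<dots> = (\<Sum>i<d. \<Sum>j<d. \<Sum>k<d. ?A * real (perm_count i j k i j k))"
    by (intro sum.cong refl hE_wt_product_aux[OF d]) auto
  also have "\<dots> = ?A * (real d * (real d + 1) * (real d + 2))"
    by (simp only: sum_distrib_left[symmetric] sum_perm_count)
  finally have "1 = ?A * (real d * (real d + 1) * (real d + 2))" .
  moreover have "real d * (real d + 1) * (real d + 2) \<noteq> 0" using d by simp
  ultimately have "?A = haar_const d" unfolding haar_const_def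
    by (metis nonzero_eq_divide_eq)
  then show ?thesis using hE_wt_product_aux[OF assms] by simp
qed

section \<open>Mixed third moments\<close>

lemma perm_of_counts:
  fixes i j k a b c :: nat
  assumes "\<And>p. of_bool (i = p) + of_bool (j = p) + of_bool (k = p)
     = (of_bool (a = p) + of_bool (b = p) + of_bool (c = p) :: nat)"
  shows "perm3 i j k a b c"
proof -
  have "{#i, j, k#} = {#a, b, c#}"
  proof (rule multiset_eqI)
    fix p show "count {#i, j, k#} p = count {#a, b, c#} p"
      using assms[of p] by (auto simp: of_bool_def split: if_splits)
  qed
  then show ?thesis by (auto simp: add_eq_conv_ex)
qed

text \<open>The left-hand side is \<i> ^ (m - n) with |m - n| at most 3, and \<i> has order 4. This
  is why the single phase \<i> is enough for third moments.\<close>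

lemma phase_factor:
  assumes "m \<le> 3" "n \<le> 3" "\<i> ^ m * (- \<i>) ^ n = 1"
  shows "m = n"
proof -
  have "m \<in> {0,1,2,3}" "n \<in> {0,1,2,3}" using assms by auto
  then show ?thesis using assms(3) by (auto simp: power2_eq_square power3_eq_cube complex_eq_iff)
qed

lemma of_real_wt: "complex_of_real (wt i v) = v i * cnj (v i)"
  unfolding wt_def by (rule complex_norm_square)

lemma monomial_eq_wt:
  assumes "perm3 i j k a b c"
  shows "v i * v j * v k * cnj (v a) * cnj (v b) * cnj (v c) = complex_of_real (wt i v * wt j v * wt k v)"
  unfolding of_real_mult of_real_wt using assms
  by (elim disjE conjE) (simp_all only: mult_ac)

lemma perm_count_cong:
  assumes "perm3 i j k a b c"
  shows "perm_count i j k i j k = perm_count i j k a b c"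
  using assms unfolding perm_count_def
  by (cases "i = j"; cases "j = k"; cases "i = k") auto

lemma hE_monomial_perm:
  assumes d: "d \<ge> 3" and ijk: "i < d" "j < d" "k < d"
    and perm: "perm3 i j k a b c"
  shows "hE d (\<lambda>v. v i * v j * v k * cnj (v a) * cnj (v b) * cnj (v c))
    = complex_of_real (haar_const d) * of_nat (perm_count i j k a b c)"
proof -
  have "hE d (\<lambda>v. v i * v j * v k * cnj (v a) * cnj (v b) * cnj (v c))
      = hE d (\<lambda>v. complex_of_real (wt i v * wt j v * wt k v))"
    unfolding monomial_eq_wt[OF perm] ..
  also have "\<dots> = complex_of_real (hE d (\<lambda>v. wt i v * wt j v * wt k v))"
    by (rule integral_complex_of_real)
  also have "\<dots> = haar_const d * of_nat (perm_count i j k a b c)"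
    unfolding hE_wt_product[OF d ijk] perm_count_cong[OF perm] by simp
  finally show ?thesis by simp
qed

text \<open>If the two index triples are not permutations of each other, some index p occurs
  unequally often in them. The phase \<i> at p multiplies the monomial by a factor other than 1
  without changing its integral, which must then vanish.\<close>

lemma haar_moment_3:
  assumes d: "d \<ge> 3" and ijk: "i < d" "j < d" "k < d" and abc: "a < d" "b < d" "c < d"
  shows "hE d (\<lambda>v. v i * v j * v k * cnj (v a) * cnj (v b) * cnj (v c))
    = complex_of_real (haar_const d) * of_nat (perm_count i j k a b c)"
proof (cases "perm_count i j k a b c = 0")
  case False
  then show ?thesis
    by (intro hE_monomial_perm[OF d ijk]) (auto simp: perm_count_def split: if_splits)
next
  case True
  let ?f = "\<lambda>v. v i * v j * v k * cnj (v a) * cnj (v b) * cnj (v c) :: complex"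
  have bd: "haar_bounded d ?f" using assms by (intro haar_bounded_intros)
  have "\<exists>p. of_bool (i = p) + of_bool (j = p) + of_bool (k = p)
     \<noteq> (of_bool (a = p) + of_bool (b = p) + of_bool (c = p) :: nat)"
    using perm_of_counts[of i j k a b c] True unfolding perm_count_def by fastforce
  then obtain p where p: "of_bool (i = p) + of_bool (j = p) + of_bool (k = p)
     \<noteq> (of_bool (a = p) + of_bool (b = p) + of_bool (c = p) :: nat)" (is "?m \<noteq> ?n") ..
  have "p < d"
  proof (rule ccontr)
    assume "\<not> p < d"
    then have "i \<noteq> p" "j \<noteq> p" "k \<noteq> p" "a \<noteq> p" "b \<noteq> p" "c \<noteq> p" using ijk abc by auto
    then show False using p by simp
  qed
  have "?f (v(p := \<i> * v p)) = (\<i> ^ ?m * (- \<i>) ^ ?n) * ?f v" for v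
  proof -
    have 1: "(v(p := \<i> * v p)) l = \<i> ^ of_bool (l = p) * v l"
      "cnj ((v(p := \<i> * v p)) l) = (- \<i>) ^ of_bool (l = p) * cnj (v l)" for l by auto
    show ?thesis unfolding 1(2) unfolding 1(1) power_add by (simp only: mult_ac)
  qed
  note phase = this
  have "hE d ?f = hE d (\<lambda>v. ?f (v(p := \<i> * v p)))"
    by (rule hE_phase[OF \<open>p < d\<close> bd, symmetric])
  also have "\<dots> = hE d (\<lambda>v. (\<i> ^ ?m * (- \<i>) ^ ?n) * ?f v)"
    unfolding phase ..
  also have "\<dots> = (\<i> ^ ?m * (- \<i>) ^ ?n) * hE d ?f"
    by (rule integral_mult_right_zero)
  finally have "hE d ?f = (\<i> ^ ?m * (- \<i>) ^ ?n) * hE d ?f" .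
  moreover have "?m \<le> 3" "?n \<le> 3" by (simp_all add: of_bool_def)
  then have "\<i> ^ ?m * (- \<i>) ^ ?n \<noteq> 1"
    using phase_factor p by blast
  moreover have "z = 0" if "z = w * z" "w \<noteq> 1" for z w :: complex
    using that by simp
  ultimately have "hE d ?f = 0" by blast
  then show ?thesis using True by simp
qed

section \<open>Median of means\<close>

lemma integrable_pmf_bounded:
  fixes h :: "'a \<Rightarrow> 'b :: {banach, second_countable_topology}"
  assumes "\<And>y. y \<in> set_pmf M \<Longrightarrow> norm (h y) \<le> B"
  shows "integrable (measure_pmf M) h"
  by (rule measure_pmf.integrable_const_bound[of _ B]) (auto intro: AE_pmfI assms)

text \<open>Goes through the nonnegative integral, where the nesting is immediate: adding
  \<open>B\<close> makes \<open>h\<close> nonnegative on the support, and the constant is removed at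
  the end.\<close>

lemma integral_bind_pmf_bounded:
  fixes h :: "'b \<Rightarrow> real"
  assumes B: "\<And>y. y \<in> set_pmf (bind_pmf p f) \<Longrightarrow> \<bar>h y\<bar> \<le> B"
  shows "measure_pmf.expectation (bind_pmf p f) h = measure_pmf.expectation p (\<lambda>x. measure_pmf.expectation (f x) h)"
proof -
  let ?g = "\<lambda>y. h y + B"
  have g0: "0 \<le> ?g y" and g2: "\<bar>?g y\<bar> \<le> 2 * B" if "y \<in> set_pmf (bind_pmf p f)" for y
    using B[OF that] by auto
  have sub: "y \<in> set_pmf (bind_pmf p f)" if "x \<in> set_pmf p" "y \<in> set_pmf (f x)" for x y
    using that by auto
  have int1: "integrable (measure_pmf (bind_pmf p f)) h"
    by (rule integrable_pmf_bounded[of _ _ B]) (use B in auto)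
  have int2: "integrable (measure_pmf (f x)) h" if "x \<in> set_pmf p" for x
    by (rule integrable_pmf_bounded[of _ _ B]) (use B sub[OF that] in auto)
  have bound: "0 \<le> measure_pmf.expectation (f x) ?g \<and> measure_pmf.expectation (f x) ?g \<le> 2 * B" if x: "x \<in> set_pmf p" for x
  proof
    show "0 \<le> measure_pmf.expectation (f x) ?g"
      using g0 sub[OF x] by (intro integral_nonneg_AE AE_pmfI) auto
    have "measure_pmf.expectation (f x) ?g \<le> measure_pmf.expectation (f x) (\<lambda>_. 2 * B)"
    proof (rule integral_mono_AE)
      show "AE y in measure_pmf (f x). h y + B \<le> 2 * B"
        using g2 sub[OF x] by (intro AE_pmfI) (auto simp: abs_le_iff)
    qed (use int2[OF x] in auto)
    then show "measure_pmf.expectation (f x) ?g \<le> 2 * B" by simp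
  qed
  have int3: "integrable (measure_pmf p) (\<lambda>x. measure_pmf.expectation (f x) ?g)"
    by (rule integrable_pmf_bounded[of _ _ "2 * B"]) (use bound in \<open>auto simp: abs_le_iff\<close>)
  have "ennreal (measure_pmf.expectation (bind_pmf p f) ?g) = (\<integral>\<^sup>+y. ?g y \<partial>bind_pmf p f)"
    by (rule nn_integral_eq_integral[symmetric]) (use int1 g0 in \<open>auto intro!: AE_pmfI\<close>)
  also have "\<dots> = (\<integral>\<^sup>+x. \<integral>\<^sup>+y. ?g y \<partial>f x \<partial>p)" by simp
  also have "\<dots> = (\<integral>\<^sup>+x. ennreal (measure_pmf.expectation (f x) ?g) \<partial>p)"
  proof (rule nn_integral_cong_AE, rule AE_pmfI)
    fix x assume x: "x \<in> set_pmf p"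
    show "(\<integral>\<^sup>+y. ?g y \<partial>f x) = ennreal (measure_pmf.expectation (f x) ?g)"
      by (rule nn_integral_eq_integral) (use int2[OF x] g0 sub[OF x] in \<open>auto intro!: AE_pmfI\<close>)
  qed
  also have "\<dots> = ennreal (measure_pmf.expectation p (\<lambda>x. measure_pmf.expectation (f x) ?g))"
    by (rule nn_integral_eq_integral[OF int3]) (use bound in \<open>auto intro!: AE_pmfI\<close>)
  finally have "measure_pmf.expectation (bind_pmf p f) ?g = measure_pmf.expectation p (\<lambda>x. measure_pmf.expectation (f x) ?g)"
    by (subst (asm) ennreal_inj) (use g0 bound in \<open>auto intro!: integral_nonneg_AE AE_pmfI\<close>)
  moreover have "measure_pmf.expectation (bind_pmf p f) ?g = measure_pmf.expectation (bind_pmf p f) h + B"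
    using int1 by simp
  moreover have "measure_pmf.expectation p (\<lambda>x. measure_pmf.expectation (f x) ?g)
      = measure_pmf.expectation p (\<lambda>x. measure_pmf.expectation (f x) h + B)"
    by (intro integral_cong_AE AE_pmfI) (use int2 in auto)
  moreover have "measure_pmf.expectation p (\<lambda>x. measure_pmf.expectation (f x) h + B)
      = measure_pmf.expectation p (\<lambda>x. measure_pmf.expectation (f x) h) + B"
  proof -
    have "\<bar>measure_pmf.expectation (f x) h\<bar> \<le> 3 * \<bar>B\<bar>" if x: "x \<in> set_pmf p" for x
      using bound[OF x] int2[OF x] by (simp add: abs_le_iff)
    then have "integrable (measure_pmf p) (\<lambda>x. measure_pmf.expectation (f x) h)"
      by (intro integrable_pmf_bounded[of _ _ "3 * \<bar>B\<bar>"]) auto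
    then show ?thesis by simp
  qed
  ultimately show ?thesis by simp
qed

section \<open>Sums and means of independent copies\<close>

lemma iid_pmf_Suc_map: "iid_pmf (Suc m) p = bind_pmf p (\<lambda>x. map_pmf ((#) x) (iid_pmf m p))"
  by (simp add: map_pmf_def)

lemma set_iid_pmf: "xs \<in> set_pmf (iid_pmf m p) \<Longrightarrow> set xs \<subseteq> set_pmf p \<and> length xs = m"
  by (induction m arbitrary: xs) (auto simp: subset_eq)

lemma abs_sum_list_le:
  fixes g :: "'a \<Rightarrow> real"
  shows "(\<And>x. x \<in> set xs \<Longrightarrow> \<bar>g x\<bar> \<le> B) \<Longrightarrow> \<bar>sum_list (map g xs)\<bar> \<le> real (length xs) * B"
proof (induction xs)
  case (Cons a xs)
  then have "\<bar>g a\<bar> \<le> B" "\<bar>sum_list (map g xs)\<bar> \<le> real (length xs) * B" by auto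
  then have "\<bar>g a + sum_list (map g xs)\<bar> \<le> B + real (length xs) * B" by linarith
  then show ?case by (simp add: distrib_right)
qed simp

text \<open>Both claims share one induction, because the cross term of the expanded square vanishes
  by the first claim for the shorter list.\<close>

lemma iid_pmf_moments:
  fixes g :: "'a \<Rightarrow> real"
  assumes B: "\<And>x. x \<in> set_pmf p \<Longrightarrow> \<bar>g x\<bar> \<le> B" and zero: "measure_pmf.expectation p g = 0"
  shows "measure_pmf.expectation (iid_pmf m p) (\<lambda>xs. sum_list (map g xs)) = 0"
    and "measure_pmf.expectation (iid_pmf m p) (\<lambda>xs. (sum_list (map g xs))\<^sup>2)
       = real m * measure_pmf.expectation p (\<lambda>x. (g x)\<^sup>2)"
proof (induction m)
  case 0
  {
    case 1 then show ?case by simp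
  next
    case 2 then show ?case by simp
  }
next
  case (Suc m)
  let ?S = "\<lambda>xs. sum_list (map g xs)"
  have bS: "\<bar>?S xs\<bar> \<le> real m * B" if "xs \<in> set_pmf (iid_pmf m p)" for xs m
    using abs_sum_list_le[of xs g B] set_iid_pmf[OF that] B by auto
  have bS2: "\<bar>(?S xs)\<^sup>2\<bar> \<le> (real m * B)\<^sup>2" if "xs \<in> set_pmf (iid_pmf m p)" for xs m
    using power_mono[OF bS[OF that], of 2] by simp
  have iS: "integrable (measure_pmf (iid_pmf m p)) ?S"
    using bS by (intro integrable_pmf_bounded) auto
  have iS2: "integrable (measure_pmf (iid_pmf m p)) (\<lambda>xs. (?S xs)\<^sup>2)"
    using bS2 by (intro integrable_pmf_bounded) auto
  have ig: "integrable (measure_pmf p) g" using B by (intro integrable_pmf_bounded) auto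
  have ig2: "integrable (measure_pmf p) (\<lambda>x. (g x)\<^sup>2)"
    by (rule integrable_pmf_bounded[of _ _ "B\<^sup>2"]) (use B power_mono[OF B abs_ge_zero, of _ 2] in auto)
  {
    case 1
    have "measure_pmf.expectation (iid_pmf (Suc m) p) ?S = measure_pmf.expectation p (\<lambda>x. g x + measure_pmf.expectation (iid_pmf m p) ?S)"
      unfolding iid_pmf_Suc_map
      by (subst integral_bind_pmf_bounded[of _ _ _ "real (Suc m) * B"])
         (use bS[of _ "Suc m", unfolded iid_pmf_Suc_map] iS in auto)
    then show ?case using Suc zero by simp
  next
    case 2
    have "measure_pmf.expectation (iid_pmf (Suc m) p) (\<lambda>xs. (?S xs)\<^sup>2)
      = measure_pmf.expectation p (\<lambda>x. measure_pmf.expectation (iid_pmf m p) (\<lambda>xs. (g x + ?S xs)\<^sup>2))"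
      unfolding iid_pmf_Suc_map
      by (subst integral_bind_pmf_bounded[of _ _ _ "(real (Suc m) * B)\<^sup>2"])
         (use bS2[of _ "Suc m", unfolded iid_pmf_Suc_map] in auto)
    also have "\<dots> = measure_pmf.expectation p (\<lambda>x. (g x)\<^sup>2 + real m * measure_pmf.expectation p (\<lambda>x. (g x)\<^sup>2))"
    proof (rule Bochner_Integration.integral_cong[OF refl])
      fix x
      have "measure_pmf.expectation (iid_pmf m p) (\<lambda>xs. (g x + ?S xs)\<^sup>2)
        = measure_pmf.expectation (iid_pmf m p) (\<lambda>xs. (g x)\<^sup>2 + 2 * g x * ?S xs + (?S xs)\<^sup>2)"
        by (simp add: power2_eq_square algebra_simps)
      also have "\<dots> = (g x)\<^sup>2 + 2 * g x * measure_pmf.expectation (iid_pmf m p) ?S + measure_pmf.expectation (iid_pmf m p) (\<lambda>xs. (?S xs)\<^sup>2)"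
        using iS iS2 by simp
      finally show "measure_pmf.expectation (iid_pmf m p) (\<lambda>xs. (g x + ?S xs)\<^sup>2) = (g x)\<^sup>2 + real m * measure_pmf.expectation p (\<lambda>x. (g x)\<^sup>2)"
        using Suc by simp
    qed
    also have "\<dots> = real (Suc m) * measure_pmf.expectation p (\<lambda>x. (g x)\<^sup>2)"
      using ig2 by (simp add: algebra_simps)
    finally show ?case .
  }
qed

lemma chebyshev_mean_list:
  fixes p :: "real pmf"
  assumes B: "\<And>x. x \<in> set_pmf p \<Longrightarrow> \<bar>x\<bar> \<le> B" and \<mu>: "\<mu> = measure_pmf.expectation p (\<lambda>x. x)"
    and L: "L > 0" and \<gamma>: "\<gamma> > 0"
  shows "measure_pmf.prob (map_pmf mean_list (iid_pmf L p)) {y. \<gamma> < \<bar>y - \<mu>\<bar>}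
     \<le> measure_pmf.expectation p (\<lambda>x. (x - \<mu>)\<^sup>2) / (real L * \<gamma>\<^sup>2)"
proof -
  let ?S = "\<lambda>xs. sum_list (map (\<lambda>x. x - \<mu>) xs)"
  have ip: "integrable (measure_pmf p) (\<lambda>x. x)" using B by (intro integrable_pmf_bounded) auto
  have B': "\<bar>x - \<mu>\<bar> \<le> B + \<bar>\<mu>\<bar>" if "x \<in> set_pmf p" for x using B[OF that] by linarith
  have z: "measure_pmf.expectation p (\<lambda>x. x - \<mu>) = 0" using ip \<mu> by simp
  have S: "?S xs = real (length xs) * (mean_list xs - \<mu>)" for xs
    by (induction xs) (auto simp: mean_list_def sum_list_subtractf sum_list_triv field_simps)
  have bS: "\<bar>?S xs\<bar> \<le> real L * (B + \<bar>\<mu>\<bar>)" if "xs \<in> set_pmf (iid_pmf L p)" for xs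
    using abs_sum_list_le[of xs "\<lambda>x. x - \<mu>" "B + \<bar>\<mu>\<bar>"] set_iid_pmf[OF that] B' by auto
  have iS2: "integrable (measure_pmf (iid_pmf L p)) (\<lambda>xs. (?S xs)\<^sup>2)"
    by (rule integrable_pmf_bounded[of _ _ "(real L * (B + \<bar>\<mu>\<bar>))\<^sup>2"])
       (use power_mono[OF bS abs_ge_zero, of _ 2] in auto)
  have "measure_pmf.prob (map_pmf mean_list (iid_pmf L p)) {y. \<gamma> < \<bar>y - \<mu>\<bar>}
     = measure_pmf.expectation (iid_pmf L p) (indicator {xs. \<gamma> < \<bar>mean_list xs - \<mu>\<bar>})"
    by (simp add: vimage_def)
  also have "\<dots> \<le> measure_pmf.expectation (iid_pmf L p) (\<lambda>xs. (?S xs)\<^sup>2 / (real L * \<gamma>)\<^sup>2)"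
  proof (rule integral_mono_AE)
    show "AE xs in iid_pmf L p. indicator {xs. \<gamma> < \<bar>mean_list xs - \<mu>\<bar>} xs \<le> (?S xs)\<^sup>2 / (real L * \<gamma>)\<^sup>2"
    proof (rule AE_pmfI)
      fix xs assume xs: "xs \<in> set_pmf (iid_pmf L p)"
      show "indicator {xs. \<gamma> < \<bar>mean_list xs - \<mu>\<bar>} xs \<le> (?S xs)\<^sup>2 / (real L * \<gamma>)\<^sup>2"
      proof (cases "\<gamma> < \<bar>mean_list xs - \<mu>\<bar>")
        case True
        have "(real L * \<gamma>)\<^sup>2 \<le> (real L * \<bar>mean_list xs - \<mu>\<bar>)\<^sup>2"
          using True \<gamma> by (intro power_mono mult_left_mono) auto
        also have "\<dots> = (?S xs)\<^sup>2" unfolding S using set_iid_pmf[OF xs] by (simp add: power_mult_distrib)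
        finally show ?thesis using True L \<gamma> by (simp add: le_divide_eq)
      qed auto
    qed
    show "integrable (measure_pmf (iid_pmf L p)) (indicat_real {xs. \<gamma> < \<bar>mean_list xs - \<mu>\<bar>})"
      by (rule integrable_pmf_bounded[of _ _ 1]) auto
  qed (use iS2 in auto)
  also have "\<dots> = real L * measure_pmf.expectation p (\<lambda>x. (x - \<mu>)\<^sup>2) / (real L * \<gamma>)\<^sup>2"
    using iid_pmf_moments(2)[OF B' z, of L] by simp
  also have "\<dots> = measure_pmf.expectation p (\<lambda>x. (x - \<mu>)\<^sup>2) / (real L * \<gamma>\<^sup>2)"
    using L by (simp add: power2_eq_square field_simps)
  finally show ?thesis .
qed

text \<open>For both parities the median lies between the order statistics at
  \<open>(m - 1) div 2\<close> and \<open>m div 2\<close>. If the upper one exceeded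
  \<open>hi\<close>, all entries from it onwards would be bad, and if the lower one fell below
  \<open>lo\<close>, all entries up to it; either block contains at least half of the list.\<close>

lemma median_list_between:
  fixes xs :: "real list"
  assumes "xs \<noteq> []" "2 * length (filter (\<lambda>x. \<not> (lo \<le> x \<and> x \<le> hi)) xs) < length xs"
  shows "lo \<le> median_list xs \<and> median_list xs \<le> hi"
proof -
  let ?P = "\<lambda>x. \<not> (lo \<le> x \<and> x \<le> hi)"
  define s where "s = sort xs"
  define m where "m = length xs"
  have len: "length s = m" and m: "m > 0" using assms(1) by (auto simp: s_def m_def)
  have srt: "sorted s" by (simp add: s_def)
  have mono: "s ! i \<le> s ! j" if "i \<le> j" "j < m" for i j
    using sorted_nth_mono[OF srt] that len by auto
  have "length (filter ?P xs) = length (filter ?P s)"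
    by (simp add: s_def filter_sort)
  then have few: "2 * card {i. i < m \<and> ?P (s ! i)} < m"
    using assms(2) len by (simp add: length_filter_conv_card m_def)
  have hi: "s ! (m div 2) \<le> hi"
  proof (rule ccontr)
    assume "\<not> s ! (m div 2) \<le> hi"
    then have "{m div 2..<m} \<subseteq> {i. i < m \<and> ?P (s ! i)}" using mono[of "m div 2"] by fastforce
    then have "card {m div 2..<m} \<le> card {i. i < m \<and> ?P (s ! i)}" by (intro card_mono) auto
    then show False using few by auto
  qed
  have lo: "lo \<le> s ! ((m - 1) div 2)"
  proof (rule ccontr)
    assume "\<not> lo \<le> s ! ((m - 1) div 2)"
    then have "{..(m - 1) div 2} \<subseteq> {i. i < m \<and> ?P (s ! i)}"
      using mono[of _ "(m - 1) div 2"] m by fastforce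
    then have "card {..(m - 1) div 2} \<le> card {i. i < m \<and> ?P (s ! i)}" by (intro card_mono) auto
    then show False using few m by simp
  qed
  have le: "s ! ((m - 1) div 2) \<le> s ! (m div 2)" using m by (intro mono div_le_mono) auto
  show ?thesis
  proof (cases "odd m")
    case True
    then have "(m - 1) div 2 = m div 2" by (auto elim: oddE)
    then show ?thesis using True lo hi unfolding median_list_def Let_def s_def[symmetric] m_def[symmetric] by simp
  next
    case False
    then have "(m - 1) div 2 = m div 2 - 1" using m by (auto elim!: evenE)
    then show ?thesis using False lo hi le unfolding median_list_def Let_def s_def[symmetric] m_def[symmetric] by simp
  qed
qed

lemma nn_integral_iid_prod:
  "(\<integral>\<^sup>+xs. prod_list (map w xs) \<partial>iid_pmf m p) = (\<integral>\<^sup>+x. (w x :: ennreal) \<partial>measure_pmf p) ^ m"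
  by (induction m) (simp_all add: nn_integral_cmult nn_integral_multc)

text \<open>Chernoff-style: weight every bad entry with 25 and apply Markov's inequality.\<close>
lemma median_failure:
  fixes q :: "real pmf"
  assumes p: "measure_pmf.prob q {y. \<not> (lo \<le> y \<and> y \<le> hi)} \<le> 1/25" and K: "K > 0"
  shows "measure_pmf.prob (map_pmf median_list (iid_pmf K q)) {e. \<not> (lo \<le> e \<and> e \<le> hi)} \<le> (49/125) ^ K"
proof -
  let ?bad = "\<lambda>y. \<not> (lo \<le> y \<and> y \<le> hi)"
  define w :: "real \<Rightarrow> real" where "w = (\<lambda>y. if ?bad y then 25 else 1)"
  have pw: "prod_list (map w xs) = 25 ^ length (filter ?bad xs)" for xs
    by (induction xs) (auto simp: w_def)
  have pw': "prod_list (map (\<lambda>x. ennreal (w x)) xs) = ennreal (prod_list (map w xs))" for xs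
  proof (induction xs)
    case (Cons a xs)
    have "0 \<le> w a" "0 \<le> prod_list (map w xs)" by (auto simp: pw) (auto simp: w_def)
    then show ?case using Cons by (simp add: ennreal_mult)
  qed simp
  \<comment> \<open>The mean weight is 1 + 24 p, where p is at most 1/25.\<close>
  have iw: "(\<integral>\<^sup>+y. ennreal (w y) \<partial>q) \<le> ennreal (49/25)"
  proof -
    have "(\<integral>\<^sup>+y. ennreal (w y) \<partial>q) = (\<integral>\<^sup>+y. 1 + 24 * indicator {y. ?bad y} y \<partial>q)"
      by (intro nn_integral_cong) (auto simp: w_def indicator_def)
    also have "\<dots> = 1 + 24 * ennreal (measure_pmf.prob q {y. ?bad y})"
      by (simp add: nn_integral_add nn_integral_cmult measure_pmf.emeasure_eq_measure)
    also have "\<dots> = ennreal (1 + 24 * measure_pmf.prob q {y. ?bad y})"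
      by (subst ennreal_plus) (auto simp: ennreal_mult)
    also have "\<dots> \<le> ennreal (49/25)" using p by (intro ennreal_leI) simp
    finally show ?thesis .
  qed
  have "measure_pmf.prob (map_pmf median_list (iid_pmf K q)) {e. ?bad e}
    = measure_pmf.prob (iid_pmf K q) {xs. ?bad (median_list xs)}"
    by (simp add: vimage_def)
  also have "ennreal \<dots> = (\<integral>\<^sup>+xs. indicator {xs. ?bad (median_list xs)} xs \<partial>iid_pmf K q)"
    by (simp add: measure_pmf.emeasure_eq_measure)
  \<comment> \<open>A bad median forces at least K / 2 bad entries, so the product of the weights is
    at least 25 ^ (K / 2) = 5 ^ K.\<close>
  also have "\<dots> \<le> (\<integral>\<^sup>+xs. ennreal ((1/5) ^ K) * prod_list (map (\<lambda>x. ennreal (w x)) xs) \<partial>iid_pmf K q)"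
  proof (rule nn_integral_mono_AE, rule AE_pmfI)
    fix xs assume xs: "xs \<in> set_pmf (iid_pmf K q)"
    show "indicator {xs. ?bad (median_list xs)} xs \<le> ennreal ((1/5) ^ K) * prod_list (map (\<lambda>x. ennreal (w x)) xs)"
    proof (cases "?bad (median_list xs)")
      case True
      have len: "length xs = K" using set_iid_pmf[OF xs] by auto
      then have "K \<le> 2 * length (filter ?bad xs)"
        using median_list_between[of xs lo hi] True K by (cases "xs = []") (simp, force)
      then have "(5::real) ^ K \<le> 5 ^ (2 * length (filter ?bad xs))" by (intro power_increasing) auto
      also have "\<dots> = prod_list (map w xs)" unfolding pw by (simp add: power_mult)
      finally have "1 \<le> (1/5) ^ K * prod_list (map w xs)" by (simp add: power_divide field_simps)
      then have "1 \<le> ennreal ((1/5) ^ K * prod_list (map w xs))" by simp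
      also have "\<dots> = ennreal ((1/5) ^ K) * prod_list (map (\<lambda>x. ennreal (w x)) xs)"
        unfolding pw' by (rule ennreal_mult) (auto simp: pw)
      finally show ?thesis using True by simp
    qed auto
  qed
  also have "\<dots> = ennreal ((1/5) ^ K) * (\<integral>\<^sup>+y. ennreal (w y) \<partial>q) ^ K"
    by (simp add: nn_integral_cmult nn_integral_iid_prod)
  also have "\<dots> \<le> ennreal ((1/5) ^ K) * ennreal (49/25) ^ K"
    by (intro mult_left_mono power_mono iw) auto
  also have "\<dots> = ennreal ((49/125) ^ K)"
    by (simp add: ennreal_power ennreal_mult'[symmetric] power_mult_distrib[symmetric])
  finally show ?thesis by (subst (asm) ennreal_le_iff) auto
qed

lemma median_of_means_accuracy:
  fixes p :: "real pmf"
  assumes B: "\<And>x. x \<in> set_pmf p \<Longrightarrow> \<bar>x\<bar> \<le> B" and \<mu>: "\<mu> = measure_pmf.expectation p (\<lambda>x. x)"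
    and V: "25 * measure_pmf.expectation p (\<lambda>x. (x - \<mu>)\<^sup>2) \<le> real L * \<gamma>\<^sup>2"
    and L: "L > 0" and \<gamma>: "\<gamma> > 0" and \<delta>: "0 < \<delta>" "\<delta> < 1"
    and K: "K = nat \<lceil>2 * ln (2 / \<delta>)\<rceil>" and bias: "\<bar>\<mu> - c\<bar> \<le> b"
  shows "measure_pmf.prob (median_of_means L K p) {e. \<bar>e - c\<bar> \<le> \<gamma> + b} \<ge> 1 - \<delta>"
proof -
  let ?q = "map_pmf mean_list (iid_pmf L p)"
  let ?lo = "\<mu> - \<gamma>" and ?hi = "\<mu> + \<gamma>"
  have ln: "0 < ln (2 / \<delta>)" using \<delta> by simp
  have K0: "K > 0" unfolding K using ln by simp
  have Kge: "2 * ln (2 / \<delta>) \<le> real K" unfolding K by linarith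
  have "measure_pmf.prob ?q {y. \<not> (?lo \<le> y \<and> y \<le> ?hi)} = measure_pmf.prob ?q {y. \<gamma> < \<bar>y - \<mu>\<bar>}"
    by (intro arg_cong[where f="measure_pmf.prob ?q"]) auto
  also have "\<dots> \<le> measure_pmf.expectation p (\<lambda>x. (x - \<mu>)\<^sup>2) / (real L * \<gamma>\<^sup>2)"
    by (rule chebyshev_mean_list[OF B \<mu> L \<gamma>])
  also have "\<dots> \<le> 1/25" using V L \<gamma> by (simp add: divide_le_eq)
  finally have "measure_pmf.prob (map_pmf median_list (iid_pmf K ?q)) {e. \<not> (?lo \<le> e \<and> e \<le> ?hi)} \<le> (49/125) ^ K"
    by (rule median_failure[OF _ K0])
  \<comment> \<open>49/125 is below 1/2 = 1 - 1/2, a lower bound of exp (- 1/2). The exponent K / 2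
    is then at least ln (2 / \<delta>), which accounts for the factor 2 in K.\<close>
  also have "\<dots> \<le> exp (- (1/2)) ^ K"
    using exp_ge_add_one_self[of "- (1/2) :: real"] by (intro power_mono) auto
  also have "\<dots> = exp (- (real K / 2))" by (simp add: exp_of_nat_mult[symmetric])
  also have "\<dots> \<le> exp (- ln (2 / \<delta>))" using Kge by simp
  also have "\<dots> = \<delta> / 2" using \<delta> by (simp add: exp_minus)
  also have "\<dots> \<le> \<delta>" using \<delta> by simp
  finally have bad: "measure_pmf.prob (median_of_means L K p) {e. \<not> (?lo \<le> e \<and> e \<le> ?hi)} \<le> \<delta>"
    unfolding median_of_means_def .
  have "1 - \<delta> \<le> 1 - measure_pmf.prob (median_of_means L K p) {e. \<not> (?lo \<le> e \<and> e \<le> ?hi)}"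
    using bad by simp
  also have "\<dots> = measure_pmf.prob (median_of_means L K p) (- {e. \<not> (?lo \<le> e \<and> e \<le> ?hi)})"
    using measure_pmf.prob_compl[of "{e. \<not> (?lo \<le> e \<and> e \<le> ?hi)}" "median_of_means L K p"]
    by (simp add: Compl_eq_Diff_UNIV)
  also have "\<dots> \<le> measure_pmf.prob (median_of_means L K p) {e. \<bar>e - c\<bar> \<le> \<gamma> + b}"
    by (rule measure_pmf.finite_measure_mono) (use bias in auto)
  finally show ?thesis .
qed

section \<open>Positive semidefinite matrices as sums of rank-one matrices\<close>

text \<open>Matrices are functions of two indices of which only values below n count. Induction on
  the dimension then keeps the same function and needs no submatrices.\<close>

definition herm_on :: "nat \<Rightarrow> (nat \<Rightarrow> nat \<Rightarrow> complex) \<Rightarrow> bool" where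
  "herm_on n A \<longleftrightarrow> (\<forall>i<n. \<forall>j<n. A j i = cnj (A i j))"

definition sesq :: "nat \<Rightarrow> (nat \<Rightarrow> nat \<Rightarrow> complex) \<Rightarrow> (nat \<Rightarrow> complex) \<Rightarrow> complex" where
  "sesq n A v = (\<Sum>i<n. \<Sum>j<n. cnj (v i) * A i j * v j)"

definition psd_on :: "nat \<Rightarrow> (nat \<Rightarrow> nat \<Rightarrow> complex) \<Rightarrow> bool" where
  "psd_on n A \<longleftrightarrow> herm_on n A \<and> (\<forall>v. 0 \<le> Re (sesq n A v))"

lemma sesq_cong:
  assumes "\<And>i. i < n \<Longrightarrow> v i = w i" "\<And>i j. i < n \<Longrightarrow> j < n \<Longrightarrow> A i j = B i j"
  shows "sesq n A v = sesq n B w"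
  unfolding sesq_def by (intro sum.cong refl) (simp add: assms)

lemma sesq_Suc:
  assumes "herm_on (Suc n) A"
  shows "sesq (Suc n) A v = sesq n A v + cnj (v n) * (\<Sum>j<n. A n j * v j)
     + cnj (cnj (v n) * (\<Sum>j<n. A n j * v j)) + cnj (v n) * A n n * v n"
proof -
  have h: "A i n = cnj (A n i)" if "i < n" for i
    using assms[unfolded herm_on_def, rule_format, of n i] that by simp
  have "(\<Sum>i<n. cnj (v i) * A i n * v n) = (\<Sum>i<n. cnj (v i) * cnj (A n i) * v n)"
    by (intro sum.cong refl) (simp add: h)
  also have "\<dots> = cnj (cnj (v n) * (\<Sum>j<n. A n j * v j))"
    by (simp add: sum_distrib_left sum_distrib_right mult_ac)
  finally have 1: "(\<Sum>i<n. cnj (v i) * A i n * v n) = cnj (cnj (v n) * (\<Sum>j<n. A n j * v j))" .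
  have 2: "(\<Sum>j<n. cnj (v n) * A n j * v j) = cnj (v n) * (\<Sum>j<n. A n j * v j)"
    by (simp add: sum_distrib_left mult_ac)
  show ?thesis unfolding sesq_def by (simp add: sum.distrib 1 2)
qed

text \<open>A Cholesky decomposition that removes the last index. A zero pivot forces the last row
  to vanish; a positive pivot \<open>a\<close> leaves the Schur complement \<open>?A'\<close>, which
  is positive semidefinite because its form is the minimum of the full form over the last
  coordinate. This avoids eigenvectors.\<close>

lemma psd_on_rank_one_aux:
  "psd_on n A \<Longrightarrow> \<exists>u. \<forall>i<n. \<forall>j<n. A i j = (\<Sum>k<n. u k i * cnj (u k j))"
proof (induction n arbitrary: A)
  case 0
  then show ?case by simp
next
  case (Suc n)
  have herm: "herm_on (Suc n) A" and pos: "\<And>v. 0 \<le> Re (sesq (Suc n) A v)"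
    using Suc.prems by (auto simp: psd_on_def)
  have hA: "A j i = cnj (A i j)" if "i < Suc n" "j < Suc n" for i j
    using herm that unfolding herm_on_def by blast
  define a where "a = Re (A n n)"
  have "Im (A n n) = 0" using herm[unfolded herm_on_def, rule_format, of n n] by (simp add: complex_eq_iff)
  then have ann: "A n n = complex_of_real a" by (simp add: a_def complex_eq_iff)
  define b where "b v = (\<Sum>j<n. A n j * v j)" for v
  have ext: "0 \<le> Re (sesq n A v) + 2 * Re (cnj t * b v) + a * (cmod t)\<^sup>2" for v t
  proof -
    define w where "w = v(n := t)"
    have wn: "w n = t" by (simp add: w_def)
    have bw: "b w = b v" unfolding b_def w_def by (intro sum.cong) auto
    have sw: "sesq n A w = sesq n A v" unfolding w_def by (rule sesq_cong) auto
    have "Re (cnj t * complex_of_real a * t) = a * (cmod t)\<^sup>2"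
      unfolding cmod_power2 by (simp add: power2_eq_square algebra_simps)
    then have "Re (sesq (Suc n) A w) = Re (sesq n A v) + 2 * Re (cnj t * b v) + a * (cmod t)\<^sup>2"
      unfolding sesq_Suc[OF herm] b_def[symmetric] wn bw sw ann by simp
    then show ?thesis using pos[of w] by simp
  qed
  have a0: "a \<ge> 0" using ext[of "\<lambda>_. 0" 1] by (simp add: b_def sesq_def)
  show ?case
  proof (cases "a = 0")
    case True
    have b0: "b v = 0" for v
    proof (rule ccontr)
      assume nz: "b v \<noteq> 0"
      \<comment> \<open>The form is affine along the direction - b v when the pivot is 0. This step
        length brings its value down to -1.\<close>
      let ?s = "(Re (sesq n A v) + 1) / (2 * (cmod (b v))\<^sup>2)"
      have "cnj (- of_real ?s * b v) * b v = of_real (- ?s * (cmod (b v))\<^sup>2)"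
        by (simp add: complex_norm_square mult_ac del: of_real_power)
      then have "Re (cnj (- of_real ?s * b v) * b v) = - ?s * (cmod (b v))\<^sup>2" by simp
      also have "\<dots> = - (Re (sesq n A v) + 1) / 2" using nz by (simp add: field_simps)
      finally have e: "Re (cnj (- of_real ?s * b v) * b v) = - (Re (sesq n A v) + 1) / 2" .
      show False using ext[of v "- of_real ?s * b v"] unfolding e True by (simp add: field_simps)
    qed
    have An: "A n i = 0" if i: "i < n" for i
    proof -
      have "b (\<lambda>j. if j = i then 1 else 0) = A n i"
      proof -
        have "b (\<lambda>j. if j = i then 1 else 0) = (\<Sum>j<n. if j = i then A n i else 0)"
          unfolding b_def by (intro sum.cong) auto
        then show ?thesis using i by simp
      qed
      then show ?thesis using b0 by simp
    qed
    have "psd_on n A" unfolding psd_on_def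
    proof
      show "herm_on n A" unfolding herm_on_def using hA less_SucI by blast
      show "\<forall>v. 0 \<le> Re (sesq n A v)" using ext[of _ 0] by simp
    qed
    from Suc.IH[OF this] obtain u where u: "\<And>i j. i < n \<Longrightarrow> j < n \<Longrightarrow> A i j = (\<Sum>k<n. u k i * cnj (u k j))" by blast
    \<comment> \<open>The list has n + 1 slots; the last one holds the zero vector, since the last
      row and column vanish.\<close>
    let ?u = "\<lambda>k i. if k = n \<or> i = n then 0 else u k i"
    have An': "A i n = 0" if "i < n" for i using hA[of n i] An[OF that] that by simp
    have dec: "A i j = (\<Sum>k<Suc n. ?u k i * cnj (?u k j))" if "i < Suc n" "j < Suc n" for i j
    proof (cases "i = n \<or> j = n")
      case True
      then show ?thesis using that An An' ann \<open>a = 0\<close> by (auto simp: less_Suc_eq)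
    next
      case False
      then have "(\<Sum>k<Suc n. ?u k i * cnj (?u k j)) = (\<Sum>k<n. u k i * cnj (u k j))"
        by (auto intro!: sum.cong)
      moreover have "i < n" "j < n" using that False by auto
      ultimately show ?thesis using u[of i j] by (simp only:)
    qed
    show ?thesis by (rule exI[of _ ?u], intro allI impI, rule dec)
  next
    case False
    then have ap: "a > 0" using a0 by simp
    define w where "w i = A i n / complex_of_real (sqrt a)" for i
    have sq: "complex_of_real (sqrt a) * complex_of_real (sqrt a) = of_real a"
    proof -
      have "sqrt a * sqrt a = a" using ap by simp
      then show ?thesis by (metis of_real_mult)
    qed
    have ww: "w i * cnj (w j) = A i n * cnj (A j n) / of_real a" for i j
      unfolding w_def by (simp add: sq)
    let ?A' = "\<lambda>i j. A i j - w i * cnj (w j)"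
    have "psd_on n ?A'" unfolding psd_on_def
    proof
      show "herm_on n ?A'" unfolding herm_on_def
      proof (intro allI impI)
        fix i j assume "i < n" "j < n"
        then show "?A' j i = cnj (?A' i j)" using hA[of i j] by simp
      qed
      show "\<forall>v. 0 \<le> Re (sesq n ?A' v)"
      proof
        fix v
        have bw: "b v / of_real (sqrt a) = (\<Sum>j<n. cnj (w j) * v j)"
          unfolding b_def sum_divide_distrib
        proof (intro sum.cong refl)
          fix j assume "j \<in> {..<n}"
          then have "A n j = cnj (A j n)" using hA[of j n] by simp
          then show "A n j * v j / of_real (sqrt a) = cnj (w j) * v j" by (simp add: w_def)
        qed
        have "sesq n ?A' v = sesq n A v - (\<Sum>i<n. \<Sum>j<n. (cnj (v i) * w i) * (cnj (w j) * v j))"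
          unfolding sesq_def by (simp add: algebra_simps sum_subtractf)
        also have "(\<Sum>i<n. \<Sum>j<n. (cnj (v i) * w i) * (cnj (w j) * v j)) = cnj (b v / of_real (sqrt a)) * (b v / of_real (sqrt a))"
          unfolding bw sum_product[symmetric] by (simp add: mult_ac)
        also have "\<dots> = of_real ((cmod (b v / of_real (sqrt a)))\<^sup>2)"
          by (simp only: complex_norm_square mult.commute)
        also have "(cmod (b v / of_real (sqrt a)))\<^sup>2 = (cmod (b v))\<^sup>2 / a"
          using ap by (simp add: norm_divide power_divide)
        finally have 1: "Re (sesq n ?A' v) = Re (sesq n A v) - (cmod (b v))\<^sup>2 / a" by simp
        \<comment> \<open>The choice t = - b v / a minimises the quadratic polynomial in
          \<open>ext\<close>, and its minimum is exactly the form of the Schur complement.\<close>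
        have "cnj (- b v / of_real a) * b v = of_real (- (cmod (b v))\<^sup>2 / a)"
          by (simp add: complex_norm_square mult_ac del: of_real_power)
        from arg_cong[OF this, of Re]
        have 2: "Re (cnj (- b v / of_real a) * b v) = - (cmod (b v))\<^sup>2 / a" by (simp only: Re_complex_of_real)
        have 3: "a * (cmod (- b v / of_real a))\<^sup>2 = (cmod (b v))\<^sup>2 / a"
          using ap by (simp add: norm_divide power_divide) (simp add: power2_eq_square)
        show "0 \<le> Re (sesq n ?A' v)" using ext[of v "- b v / of_real a"] unfolding 2 3 1 by linarith
      qed
    qed
    from Suc.IH[OF this] obtain u where u: "\<And>i j. i < n \<Longrightarrow> j < n \<Longrightarrow> ?A' i j = (\<Sum>k<n. u k i * cnj (u k j))" by blast
    let ?u = "\<lambda>k i. if k = n then w i else if i = n then 0 else u k i"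
    have An: "A n j = cnj (A j n)" if "j < n" for j using hA[of j n] that by simp
    have dec: "A i j = (\<Sum>k<Suc n. ?u k i * cnj (?u k j))" if "i < Suc n" "j < Suc n" for i j
    proof (cases "i = n \<or> j = n")
      case True
      then have "(\<Sum>k<Suc n. ?u k i * cnj (?u k j)) = w i * cnj (w j)" by auto
      also have "\<dots> = A i j" unfolding ww using True that ap An by (auto simp: less_Suc_eq ann)
      finally show ?thesis ..
    next
      case False
      then have "(\<Sum>k<Suc n. ?u k i * cnj (?u k j)) = (\<Sum>k<n. u k i * cnj (u k j)) + w i * cnj (w j)"
        by (auto intro!: sum.cong)
      also have "\<dots> = A i j" using u[of i j, symmetric] that False by simp
      finally show ?thesis ..
    qed
    show ?thesis by (rule exI[of _ ?u], intro allI impI, rule dec)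
  qed
qed

lemma psd_on_rank_one:
  assumes "psd_on n A"
  obtains u where "\<And>i j. i < n \<Longrightarrow> j < n \<Longrightarrow> A i j = (\<Sum>k<n. u k i * cnj (u k j))"
  using psd_on_rank_one_aux[OF assms] by blast

lemma psd_mat_psd_on:
  assumes "psd_mat M" "M \<in> carrier_mat n n"
  shows "psd_on n (\<lambda>i j. M $$ (i, j))"
  unfolding psd_on_def
proof
  have adj: "adj M = M" and pos: "\<And>v. v \<in> carrier_vec n \<Longrightarrow> 0 \<le> Re (\<Sum>i<n. cnj (v $ i) * (M *\<^sub>v v) $ i)"
    using assms unfolding psd_mat_def hermitian_mat_def by auto
  show "herm_on n (\<lambda>i j. M $$ (i, j))" unfolding herm_on_def
  proof (intro allI impI)
    fix i j assume "i < n" "j < n"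
    then have "adj M $$ (j, i) = cnj (M $$ (i, j))" using assms(2) by (simp add: adj_def)
    then show "M $$ (j, i) = cnj (M $$ (i, j))" unfolding adj .
  qed
  show "\<forall>v. 0 \<le> Re (sesq n (\<lambda>i j. M $$ (i, j)) v)"
  proof
    fix v :: "nat \<Rightarrow> complex"
    have "(\<Sum>i<n. cnj (Matrix.vec n v $ i) * (M *\<^sub>v Matrix.vec n v) $ i) = sesq n (\<lambda>i j. M $$ (i, j)) v"
      unfolding sesq_def using assms(2)
      by (intro sum.cong refl)
         (auto simp: scalar_prod_def sum_distrib_left mult_ac lessThan_atLeast0 intro!: sum.cong)
    then show "0 \<le> Re (sesq n (\<lambda>i j. M $$ (i, j)) v)" using pos[of "Matrix.vec n v"] by simp
  qed
qed

section \<open>The measurement circuit\<close>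

text \<open>The character (-1)^(z . a) of the group of bit strings: both the sign that Z^z puts on
  |a> and, up to scaling, an entry of the Hadamard power.\<close>

definition par :: "nat \<Rightarrow> nat \<Rightarrow> complex" where
  "par z a = (-1) ^ popcount (z AND a)"

lemma par_commute: "par z a = par a z"
  unfolding par_def by (simp add: and.commute)

lemma bit_nat_less: "(m::nat) < 2 ^ n \<Longrightarrow> bit m j \<Longrightarrow> j < n"
  by (metis bit_take_bit_iff take_bit_nat_eq_self)

text \<open>Bit by bit the sign is multiplicative, so that xor and the Kronecker recursion can each
  be handled one bit at a time.\<close>

lemma par_prod:
  assumes "z < 2 ^ n"
  shows "par z a = (\<Prod>j<n. if bit z j \<and> bit a j then -1 else 1)"
proof -
  have "{j. bit (z AND a) j} = {j \<in> {..<n}. bit z j \<and> bit a j}"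
    using bit_nat_less[OF assms] by (auto simp: bit_and_iff)
  then have "par z a = (\<Prod>j\<in>{j \<in> {..<n}. bit z j \<and> bit a j}. -1)"
    unfolding par_def popcount_def by simp
  also have "\<dots> = (\<Prod>j<n. if bit z j \<and> bit a j then -1 else 1)"
    by (rule prod.inter_filter) simp
  finally show ?thesis .
qed

lemma par_xor: "par z (a XOR b) = par z a * par z b"
proof -
  obtain n where n: "z < 2 ^ n" by (metis less_exp)
  show ?thesis unfolding par_prod[OF n] prod.distrib[symmetric]
    by (intro prod.cong refl) (auto simp: bit_xor_iff)
qed

lemma par_xor_left: "par (z XOR y) a = par z a * par y a"
  by (simp add: par_commute[of _ a] par_xor)

lemma par_square: "par z a * par z a = 1"
  unfolding par_def by (simp flip: power_add)

lemma cnj_par [simp]: "cnj (par z a) = par z a"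
  unfolding par_def by simp

lemma xor_less: "(a::nat) < 2 ^ n \<Longrightarrow> b < 2 ^ n \<Longrightarrow> a XOR b < 2 ^ n"
  by (metis take_bit_nat_eq_self take_bit_nat_less_exp take_bit_xor)

lemma xor_xor_cancel: "((a::nat) XOR b) XOR b = a"
  by (simp add: xor.assoc)

lemma sum_xor_reindex:
  assumes "x < 2 ^ n"
  shows "(\<Sum>a<2 ^ n. f (a XOR x)) = (\<Sum>a<(2::nat) ^ n. f a)"
  by (rule sum.reindex_bij_witness[of _ "\<lambda>a. a XOR x" "\<lambda>a. a XOR x"])
     (auto simp: xor_xor_cancel xor_less assms)

text \<open>Flipping in z a bit that is set in c permutes the range and changes the sign of every
  term.\<close>

lemma sum_par:
  assumes c: "c < 2 ^ n" "c \<noteq> 0"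
  shows "(\<Sum>z<2 ^ n. par z c) = 0"
proof -
  obtain j where j: "bit c j" using c(2) by (metis bit_eq_iff bit_0_eq bot_apply bot_bool_def)
  then have jn: "j < n" using bit_nat_less c(1) by blast
  have p: "(2::nat) ^ j < 2 ^ n" using jn by simp
  have "{i. bit ((2::nat) ^ j AND c) i} = {j}" using j by (auto simp: bit_and_iff bit_exp_iff)
  then have "par (2 ^ j) c = -1" unfolding par_def popcount_def by simp
  then have "(\<Sum>z<2 ^ n. par (z XOR 2 ^ j) c) = - (\<Sum>z<2 ^ n. par z c)"
    by (simp add: par_xor_left sum_negf)
  then show ?thesis using sum_xor_reindex[OF p, of "\<lambda>z. par z c"] by simp
qed

lemma sum_par_product:
  assumes "a < 2 ^ n" "b < 2 ^ n"
  shows "(\<Sum>z<2 ^ n. par z a * par z b) = (if a = b then 2 ^ n else 0)"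
proof (cases "a = b")
  case True
  then show ?thesis by (simp add: par_square)
next
  case False
  have "a XOR b \<noteq> 0" using False by (metis xor_xor_cancel xor.left_neutral)
  then show ?thesis using sum_par[of "a XOR b" n] assms False by (simp add: par_xor xor_less)
qed

section \<open>Amplitudes and outcome probabilities of the circuit\<close>

lemma hadamard_pow_carrier: "hadamard_pow n \<in> carrier_mat (2 ^ n) (2 ^ n)"
  by (induction n) (auto simp: kron_def hadamard_def)

text \<open>The recursion adds the new factor at the top: \<open>i div 2 ^ n\<close> is bit n, and
  \<open>i mod 2 ^ n\<close> keeps the lower bits.\<close>

lemma hadamard_pow_entry:
  "i < 2 ^ n \<Longrightarrow> j < 2 ^ n \<Longrightarrow> hadamard_pow n $$ (i, j) = par i j / complex_of_real (sqrt (2 ^ n))"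
proof (induction n arbitrary: i j)
  case 0
  then show ?case by (simp add: par_def popcount_def)
next
  case (Suc n)
  have dim: "dim_row (hadamard_pow n) = 2 ^ n" "dim_col (hadamard_pow n) = 2 ^ n"
    using hadamard_pow_carrier[of n] by auto
  have d2: "i div 2 ^ n < 2" "j div 2 ^ n < 2"
    using Suc.prems by (auto simp: less_mult_imp_div_less mult.commute)
  have m: "i mod 2 ^ n < 2 ^ n" "j mod 2 ^ n < 2 ^ n" by auto
  have "hadamard_pow (Suc n) $$ (i, j)
      = hadamard $$ (i div 2 ^ n, j div 2 ^ n) * hadamard_pow n $$ (i mod 2 ^ n, j mod 2 ^ n)"
    using Suc.prems by (simp add: kron_def dim hadamard_def)
  also have "hadamard $$ (i div 2 ^ n, j div 2 ^ n)
      = (if bit i n \<and> bit j n then -1 else 1) / complex_of_real (sqrt 2)"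
    using d2 by (auto simp: hadamard_def bit_iff_odd less_2_cases_iff)
  also have "hadamard_pow n $$ (i mod 2 ^ n, j mod 2 ^ n)
      = par (i mod 2 ^ n) (j mod 2 ^ n) / complex_of_real (sqrt (2 ^ n))"
    by (rule Suc.IH[OF m])
  also have "par (i mod 2 ^ n) (j mod 2 ^ n) = (\<Prod>k<n. if bit i k \<and> bit j k then -1 else 1)"
    unfolding par_prod[OF m(1)]
    by (intro prod.cong refl) (auto simp: bit_take_bit_iff simp flip: take_bit_eq_mod)
  also have "(if bit i n \<and> bit j n then -1 else 1) / complex_of_real (sqrt 2) *
      ((\<Prod>k<n. if bit i k \<and> bit j k then -1 else 1) / complex_of_real (sqrt (2 ^ n)))
    = par i j / complex_of_real (sqrt (2 ^ Suc n))"
    unfolding par_prod[OF Suc.prems(1)] by (simp add: real_sqrt_mult)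
  finally show ?case .
qed

text \<open>Serves both the joint register, whose index is z * 2^n + x, and the base-d digits of
  tensor indices.\<close>

lemma sum_div_mod:
  fixes f :: "nat \<Rightarrow> nat \<Rightarrow> 'a :: comm_monoid_add"
  shows "(\<Sum>I<m * k. f (I div k) (I mod k)) = (\<Sum>a<m. \<Sum>b<k. f a b)"
proof -
  have "(\<Sum>a<m. \<Sum>b<k. f a b) = (\<Sum>(a, b)\<in>{..<m} \<times> {..<k}. f a b)"
    by (rule sum.cartesian_product)
  also have "\<dots> = (\<Sum>I<m * k. f (I div k) (I mod k))"
  proof (rule sum.reindex_bij_witness[of _ "\<lambda>I. (I div k, I mod k)" "\<lambda>(a, b). a * k + b"])
    fix ab assume "ab \<in> {..<m} \<times> {..<k}"
    then obtain a b where ab: "ab = (a, b)" "a < m" "b < k" by auto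
    have "a * k + b < (a + 1) * k" using ab by simp
    also have "\<dots> \<le> m * k" using ab by (intro mult_le_mono1) auto
    finally show "(case ab of (a, b) \<Rightarrow> a * k + b) \<in> {..<m * k}" using ab by simp
    show "((case ab of (a, b) \<Rightarrow> a * k + b) div k, (case ab of (a, b) \<Rightarrow> a * k + b) mod k) = ab"
      using ab by simp
  next
    fix I assume I: "I \<in> {..<m * k}"
    then have "k > 0" by (auto intro: Nat.gr0I)
    then show "(I div k, I mod k) \<in> {..<m} \<times> {..<k}" using I by (auto simp: less_mult_imp_div_less)
  qed auto
  finally show ?thesis by simp
qed

lemma shadow_circuit_carrier: "shadow_circuit n \<in> carrier_mat (2 ^ n * 2 ^ n) (2 ^ n * 2 ^ n)"
  using hadamard_pow_carrier[of n] unfolding shadow_circuit_def cnot_layer_def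
  by (auto simp: kron_def)

lemma shadow_circuit_entry:
  assumes zx: "z < 2 ^ n" "x < 2 ^ n" and ab: "a < 2 ^ n" "b < 2 ^ n"
  shows "shadow_circuit n $$ (z * 2 ^ n + x, a * 2 ^ n + b)
    = (if x = a XOR b then par z a / complex_of_real (sqrt (2 ^ n)) else 0)"
proof -
  let ?N = "2 ^ n :: nat" and ?H = "hadamard_pow n"
  have dim: "dim_row ?H = ?N" "dim_col ?H = ?N" using hadamard_pow_carrier[of n] by auto
  have lt: "c * ?N + e < ?N * ?N" if "c < ?N" "e < ?N" for c e
  proof -
    have "c * ?N + e < (c + 1) * ?N" using that by simp
    also have "\<dots> \<le> ?N * ?N" using that by (intro mult_le_mono1) auto
    finally show ?thesis .
  qed
  let ?J = "a * ?N + ((a XOR b))"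
  have J: "?J < ?N * ?N" using lt[OF ab(1) xor_less[OF ab]] .
  have "shadow_circuit n $$ (z * ?N + x, a * ?N + b) =
     (\<Sum>C<?N * ?N. kron ?H (1\<^sub>m ?N) $$ (z * ?N + x, C) * cnot_layer n $$ (C, a * ?N + b))"
    unfolding shadow_circuit_def using lt[OF zx] lt[OF ab]
    by (subst index_mult_mat) (auto simp: scalar_prod_def kron_def dim cnot_layer_def lessThan_atLeast0)
  also have "\<dots> = (\<Sum>C<?N * ?N. if C = ?J then kron ?H (1\<^sub>m ?N) $$ (z * ?N + x, ?J) else 0)"
    using lt[OF ab] ab by (intro sum.cong refl) (auto simp: cnot_layer_def)
  also have "\<dots> = kron ?H (1\<^sub>m ?N) $$ (z * ?N + x, ?J)" using J by simp
  also have "\<dots> = ?H $$ (z, a) * (if x = a XOR b then 1 else 0)"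
    using lt[OF zx] J zx ab xor_less[OF ab] by (simp add: kron_def dim)
  also have "\<dots> = (if x = a XOR b then par z a / complex_of_real (sqrt (2 ^ n)) else 0)"
    by (simp add: hadamard_pow_entry[OF zx(1) ab(1)])
  finally show ?thesis .
qed

text \<open>The entries of zeta*_{x,z} in closed form: X^x moves the amplitude at i xor x to i,
  after Z^z has put its sign on it.\<close>

definition shadow_vec :: "(nat \<Rightarrow> complex) \<Rightarrow> nat \<Rightarrow> nat \<Rightarrow> nat \<Rightarrow> complex" where
  "shadow_vec \<zeta> z x i = par z (i XOR x) * cnj (\<zeta> (i XOR x))"

lemma mat_mult_entry:
  assumes "A \<in> carrier_mat m k" "B \<in> carrier_mat k l" "i < m" "j < l"
  shows "(A * B) $$ (i, j) = (\<Sum>r<k. A $$ (i, r) * B $$ (r, j))"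
  using assms by (auto simp: scalar_prod_def lessThan_atLeast0)

text \<open>Used with p = \<open>par z x\<close>: the Hadamard signs at a and b may be replaced by
  those at a xor x and b xor x, since the common sign occurs twice.\<close>

lemma cancel_sign:
  fixes p :: complex
  assumes "p * p = 1"
  shows "a / q * (r * (s * t)) * (b / q) = (a * p * s) * r * (b * p * t) / (q * q)"
proof -
  have "(a * p * s) * r * (b * p * t) = (p * p) * (a * (r * (s * t)) * b)" by (simp only: mult_ac)
  then show ?thesis using assms by simp
qed

text \<open>Outcome x selects b = a xor x in R2, so the row of the circuit belonging to (z, x),
  applied to zeta in R2, leaves the row vector with entries
  \<open>par z a * \<zeta> $ (a XOR x)\<close> on R1, up to 1 / sqrt N. Up to the global sign
  \<open>par z x\<close>, which drops out, this is the adjoint of \<open>shadow_vec\<close>.\<close>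

lemma outcome_prob_eq:
  assumes zx: "z < 2 ^ n" "x < 2 ^ n" and \<rho>: "\<rho> \<in> carrier_mat (2 ^ n) (2 ^ n)" and \<zeta>: "\<zeta> \<in> carrier_vec (2 ^ n)"
  shows "outcome_prob n \<rho> \<zeta> (z, x) = Re (sesq (2 ^ n) (\<lambda>i j. \<rho> $$ (i, j)) (shadow_vec (\<lambda>i. \<zeta> $ i) z x)) / 2 ^ n"
proof -
  let ?N = "2 ^ n :: nat" and ?U = "shadow_circuit n"
  let ?D = "?N * ?N" and ?I = "z * 2 ^ n + x"
  let ?M = "kron \<rho> (outer \<zeta>)"
  have I: "?I < ?D"
  proof -
    have "?I < (z + 1) * ?N" using zx by simp
    also have "\<dots> \<le> ?D" using zx by (intro mult_le_mono1) auto
    finally show ?thesis .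
  qed
  note U = shadow_circuit_carrier[of n]
  have M: "?M \<in> carrier_mat ?D ?D" using \<rho> \<zeta> by (auto simp: kron_def outer_def)
  have A: "adj ?U \<in> carrier_mat ?D ?D" using U by (auto simp: adj_def)
  define u where "u a b = (if x = a XOR b then par z a / complex_of_real (sqrt (2 ^ n)) else 0)" for a b
  have Ue: "?U $$ (?I, J) = u (J div ?N) (J mod ?N)" if "J < ?D" for J
  proof -
    have "J div ?N < ?N" "J mod ?N < ?N" using that by (auto simp: less_mult_imp_div_less)
    from shadow_circuit_entry[OF zx this] show ?thesis unfolding u_def by (simp add: div_mult_mod_eq)
  qed
  have Me: "?M $$ (J, K) = \<rho> $$ (J div ?N, K div ?N) * (\<zeta> $ (J mod ?N) * cnj (\<zeta> $ (K mod ?N)))"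
    if "J < ?D" "K < ?D" for J K
    using that \<rho> \<zeta> by (auto simp: kron_def outer_def)
  have "(?U * ?M * adj ?U) $$ (?I, ?I) = (\<Sum>K<?D. (?U * ?M) $$ (?I, K) * adj ?U $$ (K, ?I))"
    by (rule mat_mult_entry[of _ ?D ?D _ ?D]) (use U M A I in auto)
  also have "\<dots> = (\<Sum>K<?D. (\<Sum>J<?D. ?U $$ (?I, J) * ?M $$ (J, K)) * cnj (?U $$ (?I, K)))"
    using U I mat_mult_entry[OF U M I] by (intro sum.cong refl) (auto simp: adj_def)
  also have "\<dots> = (\<Sum>K<?D. (\<Sum>J<?D. u (J div ?N) (J mod ?N) *
      (\<rho> $$ (J div ?N, K div ?N) * (\<zeta> $ (J mod ?N) * cnj (\<zeta> $ (K mod ?N))))) * cnj (u (K div ?N) (K mod ?N)))"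
    using Ue Me by (intro sum.cong arg_cong2[where f="(*)"] refl) auto
  also have "\<dots> = (\<Sum>a'<?N. \<Sum>b'<?N. (\<Sum>a<?N. \<Sum>b<?N. u a b * (\<rho> $$ (a, a') * (\<zeta> $ b * cnj (\<zeta> $ b')))) * cnj (u a' b'))"
    unfolding sum_div_mod[of "\<lambda>a b. u a b * (\<rho> $$ (a, K div ?N) * (\<zeta> $ b * cnj (\<zeta> $ (K mod ?N))))" ?N ?N for K]
    by (rule sum_div_mod[of "\<lambda>a' b'. (\<Sum>a<?N. \<Sum>b<?N. u a b * (\<rho> $$ (a, a') * (\<zeta> $ b * cnj (\<zeta> $ b')))) * cnj (u a' b')"])
  also have "\<dots> = (\<Sum>a'<?N. (\<Sum>a<?N. (par z a / sqrt (2 ^ n)) * (\<rho> $$ (a, a') * (\<zeta> $ (a XOR x) * cnj (\<zeta> $ (a' XOR x)))))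
      * cnj (par z a' / sqrt (2 ^ n)))"
  proof (intro sum.cong refl)
    have pick: "(\<Sum>b<?N. u a b * f b) = par z a / sqrt (2 ^ n) * f (a XOR x)" if a: "a < ?N" for a f
    proof -
      have iff: "x = a XOR b \<longleftrightarrow> b = a XOR x" for b
        by (metis xor.assoc xor_self_eq xor.left_neutral)
      have "(\<Sum>b<?N. u a b * f b) = (\<Sum>b<?N. if b = a XOR x then par z a / sqrt (2 ^ n) * f (a XOR x) else 0)"
        unfolding u_def iff by (intro sum.cong) auto
      then show ?thesis using xor_less[OF a zx(2)] by simp
    qed
    fix a' assume a': "a' \<in> {..<?N}"
    have "(\<Sum>a<?N. \<Sum>b<?N. u a b * (\<rho> $$ (a, a') * (\<zeta> $ b * cnj (\<zeta> $ b'))))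
      = (\<Sum>a<?N. par z a / sqrt (2 ^ n) * (\<rho> $$ (a, a') * (\<zeta> $ (a XOR x) * cnj (\<zeta> $ b'))))" for b'
      by (intro sum.cong refl pick) auto
    moreover have "(\<Sum>b'<?N. F b' * cnj (u a' b')) = F (a' XOR x) * cnj (par z a' / sqrt (2 ^ n))" for F
    proof -
      have "cnj (\<Sum>b'<?N. F b' * cnj (u a' b')) = (\<Sum>b'<?N. u a' b' * cnj (F b'))"
        by (simp add: mult.commute)
      also have "\<dots> = par z a' / sqrt (2 ^ n) * cnj (F (a' XOR x))" using a' by (intro pick) auto
      finally show ?thesis by (metis complex_cnj_cnj complex_cnj_mult mult.commute)
    qed
    ultimately show "(\<Sum>b'<?N. (\<Sum>a<?N. \<Sum>b<?N. u a b * (\<rho> $$ (a, a') * (\<zeta> $ b * cnj (\<zeta> $ b')))) * cnj (u a' b'))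
      = (\<Sum>a<?N. (par z a / sqrt (2 ^ n)) * (\<rho> $$ (a, a') * (\<zeta> $ (a XOR x) * cnj (\<zeta> $ (a' XOR x)))))
      * cnj (par z a' / sqrt (2 ^ n))" by presburger
  qed
  also have "\<dots> = (\<Sum>a'<?N. \<Sum>a<?N. (cnj (shadow_vec (\<lambda>i. \<zeta> $ i) z x a) * \<rho> $$ (a, a') * shadow_vec (\<lambda>i. \<zeta> $ i) z x a') / 2 ^ n)"
  proof -
    have s: "complex_of_real (sqrt (2 ^ n)) * complex_of_real (sqrt (2 ^ n)) = 2 ^ n"
    proof -
      have "sqrt (2 ^ n) * sqrt (2 ^ n) = (2 ^ n :: real)" by simp
      then show ?thesis by (metis of_real_mult of_real_power of_real_numeral)
    qed
    show ?thesis unfolding sum_distrib_right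
      by (intro sum.cong refl)
        (simp only: shadow_vec_def par_xor s[symmetric] complex_cnj_mult complex_cnj_cnj cnj_par
          complex_cnj_divide complex_cnj_complex_of_real cancel_sign[OF par_square[of z x]])
  qed
  also have "\<dots> = sesq ?N (\<lambda>i j. \<rho> $$ (i, j)) (shadow_vec (\<lambda>i. \<zeta> $ i) z x) / 2 ^ n"
    unfolding sesq_def by (subst sum.swap) (simp only: sum_divide_distrib)
  finally have eq: "(?U * ?M * adj ?U) $$ (?I, ?I) = sesq ?N (\<lambda>i j. \<rho> $$ (i, j)) (shadow_vec (\<lambda>i. \<zeta> $ i) z x) / 2 ^ n" .
  have "Re (c / 2 ^ n) = Re c / 2 ^ n" for c
    using Re_divide_of_real[of c "2 ^ n"] by simp
  then show ?thesis unfolding outcome_prob_def using zx eq by simp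
qed

text \<open>The projectors onto the vectors of all outcomes add up to N times the identity: summing
  over z removes the off-diagonal terms by orthogonality of characters, and summing over x produces
  the norm of zeta at each diagonal entry.\<close>

lemma sum_outcomes:
  assumes "(\<Sum>i<2 ^ n. (cmod (\<zeta> i))\<^sup>2) = 1"
  shows "(\<Sum>z<2 ^ n. \<Sum>x<2 ^ n. sesq (2 ^ n) A (shadow_vec \<zeta> z x)) = 2 ^ n * (\<Sum>i<2 ^ n. A i i)"
proof -
  let ?N = "2 ^ n :: nat"
  have "(\<Sum>z<?N. \<Sum>x<?N. sesq ?N A (shadow_vec \<zeta> z x))
    = (\<Sum>z<?N. \<Sum>x<?N. \<Sum>a<?N. \<Sum>b<?N. (par z (a XOR x) * par z (b XOR x)) * (\<zeta> (a XOR x) * cnj (\<zeta> (b XOR x)) * A a b))"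
    unfolding sesq_def shadow_vec_def by (intro sum.cong refl) (simp add: mult_ac)
  also have "\<dots> = (\<Sum>x<?N. \<Sum>a<?N. \<Sum>b<?N. \<Sum>z<?N. (par z (a XOR x) * par z (b XOR x)) * (\<zeta> (a XOR x) * cnj (\<zeta> (b XOR x)) * A a b))"
    by (subst sum.swap, rule sum.cong[OF refl], subst sum.swap, rule sum.cong[OF refl], rule sum.swap)
  also have "\<dots> = (\<Sum>x<?N. \<Sum>a<?N. \<Sum>b<?N. if a = b then 2 ^ n * (\<zeta> (a XOR x) * cnj (\<zeta> (a XOR x)) * A a a) else 0)"
  proof (intro sum.cong refl)
    fix x a b assume xab: "x \<in> {..<?N}" "a \<in> {..<?N}" "b \<in> {..<?N}"
    have "(a XOR x = b XOR x) = (a = b)" by (metis xor_xor_cancel)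
    moreover have "a XOR x < ?N" "b XOR x < ?N" using xab by (auto intro: xor_less)
    ultimately have "(\<Sum>z<?N. par z (a XOR x) * par z (b XOR x)) = (if a = b then 2 ^ n else 0)"
      using sum_par_product[of "a XOR x" n "b XOR x"] by simp
    then show "(\<Sum>z<?N. (par z (a XOR x) * par z (b XOR x)) * (\<zeta> (a XOR x) * cnj (\<zeta> (b XOR x)) * A a b))
      = (if a = b then 2 ^ n * (\<zeta> (a XOR x) * cnj (\<zeta> (a XOR x)) * A a a) else 0)"
      unfolding sum_distrib_right[symmetric] by simp
  qed
  also have "\<dots> = (\<Sum>x<?N. \<Sum>a<?N. 2 ^ n * (\<zeta> (a XOR x) * cnj (\<zeta> (a XOR x)) * A a a))"
    by (intro sum.cong refl) simp
  also have "\<dots> = (\<Sum>a<?N. 2 ^ n * A a a * (\<Sum>x<?N. \<zeta> (x XOR a) * cnj (\<zeta> (x XOR a))))"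
    by (subst sum.swap) (simp add: sum_distrib_left xor.commute mult_ac)
  also have "\<dots> = (\<Sum>a<?N. 2 ^ n * A a a * 1)"
  proof (intro sum.cong refl arg_cong2[where f="(*)"])
    fix a assume "a \<in> {..<?N}"
    then have "(\<Sum>x<?N. \<zeta> (x XOR a) * cnj (\<zeta> (x XOR a))) = (\<Sum>x<?N. \<zeta> x * cnj (\<zeta> x))"
      by (intro sum_xor_reindex[of a n "\<lambda>x. \<zeta> x * cnj (\<zeta> x)"]) auto
    also have "\<dots> = complex_of_real (\<Sum>i<?N. (cmod (\<zeta> i))\<^sup>2)"
      unfolding of_real_sum by (simp only: complex_norm_square)
    also have "\<dots> = 1" unfolding assms by simp
    finally show "(\<Sum>x<?N. \<zeta> (x XOR a) * cnj (\<zeta> (x XOR a))) = 1" .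
  qed
  finally show ?thesis by (simp add: sum_distrib_left)
qed

text \<open>\<open>embed_pmf\<close> returns the intended distribution only for nonnegative values
  of total mass 1. Positivity of \<rho> gives the former; its trace and the norm of \<zeta> give the
  latter.\<close>

lemma outcome_pmf_expectation:
  fixes h :: "nat \<times> nat \<Rightarrow> real"
  assumes \<rho>: "density_mat n \<rho>" and \<zeta>: "unit_state (2 ^ n) \<zeta>"
  shows "measure_pmf.expectation (outcome_pmf n \<rho> \<zeta>) h =
      (\<Sum>z<2 ^ n. \<Sum>x<2 ^ n. Re (sesq (2 ^ n) (\<lambda>i j. \<rho> $$ (i, j)) (shadow_vec (\<lambda>i. \<zeta> $ i) z x)) / 2 ^ n * h (z, x))"
    and "set_pmf (outcome_pmf n \<rho> \<zeta>) \<subseteq> {..<2 ^ n} \<times> {..<2 ^ n}"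
proof -
  let ?N = "2 ^ n :: nat" and ?q = "outcome_prob n \<rho> \<zeta>"
  let ?S = "{..<?N} \<times> {..<?N}"
  have car: "\<rho> \<in> carrier_mat ?N ?N" "\<zeta> \<in> carrier_vec ?N" and psd: "psd_mat \<rho>" and tr: "mtrace \<rho> = 1"
    and unit: "(\<Sum>i<?N. (cmod (\<zeta> $ i))\<^sup>2) = 1"
    using assms unfolding density_mat_def unit_state_def by auto
  have q: "?q (z, x) = Re (sesq ?N (\<lambda>i j. \<rho> $$ (i, j)) (shadow_vec (\<lambda>i. \<zeta> $ i) z x)) / 2 ^ n"
    if "z < ?N" "x < ?N" for z x using outcome_prob_eq[OF that car] .
  have supp: "?q y = 0" if "y \<notin> ?S" for y using that by (cases y) (auto simp: outcome_prob_def)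
  have nonneg: "0 \<le> ?q y" for y
  proof (cases "y \<in> ?S")
    case True
    then show ?thesis using q psd_mat_psd_on[OF psd car(1)] unfolding psd_on_def by (cases y) auto
  next
    case False
    then show ?thesis using supp by simp
  qed
  have "(\<Sum>y\<in>?S. ?q y) = (\<Sum>z<?N. \<Sum>x<?N. ?q (z, x))"
    by (simp add: sum.cartesian_product)
  also have "\<dots> = Re (\<Sum>z<?N. \<Sum>x<?N. sesq ?N (\<lambda>i j. \<rho> $$ (i, j)) (shadow_vec (\<lambda>i. \<zeta> $ i) z x)) / 2 ^ n"
    unfolding Re_sum sum_divide_distrib by (intro sum.cong refl q) auto
  also have "\<dots> = Re (complex_of_real (2 ^ n) * (\<Sum>i<?N. \<rho> $$ (i, i))) / 2 ^ n"
    by (subst sum_outcomes[OF unit]) simp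
  also have "(\<Sum>i<?N. \<rho> $$ (i, i)) = 1" using tr car(1) by (simp add: mtrace_def)
  finally have one: "(\<Sum>y\<in>?S. ?q y) = 1" by simp
  have "(\<integral>\<^sup>+y. ennreal (?q y) \<partial>count_space UNIV) = (\<Sum>y\<in>?S. ennreal (?q y))"
    by (rule nn_integral_count_space') (use supp in auto)
  also have "\<dots> = 1" using one nonneg by (simp add: sum_ennreal)
  finally have pmf: "pmf (outcome_pmf n \<rho> \<zeta>) y = ?q y" for y
    unfolding outcome_pmf_def by (intro pmf_embed_pmf nonneg)
  then show sub: "set_pmf (outcome_pmf n \<rho> \<zeta>) \<subseteq> ?S" using supp by (auto simp: set_pmf_eq)
  have "measure_pmf.expectation (outcome_pmf n \<rho> \<zeta>) h = (\<Sum>y\<in>?S. ?q y * h y)"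
    by (subst integral_measure_pmf[of ?S]) (use sub pmf in auto)
  also have "\<dots> = (\<Sum>z<?N. \<Sum>x<?N. ?q (z, x) * h (z, x))"
    by (simp add: sum.cartesian_product)
  also have "\<dots> = (\<Sum>z<?N. \<Sum>x<?N. Re (sesq ?N (\<lambda>i j. \<rho> $$ (i, j)) (shadow_vec (\<lambda>i. \<zeta> $ i) z x)) / 2 ^ n * h (z, x))"
    by (intro sum.cong refl) (simp add: q)
  finally show "measure_pmf.expectation (outcome_pmf n \<rho> \<zeta>) h =
      (\<Sum>z<?N. \<Sum>x<?N. Re (sesq ?N (\<lambda>i j. \<rho> $$ (i, j)) (shadow_vec (\<lambda>i. \<zeta> $ i) z x)) / 2 ^ n * h (z, x))" .
qed

lemma estimate_eq:
  assumes O: "Obs \<in> carrier_mat (2 ^ n) (2 ^ n)" and \<zeta>: "\<zeta> \<in> carrier_vec (2 ^ n)" and zx: "z < 2 ^ n" "x < 2 ^ n"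
  shows "mtrace (Obs * classical_shadow n \<zeta> x z) =
     (2 ^ n + 1) * sesq (2 ^ n) (\<lambda>i j. Obs $$ (i, j)) (shadow_vec (\<lambda>i. \<zeta> $ i) z x) - mtrace Obs"
proof -
  let ?N = "2 ^ n :: nat" and ?w = "shadow_vec (\<lambda>i. \<zeta> $ i) z x"
  have Z: "(pauli_Z n z *\<^sub>v \<zeta>) $ i = par z i * \<zeta> $ i" if i: "i < ?N" for i
  proof -
    have "(pauli_Z n z *\<^sub>v \<zeta>) $ i = (\<Sum>j<?N. (if i = j then (-1) ^ popcount (z AND j) else 0) * \<zeta> $ j)"
      using i \<zeta> by (auto simp: pauli_Z_def scalar_prod_def lessThan_atLeast0)
    also have "\<dots> = (\<Sum>j<?N. if j = i then par z i * \<zeta> $ i else 0)"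
      by (intro sum.cong) (auto simp: par_def)
    finally show ?thesis using i by simp
  qed
  have Zd: "dim_vec (pauli_Z n z *\<^sub>v \<zeta>) = ?N" by (simp add: pauli_Z_def)
  have X: "(pauli_X n x *\<^sub>v (pauli_Z n z *\<^sub>v \<zeta>)) $ i = par z (i XOR x) * \<zeta> $ (i XOR x)" if i: "i < ?N" for i
  proof -
    have iff: "(i = j XOR x) = (j = i XOR x)" for j by (metis xor_xor_cancel)
    have "(pauli_X n x *\<^sub>v (pauli_Z n z *\<^sub>v \<zeta>)) $ i
        = (\<Sum>j<?N. (if i = j XOR x then 1 else 0) * (pauli_Z n z *\<^sub>v \<zeta>) $ j)"
      using i Zd by (auto simp: pauli_X_def scalar_prod_def lessThan_atLeast0)
    also have "\<dots> = (\<Sum>j<?N. if j = i XOR x then (pauli_Z n z *\<^sub>v \<zeta>) $ (i XOR x) else 0)"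
      unfolding iff by (intro sum.cong) auto
    finally show ?thesis using xor_less[OF i zx(2)] Z by simp
  qed
  let ?v = "conj_vec (pauli_X n x *\<^sub>v (pauli_Z n z *\<^sub>v \<zeta>))"
  have vd: "dim_vec ?v = ?N" by (simp add: conj_vec_def pauli_X_def)
  have v: "?v $ i = ?w i" if "i < ?N" for i
    using X[OF that] that by (simp add: conj_vec_def pauli_X_def shadow_vec_def)
  have C: "classical_shadow n \<zeta> x z \<in> carrier_mat ?N ?N"
    unfolding classical_shadow_def by (auto simp: outer_def vd)
  have Ce: "classical_shadow n \<zeta> x z $$ (j, i) = (2 ^ n + 1) * (?w j * cnj (?w i)) - (if j = i then 1 else 0)"
    if "i < ?N" "j < ?N" for i j
    using that unfolding classical_shadow_def by (simp add: outer_def vd v)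
  have "mtrace (Obs * classical_shadow n \<zeta> x z) = (\<Sum>i<?N. \<Sum>j<?N. Obs $$ (i, j) * classical_shadow n \<zeta> x z $$ (j, i))"
    unfolding mtrace_def using mat_mult_entry[OF O C] O by (intro sum.cong) auto
  also have "\<dots> = (\<Sum>i<?N. \<Sum>j<?N. (2 ^ n + 1) * (cnj (?w i) * Obs $$ (i, j) * ?w j) - (if j = i then Obs $$ (i, i) else 0))"
    by (intro sum.cong refl) (simp add: Ce algebra_simps)
  also have "\<dots> = (2 ^ n + 1) * sesq ?N (\<lambda>i j. Obs $$ (i, j)) ?w - (\<Sum>i<?N. Obs $$ (i, i))"
    unfolding sesq_def by (simp add: sum_subtractf sum_distrib_left)
  finally show ?thesis using O by (simp add: mtrace_def)
qed

text \<open>Moves the Pauli operator and the complex conjugation from the state to the matrix; the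
  conjugation is what transposes the indices.\<close>
definition twist :: "nat \<Rightarrow> nat \<Rightarrow> (nat \<Rightarrow> nat \<Rightarrow> complex) \<Rightarrow> nat \<Rightarrow> nat \<Rightarrow> complex" where
  "twist z x A i j = par z i * par z j * A (j XOR x) (i XOR x)"

lemma sesq_shadow_vec:
  assumes "x < 2 ^ n"
  shows "sesq (2 ^ n) A (shadow_vec \<zeta> z x) = sesq (2 ^ n) (twist z x A) \<zeta>"
proof -
  have "sesq (2 ^ n) (twist z x A) \<zeta>
      = (\<Sum>i<2 ^ n. \<Sum>j<2 ^ n. cnj (\<zeta> i) * (par z i * par z j * A (j XOR x) (i XOR x)) * \<zeta> j)"
    unfolding sesq_def twist_def ..
  also have "\<dots> = (\<Sum>i<2 ^ n. \<Sum>j<2 ^ n. cnj (\<zeta> (i XOR x)) * (par z (i XOR x) * par z (j XOR x) * A j i) * \<zeta> (j XOR x))"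
  proof -
    define F where "F i j = cnj (\<zeta> i) * (par z i * par z j * A (j XOR x) (i XOR x)) * \<zeta> j" for i j
    have "(\<Sum>i<2 ^ n. \<Sum>j<2 ^ n. F i j) = (\<Sum>i<2 ^ n. \<Sum>j<2 ^ n. F (i XOR x) j)"
      by (rule sum_xor_reindex[OF assms, symmetric])
    also have "\<dots> = (\<Sum>i<2 ^ n. \<Sum>j<2 ^ n. F (i XOR x) (j XOR x))"
      by (intro sum.cong[OF refl] sum_xor_reindex[OF assms, symmetric])
    finally show ?thesis unfolding F_def by (simp only: xor_xor_cancel)
  qed
  also have "\<dots> = (\<Sum>j<2 ^ n. \<Sum>i<2 ^ n. cnj (shadow_vec \<zeta> z x j) * A j i * shadow_vec \<zeta> z x i)"
    by (subst sum.swap) (simp add: shadow_vec_def mult_ac)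
  finally show ?thesis unfolding sesq_def by simp
qed

lemma psd_on_twist:
  assumes x: "x < 2 ^ n" and A: "psd_on (2 ^ n) A"
  shows "psd_on (2 ^ n) (twist z x A)"
  unfolding psd_on_def
proof
  show "\<forall>v. 0 \<le> Re (sesq (2 ^ n) (twist z x A) v)"
    using A unfolding sesq_shadow_vec[OF x, symmetric] psd_on_def by blast
  show "herm_on (2 ^ n) (twist z x A)" unfolding herm_on_def
  proof (intro allI impI)
    fix i j :: nat assume "i < 2 ^ n" "j < 2 ^ n"
    then have "A (i XOR x) (j XOR x) = cnj (A (j XOR x) (i XOR x))"
      using A[unfolded psd_on_def herm_on_def, THEN conjunct1, rule_format, of "j XOR x" "i XOR x"]
        xor_less x by blast
    then show "twist z x A j i = cnj (twist z x A i j)"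
      unfolding twist_def by (simp add: mult_ac)
  qed
qed

section \<open>Moments of a relative approximate design\<close>

definition tr1 :: "nat \<Rightarrow> (nat \<Rightarrow> nat \<Rightarrow> complex) \<Rightarrow> complex" where
  "tr1 n A = (\<Sum>i<n. A i i)"
definition tr2 :: "nat \<Rightarrow> (nat \<Rightarrow> nat \<Rightarrow> complex) \<Rightarrow> (nat \<Rightarrow> nat \<Rightarrow> complex) \<Rightarrow> complex" where
  "tr2 n A B = (\<Sum>i<n. \<Sum>j<n. A i j * B j i)"
definition tr3 :: "nat \<Rightarrow> (nat \<Rightarrow> nat \<Rightarrow> complex) \<Rightarrow> (nat \<Rightarrow> nat \<Rightarrow> complex) \<Rightarrow> (nat \<Rightarrow> nat \<Rightarrow> complex) \<Rightarrow> complex" where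
  "tr3 n A B C = (\<Sum>i<n. \<Sum>j<n. \<Sum>k<n. A i j * B j k * C k i)"

text \<open>The trace of P \<otimes> Q \<otimes> R against the sum of the six permutation operators:
  the identity, three transpositions and two 3-cycles, each contracting to traces along its
  cycles.\<close>

definition sym_trace :: "nat \<Rightarrow> (nat \<Rightarrow> nat \<Rightarrow> complex) \<Rightarrow> (nat \<Rightarrow> nat \<Rightarrow> complex) \<Rightarrow> (nat \<Rightarrow> nat \<Rightarrow> complex) \<Rightarrow> complex" where
  "sym_trace n P Q R = tr1 n P * tr1 n Q * tr1 n R + tr1 n P * tr2 n Q R + tr2 n P Q * tr1 n R
     + tr2 n P R * tr1 n Q + tr3 n P Q R + tr3 n R Q P"

lemma sum_product3:
  fixes f g h :: "nat \<Rightarrow> 'a :: comm_semiring_0"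
  shows "(\<Sum>i\<in>A. f i) * (\<Sum>j\<in>B. g j) * (\<Sum>k\<in>C. h k) = (\<Sum>i\<in>A. \<Sum>j\<in>B. \<Sum>k\<in>C. f i * g j * h k)"
proof -
  have two: "(\<Sum>i\<in>A. f i) * (\<Sum>j\<in>B. g j) * H = (\<Sum>i\<in>A. \<Sum>j\<in>B. f i * g j * H)" for H
    unfolding sum_product by (simp only: sum_distrib_right)
  show ?thesis unfolding two by (simp only: sum_distrib_left)
qed

lemma sum_pick3:
  fixes X :: "nat \<Rightarrow> nat \<Rightarrow> nat \<Rightarrow> complex"
  assumes "p < d" "q < d" "r < d"
  shows "(\<Sum>a<d. \<Sum>b<d. \<Sum>c<d. X a b c * of_nat (of_bool (a = p \<and> b = q \<and> c = r))) = X p q r"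
proof -
  have e: "X a b c * of_nat (of_bool (a = p \<and> b = q \<and> c = r))
      = (if c = r then if b = q then if a = p then X a b c else 0 else 0 else 0)" for a b c by auto
  show ?thesis
    unfolding e using assms by (simp only: sum.delta finite_lessThan lessThan_iff if_True)
qed

lemma sum_perm_count_pick:
  fixes X :: "nat \<Rightarrow> nat \<Rightarrow> nat \<Rightarrow> complex"
  assumes "i < d" "j < d" "k < d"
  shows "(\<Sum>a<d. \<Sum>b<d. \<Sum>c<d. X a b c * of_nat (perm_count i j k a b c))
    = X i j k + X i k j + X j i k + X j k i + X k i j + X k j i"
  unfolding perm_count_def of_nat_add distrib_left sum.distrib
  using assms by (simp only: sum_pick3)

lemma integral_sum3:
  fixes f :: "nat \<Rightarrow> nat \<Rightarrow> nat \<Rightarrow> 'a \<Rightarrow> 'b :: {banach, second_countable_topology}"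
  assumes "\<And>i j k. i < d \<Longrightarrow> j < d \<Longrightarrow> k < d \<Longrightarrow> integrable M (f i j k)"
  shows "(\<integral>v. (\<Sum>i<d. \<Sum>j<d. \<Sum>k<d. f i j k v) \<partial>M) = (\<Sum>i<d. \<Sum>j<d. \<Sum>k<d. \<integral>v. f i j k v \<partial>M)"
proof -
  have "(\<integral>v. (\<Sum>k<d. f i j k v) \<partial>M) = (\<Sum>k<d. \<integral>v. f i j k v \<partial>M)" if "i < d" "j < d" for i j
    using assms that by (intro Bochner_Integration.integral_sum) auto
  moreover have "(\<integral>v. (\<Sum>j<d. \<Sum>k<d. f i j k v) \<partial>M) = (\<Sum>j<d. \<integral>v. (\<Sum>k<d. f i j k v) \<partial>M)" if "i < d" for i
    using that by (intro Bochner_Integration.integral_sum Bochner_Integration.integrable_sum assms) auto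
  moreover have "(\<integral>v. (\<Sum>i<d. \<Sum>j<d. \<Sum>k<d. f i j k v) \<partial>M) = (\<Sum>i<d. \<integral>v. (\<Sum>j<d. \<Sum>k<d. f i j k v) \<partial>M)"
    by (intro Bochner_Integration.integral_sum Bochner_Integration.integrable_sum assms) auto
  ultimately show ?thesis by simp
qed

lemma sesq_as_sum: "sesq n A v = (\<Sum>i<n. \<Sum>a<n. A a i * (v i * cnj (v a)))"
  unfolding sesq_def by (subst sum.swap) (simp add: mult_ac)

lemma haar_sesq_product:
  assumes d: "d \<ge> 3"
  shows "hE d (\<lambda>v. sesq d P v * sesq d Q v * sesq d R v) = complex_of_real (haar_const d) * sym_trace d P Q R"
proof -
  let ?m = "\<lambda>i j k a b c v. v i * v j * v k * cnj (v a) * cnj (v b) * cnj (v c) :: complex"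
  let ?X = "\<lambda>i j k a b c. P a i * Q b j * R c k"
  have exp: "sesq d P v * sesq d Q v * sesq d R v
      = (\<Sum>i<d. \<Sum>j<d. \<Sum>k<d. \<Sum>a<d. \<Sum>b<d. \<Sum>c<d. ?X i j k a b c * ?m i j k a b c v)" for v
    unfolding sesq_as_sum sum_product3 by (intro sum.cong refl) (simp add: mult_ac)
  have int: "integrable (haar_state_measure d) (\<lambda>v. ?X i j k a b c * ?m i j k a b c v)"
    if "i < d" "j < d" "k < d" "a < d" "b < d" "c < d" for i j k a b c
    using that by (intro haar_bounded_integrable haar_bounded_intros)
  have "hE d (\<lambda>v. sesq d P v * sesq d Q v * sesq d R v)
      = (\<Sum>i<d. \<Sum>j<d. \<Sum>k<d. \<Sum>a<d. \<Sum>b<d. \<Sum>c<d. hE d (\<lambda>v. ?X i j k a b c * ?m i j k a b c v))"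
  proof -
    have "hE d (\<lambda>v. sesq d P v * sesq d Q v * sesq d R v)
      = (\<Sum>i<d. \<Sum>j<d. \<Sum>k<d. hE d (\<lambda>v. \<Sum>a<d. \<Sum>b<d. \<Sum>c<d. ?X i j k a b c * ?m i j k a b c v))"
      unfolding exp by (rule integral_sum3) (intro Bochner_Integration.integrable_sum int; simp)
    also have "\<dots> = (\<Sum>i<d. \<Sum>j<d. \<Sum>k<d. \<Sum>a<d. \<Sum>b<d. \<Sum>c<d. hE d (\<lambda>v. ?X i j k a b c * ?m i j k a b c v))"
    proof (intro sum.cong[OF refl])
      fix i j k assume "i \<in> {..<d}" "j \<in> {..<d}" "k \<in> {..<d}"
      then show "hE d (\<lambda>v. \<Sum>a<d. \<Sum>b<d. \<Sum>c<d. ?X i j k a b c * ?m i j k a b c v)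
        = (\<Sum>a<d. \<Sum>b<d. \<Sum>c<d. hE d (\<lambda>v. ?X i j k a b c * ?m i j k a b c v))"
        by (intro integral_sum3 int) auto
    qed
    finally show ?thesis .
  qed
  also have "\<dots> = (\<Sum>i<d. \<Sum>j<d. \<Sum>k<d. \<Sum>a<d. \<Sum>b<d. \<Sum>c<d.
      (haar_const d * ?X i j k a b c) * of_nat (perm_count i j k a b c))"
  proof (intro sum.cong refl)
    fix i j k a b c assume "i \<in> {..<d}" "j \<in> {..<d}" "k \<in> {..<d}" "a \<in> {..<d}" "b \<in> {..<d}" "c \<in> {..<d}"
    then have "hE d (?m i j k a b c) = complex_of_real (haar_const d) * of_nat (perm_count i j k a b c)"
      by (intro haar_moment_3 d) auto
    then show "hE d (\<lambda>v. ?X i j k a b c * ?m i j k a b c v) = (haar_const d * ?X i j k a b c) * of_nat (perm_count i j k a b c)"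
      by simp
  qed
  also have "\<dots> = (\<Sum>i<d. \<Sum>j<d. \<Sum>k<d. haar_const d * ?X i j k i j k + haar_const d * ?X i j k i k j
      + haar_const d * ?X i j k j i k + haar_const d * ?X i j k j k i + haar_const d * ?X i j k k i j + haar_const d * ?X i j k k j i)"
    by (intro sum.cong refl sum_perm_count_pick) auto
  also have "\<dots> = haar_const d * ((\<Sum>i<d. \<Sum>j<d. \<Sum>k<d. ?X i j k i j k) + (\<Sum>i<d. \<Sum>j<d. \<Sum>k<d. ?X i j k i k j)
      + (\<Sum>i<d. \<Sum>j<d. \<Sum>k<d. ?X i j k j i k) + (\<Sum>i<d. \<Sum>j<d. \<Sum>k<d. ?X i j k j k i)
      + (\<Sum>i<d. \<Sum>j<d. \<Sum>k<d. ?X i j k k i j) + (\<Sum>i<d. \<Sum>j<d. \<Sum>k<d. ?X i j k k j i))"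
    by (simp only: distrib_left sum_distrib_left sum.distrib)
  also have "(\<Sum>i<d. \<Sum>j<d. \<Sum>k<d. ?X i j k i j k) = tr1 d P * tr1 d Q * tr1 d R"
    unfolding tr1_def sum_product3 ..
  also have "(\<Sum>i<d. \<Sum>j<d. \<Sum>k<d. ?X i j k i k j) = tr1 d P * tr2 d Q R"
  proof -
    have "(\<Sum>j<d. \<Sum>k<d. ?X i j k i k j) = P i i * tr2 d Q R" for i
      unfolding tr2_def by (subst sum.swap) (simp add: sum_distrib_left mult_ac)
    then show ?thesis by (simp add: tr1_def sum_distrib_right)
  qed
  also have "(\<Sum>i<d. \<Sum>j<d. \<Sum>k<d. ?X i j k j i k) = tr2 d P Q * tr1 d R"
  proof -
    have "(\<Sum>i<d. \<Sum>j<d. \<Sum>k<d. ?X i j k j i k) = (\<Sum>i<d. \<Sum>j<d. P j i * Q i j * tr1 d R)"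
      by (simp add: tr1_def sum_distrib_left)
    also have "\<dots> = tr2 d P Q * tr1 d R"
      unfolding tr2_def by (subst sum.swap) (simp add: sum_distrib_right)
    finally show ?thesis .
  qed
  also have "(\<Sum>i<d. \<Sum>j<d. \<Sum>k<d. ?X i j k k j i) = tr2 d P R * tr1 d Q"
  proof -
    have "(\<Sum>i<d. \<Sum>j<d. \<Sum>k<d. ?X i j k k j i) = (\<Sum>i<d. \<Sum>k<d. \<Sum>j<d. ?X i j k k j i)"
      by (intro sum.cong refl sum.swap)
    also have "\<dots> = (\<Sum>i<d. \<Sum>k<d. P k i * R i k * tr1 d Q)"
      by (simp add: tr1_def sum_distrib_left mult_ac)
    also have "\<dots> = tr2 d P R * tr1 d Q"
      unfolding tr2_def by (subst sum.swap) (simp add: sum_distrib_right)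
    finally show ?thesis .
  qed
  also have "(\<Sum>i<d. \<Sum>j<d. \<Sum>k<d. ?X i j k j k i) = tr3 d R Q P"
  proof -
    have "(\<Sum>i<d. \<Sum>j<d. \<Sum>k<d. ?X i j k j k i) = (\<Sum>i<d. \<Sum>k<d. \<Sum>j<d. ?X i j k j k i)"
      by (intro sum.cong refl sum.swap)
    then show ?thesis unfolding tr3_def by (simp add: mult_ac)
  qed
  also have "(\<Sum>i<d. \<Sum>j<d. \<Sum>k<d. ?X i j k k i j) = tr3 d P Q R"
  proof -
    have "tr3 d P Q R = (\<Sum>k<d. \<Sum>i<d. \<Sum>j<d. ?X i j k k i j)" unfolding tr3_def ..
    also have "\<dots> = (\<Sum>i<d. \<Sum>k<d. \<Sum>j<d. ?X i j k k i j)" by (rule sum.swap)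
    also have "\<dots> = (\<Sum>i<d. \<Sum>j<d. \<Sum>k<d. ?X i j k k i j)" by (intro sum.cong refl sum.swap)
    finally show ?thesis ..
  qed
  finally show ?thesis unfolding sym_trace_def by (simp only: add_ac)
qed

section \<open>Third moment operators at product vectors\<close>

definition ip :: "nat \<Rightarrow> (nat \<Rightarrow> complex) \<Rightarrow> (nat \<Rightarrow> complex) \<Rightarrow> complex" where
  "ip d u \<phi> = (\<Sum>i<d. cnj (u i) * \<phi> i)"

text \<open>The quadratic form of the third tensor power of |phi><phi| at u \<otimes> v \<otimes> w.
  Such products are the only test vectors used with the design condition.\<close>

definition overlap3 :: "nat \<Rightarrow> (nat \<Rightarrow> complex) \<Rightarrow> (nat \<Rightarrow> complex) \<Rightarrow> (nat \<Rightarrow> complex) \<Rightarrow> (nat \<Rightarrow> complex) \<Rightarrow> real" where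
  "overlap3 d u v w \<phi> = (cmod (ip d u \<phi>))\<^sup>2 * (cmod (ip d v \<phi>))\<^sup>2 * (cmod (ip d w \<phi>))\<^sup>2"

text \<open>The arguments appear reversed because digit 0 is the least significant and therefore the
  innermost summation.\<close>

lemma sum_digits3:
  fixes G :: "nat \<Rightarrow> nat \<Rightarrow> nat \<Rightarrow> complex"
  shows "(\<Sum>I<d ^ 3. G (digit d I 0) (digit d I 1) (digit d I 2)) = (\<Sum>a<d. \<Sum>b<d. \<Sum>c<d. G c b a)"
proof -
  have "(\<Sum>I<d ^ 3. G (digit d I 0) (digit d I 1) (digit d I 2))
      = (\<Sum>I<(d * d) * d. (\<lambda>A c. G c (A mod d) (A div d mod d)) (I div d) (I mod d))"
    by (intro sum.cong) (auto simp: digit_def power3_eq_cube power2_eq_square div_mult2_eq)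
  also have "\<dots> = (\<Sum>A<d * d. \<Sum>c<d. G c (A mod d) (A div d mod d))"
    by (rule sum_div_mod)
  also have "\<dots> = (\<Sum>a<d. \<Sum>b<d. \<Sum>c<d. G c b (a mod d))"
    by (rule sum_div_mod[of "\<lambda>a b. \<Sum>c<d. G c b (a mod d)"])
  also have "\<dots> = (\<Sum>a<d. \<Sum>b<d. \<Sum>c<d. G c b a)" by (intro sum.cong refl) simp
  finally show ?thesis .
qed

lemma prod_lessThan_3: "(\<Prod>k<3. f k) = f 0 * f 1 * (f (2::nat) :: 'a :: comm_monoid_mult)"
  by (simp add: numeral_3_eq_3 numeral_2_eq_2)

text \<open>\<open>V\<close> encodes u \<otimes> v \<otimes> w through base-d digits. The tensor
  power has rank one, so the double sum is a single inner product times its conjugate, and that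
  inner product factors over the digits.\<close>

lemma sesq_tensor_pow:
  fixes d :: nat and u v w :: "nat \<Rightarrow> complex"
  defines "V \<equiv> \<lambda>I. u (digit d I 0) * v (digit d I 1) * w (digit d I 2)"
  shows "(\<Sum>I<d ^ 3. \<Sum>J<d ^ 3. (cnj (V I) * V J) * tensor_pow_entry d 3 \<phi> I J) = complex_of_real (overlap3 d u v w \<phi>)"
proof -
  define \<Phi> where "\<Phi> I = cnj (V I) * (\<phi> (digit d I 0) * \<phi> (digit d I 1) * \<phi> (digit d I 2))" for I
  have "(cnj (V I) * V J) * tensor_pow_entry d 3 \<phi> I J = \<Phi> I * cnj (\<Phi> J)" for I J
    unfolding tensor_pow_entry_def prod_lessThan_3 \<Phi>_def by (simp add: mult_ac)
  then have "(\<Sum>I<d ^ 3. \<Sum>J<d ^ 3. (cnj (V I) * V J) * tensor_pow_entry d 3 \<phi> I J)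
      = (\<Sum>I<d ^ 3. \<Phi> I) * cnj (\<Sum>I<d ^ 3. \<Phi> I)"
    by (simp add: sum_product)
  also have "(\<Sum>I<d ^ 3. \<Phi> I) = ip d w \<phi> * ip d v \<phi> * ip d u \<phi>"
  proof -
    have "(\<Sum>I<d ^ 3. \<Phi> I) = (\<Sum>a<d. \<Sum>b<d. \<Sum>c<d. (cnj (w a) * \<phi> a) * (cnj (v b) * \<phi> b) * (cnj (u c) * \<phi> c))"
      unfolding \<Phi>_def V_def
      by (subst sum_digits3[of "\<lambda>c b a. cnj (u c * v b * w a) * (\<phi> c * \<phi> b * \<phi> a)"]) (simp add: mult_ac)
    then show ?thesis unfolding ip_def sum_product3 .
  qed
  also have "ip d w \<phi> * ip d v \<phi> * ip d u \<phi> * cnj (ip d w \<phi> * ip d v \<phi> * ip d u \<phi>)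
      = complex_of_real ((cmod (ip d w \<phi> * ip d v \<phi> * ip d u \<phi>))\<^sup>2)"
    by (rule complex_norm_square[symmetric])
  also have "(cmod (ip d w \<phi> * ip d v \<phi> * ip d u \<phi>))\<^sup>2 = overlap3 d u v w \<phi>"
    unfolding overlap3_def by (simp add: norm_mult power_mult_distrib mult_ac)
  finally show ?thesis .
qed

lemma integral_sesq_tensor_pow:
  fixes d :: nat and u v w :: "nat \<Rightarrow> complex"
  defines "V \<equiv> \<lambda>I. u (digit d I 0) * v (digit d I 1) * w (digit d I 2)"
  assumes int: "\<And>I J. integrable M (\<lambda>k. tensor_pow_entry d 3 (\<phi> k) I J)"
  shows "sesq (d ^ 3) (\<lambda>I J. \<integral>k. tensor_pow_entry d 3 (\<phi> k) I J \<partial>M) V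
     = complex_of_real (\<integral>k. overlap3 d u v w (\<phi> k) \<partial>M)"
proof -
  have "sesq (d ^ 3) (\<lambda>I J. \<integral>k. tensor_pow_entry d 3 (\<phi> k) I J \<partial>M) V
      = (\<Sum>I<d ^ 3. \<Sum>J<d ^ 3. \<integral>k. (cnj (V I) * V J) * tensor_pow_entry d 3 (\<phi> k) I J \<partial>M)"
    unfolding sesq_def by (intro sum.cong refl) (simp add: mult_ac)
  also have "\<dots> = (\<integral>k. (\<Sum>I<d ^ 3. \<Sum>J<d ^ 3. (cnj (V I) * V J) * tensor_pow_entry d 3 (\<phi> k) I J) \<partial>M)"
  proof -
    have i: "integrable M (\<lambda>k. (cnj (V I) * V J) * tensor_pow_entry d 3 (\<phi> k) I J)" for I J
      by (intro integrable_mult_right int)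
    have "(\<integral>k. (\<Sum>I<d ^ 3. \<Sum>J<d ^ 3. (cnj (V I) * V J) * tensor_pow_entry d 3 (\<phi> k) I J) \<partial>M)
       = (\<Sum>I<d ^ 3. \<integral>k. (\<Sum>J<d ^ 3. (cnj (V I) * V J) * tensor_pow_entry d 3 (\<phi> k) I J) \<partial>M)"
      by (intro Bochner_Integration.integral_sum Bochner_Integration.integrable_sum i)
    also have "\<dots> = (\<Sum>I<d ^ 3. \<Sum>J<d ^ 3. \<integral>k. (cnj (V I) * V J) * tensor_pow_entry d 3 (\<phi> k) I J \<partial>M)"
      by (intro sum.cong[OF refl] Bochner_Integration.integral_sum i)
    finally show ?thesis ..
  qed
  also have "\<dots> = (\<integral>k. complex_of_real (overlap3 d u v w (\<phi> k)) \<partial>M)"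
    unfolding V_def sesq_tensor_pow ..
  also have "\<dots> = complex_of_real (\<integral>k. overlap3 d u v w (\<phi> k) \<partial>M)"
    by (rule integral_complex_of_real)
  finally show ?thesis .
qed

lemma sesq_diff_scaled:
  "sesq n (\<lambda>i j. A i j - c * B i j) v = sesq n A v - c * sesq n B v"
  unfolding sesq_def by (simp add: algebra_simps sum_subtractf sum_distrib_left)

lemma digit_less: "d > 0 \<Longrightarrow> digit d I k < d"
  unfolding digit_def by simp

lemma cmod_unit_state_le:
  fixes \<psi> :: "complex Matrix.vec"
  assumes "unit_state d \<psi>" "i < d" shows "cmod (\<psi> $ i) \<le> 1"
proof -
  have "(cmod (\<psi> $ i))\<^sup>2 \<le> (\<Sum>i<d. (cmod (\<psi> $ i))\<^sup>2)" using assms by (intro member_le_sum) auto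
  then show ?thesis using assms by (simp add: unit_state_def abs_square_le_1[of "cmod (\<psi> $ i)"])
qed

lemma design_rank_one:
  assumes d: "d > 0" and unit: "\<And>k. k \<in> set_pmf S \<Longrightarrow> unit_state d (psi k)"
    and des: "relative_approx_design d 3 \<epsilon> S psi"
  shows "(1 - \<epsilon>) * hE d (overlap3 d u v w) \<le> measure_pmf.expectation S (\<lambda>k. overlap3 d u v w (\<lambda>i. psi k $ i))"
    and "measure_pmf.expectation S (\<lambda>k. overlap3 d u v w (\<lambda>i. psi k $ i)) \<le> (1 + \<epsilon>) * hE d (overlap3 d u v w)"
proof -
  let ?V = "\<lambda>I. u (digit d I 0) * v (digit d I 1) * w (digit d I 2)"
  let ?H = "\<lambda>I J. \<integral>v. tensor_pow_entry d 3 v I J \<partial>haar_state_measure d"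
  let ?E = "\<lambda>I J. \<integral>k. tensor_pow_entry d 3 (\<lambda>i. psi k $ i) I J \<partial>measure_pmf S"
  have iH: "integrable (haar_state_measure d) (\<lambda>v. tensor_pow_entry d 3 v I J)" for I J
    unfolding tensor_pow_entry_def using d
    by (intro haar_bounded_integrable haar_bounded_intros digit_less)
  have iE: "integrable (measure_pmf S) (\<lambda>k. tensor_pow_entry d 3 (\<lambda>i. psi k $ i) I J)" for I J
  proof (rule integrable_pmf_bounded[of _ _ 1])
    fix k assume k: "k \<in> set_pmf S"
    show "norm (tensor_pow_entry d 3 (\<lambda>i. psi k $ i) I J) \<le> 1"
      unfolding tensor_pow_entry_def prod_norm[symmetric] norm_mult complex_mod_cnj
      using cmod_unit_state_le[OF unit[OF k] digit_less[OF d]]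
      by (intro prod_le_1) (auto intro: mult_le_one)
  qed
  have sH: "sesq (d ^ 3) ?H ?V = complex_of_real (hE d (overlap3 d u v w))"
    by (rule integral_sesq_tensor_pow[OF iH])
  have sE: "sesq (d ^ 3) ?E ?V = complex_of_real (measure_pmf.expectation S (\<lambda>k. overlap3 d u v w (\<lambda>i. psi k $ i)))"
    by (rule integral_sesq_tensor_pow[OF iE])
  have p1: "psd_mat (ensemble_moment d 3 S psi - complex_of_real (1 - \<epsilon>) \<cdot>\<^sub>m haar_moment d 3)"
    and p2: "psd_mat (complex_of_real (1 + \<epsilon>) \<cdot>\<^sub>m haar_moment d 3 - ensemble_moment d 3 S psi)"
    using des unfolding relative_approx_design_def loewner_le_def by auto
  have c1: "ensemble_moment d 3 S psi - complex_of_real (1 - \<epsilon>) \<cdot>\<^sub>m haar_moment d 3 \<in> carrier_mat (d ^ 3) (d ^ 3)"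
    and c2: "complex_of_real (1 + \<epsilon>) \<cdot>\<^sub>m haar_moment d 3 - ensemble_moment d 3 S psi \<in> carrier_mat (d ^ 3) (d ^ 3)"
    by (auto simp: ensemble_moment_def haar_moment_def)
  have "0 \<le> Re (sesq (d ^ 3) (\<lambda>i j. (ensemble_moment d 3 S psi - complex_of_real (1 - \<epsilon>) \<cdot>\<^sub>m haar_moment d 3) $$ (i, j)) ?V)"
    using psd_mat_psd_on[OF p1 c1] unfolding psd_on_def by blast
  also have "sesq (d ^ 3) (\<lambda>i j. (ensemble_moment d 3 S psi - complex_of_real (1 - \<epsilon>) \<cdot>\<^sub>m haar_moment d 3) $$ (i, j)) ?V
     = sesq (d ^ 3) (\<lambda>i j. ?E i j - complex_of_real (1 - \<epsilon>) * ?H i j) ?V"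
    by (rule sesq_cong) (auto simp: ensemble_moment_def haar_moment_def)
  finally show "(1 - \<epsilon>) * hE d (overlap3 d u v w) \<le> measure_pmf.expectation S (\<lambda>k. overlap3 d u v w (\<lambda>i. psi k $ i))"
    unfolding sesq_diff_scaled sH sE by (simp flip: of_real_mult of_real_diff)
  have "0 \<le> Re (sesq (d ^ 3) (\<lambda>i j. (complex_of_real (1 + \<epsilon>) \<cdot>\<^sub>m haar_moment d 3 - ensemble_moment d 3 S psi) $$ (i, j)) ?V)"
    using psd_mat_psd_on[OF p2 c2] unfolding psd_on_def by blast
  \<comment> \<open>The factor 1 gives the difference the shape that \<open>sesq_diff_scaled\<close>
    expects.\<close>
  also have "sesq (d ^ 3) (\<lambda>i j. (complex_of_real (1 + \<epsilon>) \<cdot>\<^sub>m haar_moment d 3 - ensemble_moment d 3 S psi) $$ (i, j)) ?V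
     = sesq (d ^ 3) (\<lambda>i j. complex_of_real (1 + \<epsilon>) * ?H i j - 1 * ?E i j) ?V"
    by (rule sesq_cong) (auto simp: ensemble_moment_def haar_moment_def)
  also have "\<dots> = complex_of_real (1 + \<epsilon>) * sesq (d ^ 3) ?H ?V - sesq (d ^ 3) ?E ?V"
    unfolding sesq_diff_scaled by (simp add: sesq_def sum_distrib_left mult_ac)
  finally show "measure_pmf.expectation S (\<lambda>k. overlap3 d u v w (\<lambda>i. psi k $ i)) \<le> (1 + \<epsilon>) * hE d (overlap3 d u v w)"
    unfolding sH sE by (simp flip: of_real_mult of_real_diff)
qed

section \<open>Trace inequalities\<close>

text \<open>The identity as a padding factor: its form is 1 at a unit vector, so products of one or
  two forms become triple products, to which the 3-design condition applies.\<close>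

definition idm :: "nat \<Rightarrow> nat \<Rightarrow> complex" where
  "idm i j = (if i = j then 1 else 0)"

lemma sum_idm:
  "(\<Sum>j<n. A j * idm i j) = (if i < n then A i else 0)" "(\<Sum>j<n. A j * idm j i) = (if i < n then A i else 0)"
  "(\<Sum>j<n. idm i j * A j) = (if i < n then A i else 0)" "(\<Sum>j<n. idm j i * A j) = (if i < n then A i else 0)"
  unfolding idm_def by (simp_all add: if_distrib[of "\<lambda>c. _ * c"] if_distrib[of "\<lambda>c. c * _"] cong: if_cong)

lemma sesq_idm: "sesq n idm v = complex_of_real (\<Sum>i<n. (cmod (v i))\<^sup>2)"
proof -
  have "sesq n idm v = (\<Sum>i<n. cnj (v i) * (\<Sum>j<n. idm i j * v j))"
    unfolding sesq_def by (simp add: sum_distrib_left mult.assoc)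
  also have "\<dots> = (\<Sum>i<n. v i * cnj (v i))"
    by (intro sum.cong refl) (simp add: sum_idm mult.commute)
  finally show ?thesis unfolding of_real_sum by (simp only: complex_norm_square)
qed

lemma psd_on_idm: "psd_on n idm"
  unfolding psd_on_def herm_on_def by (auto simp: sesq_idm idm_def intro!: sum_nonneg)

lemma tr1_idm: "tr1 n idm = of_nat n"
  unfolding tr1_def idm_def by simp

lemma tr2_commute: "tr2 n A B = tr2 n B A"
  unfolding tr2_def by (subst sum.swap) (simp add: mult.commute)

lemma tr2_idm: "tr2 n A idm = tr1 n A" "tr2 n idm A = tr1 n A"
proof -
  show "tr2 n A idm = tr1 n A" unfolding tr2_def tr1_def by (intro sum.cong refl) (simp add: sum_idm)
  then show "tr2 n idm A = tr1 n A" by (simp add: tr2_commute)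
qed

lemma tr3_cyclic: "tr3 n A B C = tr3 n B C A"
proof -
  have "tr3 n A B C = (\<Sum>j<n. \<Sum>i<n. \<Sum>k<n. A i j * B j k * C k i)"
    unfolding tr3_def by (rule sum.swap)
  also have "\<dots> = (\<Sum>j<n. \<Sum>k<n. \<Sum>i<n. A i j * B j k * C k i)"
    by (intro sum.cong[OF refl] sum.swap)
  finally show ?thesis unfolding tr3_def by (simp add: mult_ac)
qed

lemma tr3_idm: "tr3 n A B idm = tr2 n A B" "tr3 n A idm B = tr2 n A B" "tr3 n idm A B = tr2 n A B"
proof -
  have aux: "(\<Sum>j<n. \<Sum>k<n. A i j * idm j k * B k i) = (\<Sum>j<n. A i j * B j i)" for A B i
  proof (intro sum.cong refl)
    fix j assume j: "j \<in> {..<n}"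
    have "(\<Sum>k<n. A i j * idm j k * B k i) = A i j * (\<Sum>k<n. idm j k * B k i)"
      by (simp add: sum_distrib_left mult.assoc)
    then show "(\<Sum>k<n. A i j * idm j k * B k i) = A i j * B j i"
      using j by (simp add: sum_idm)
  qed
  have 1: "tr3 n A idm B = tr2 n A B" for A B unfolding tr3_def tr2_def aux ..
  show "tr3 n A idm B = tr2 n A B" by (rule 1)
  have "tr3 n A B idm = tr3 n B idm A" by (rule tr3_cyclic)
  then show 2: "tr3 n A B idm = tr2 n A B" unfolding 1 by (simp only: tr2_commute[of n B A])
  have "tr3 n idm A B = tr3 n A B idm" by (rule tr3_cyclic)
  then show "tr3 n idm A B = tr2 n A B" unfolding 2 .
qed

text \<open>Padding with the identity lowers the third moment to the second: n + 2 cancels against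
  \<open>haar_const\<close> and leaves 1 / (n (n + 1)).\<close>

lemma sym_trace_idm:
  "sym_trace n P Q idm = (of_nat n + 2) * (tr1 n P * tr1 n Q + tr2 n P Q)"
  unfolding sym_trace_def tr1_idm tr2_idm tr3_idm tr2_commute[of n Q P] by (simp add: algebra_simps)

section \<open>Traces of twisted matrices\<close>

lemma tr1_twist:
  assumes "x < 2 ^ n" shows "tr1 (2 ^ n) (twist z x A) = tr1 (2 ^ n) A"
  unfolding tr1_def twist_def par_square mult_1_left
  by (rule sum_xor_reindex[OF assms, of "\<lambda>i. A i i"])

lemma tr2_twist:
  assumes "x < 2 ^ n" shows "tr2 (2 ^ n) (twist z x A) (twist z x B) = tr2 (2 ^ n) A B"
proof -
  have "tr2 (2 ^ n) (twist z x A) (twist z x B)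
      = (\<Sum>i<2 ^ n. \<Sum>j<2 ^ n. (par z i * par z i) * (par z j * par z j) * (A (j XOR x) (i XOR x) * B (i XOR x) (j XOR x)))"
    unfolding tr2_def twist_def by (intro sum.cong refl) (simp only: mult_ac)
  also have "\<dots> = (\<Sum>i<2 ^ n. \<Sum>j<2 ^ n. A (j XOR x) i * B i (j XOR x))"
    unfolding par_square mult_1_left
    by (rule sum_xor_reindex[OF assms, of "\<lambda>i. \<Sum>j<2 ^ n. A (j XOR x) i * B i (j XOR x)"])
  also have "\<dots> = (\<Sum>i<2 ^ n. \<Sum>j<2 ^ n. A j i * B i j)"
    by (rule sum.cong[OF refl]) (rule sum_xor_reindex[OF assms, of "\<lambda>j. A j i * B i j" for i])
  also have "\<dots> = tr2 (2 ^ n) A B" unfolding tr2_def by (rule sum.swap)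
  finally show ?thesis .
qed

lemma tr3_twist:
  assumes "x < 2 ^ n" shows "tr3 (2 ^ n) (twist z x A) (twist z x B) (twist z x C) = tr3 (2 ^ n) C B A"
proof -
  define F where "F i j k = A j i * B k j * C i k" for i j k
  have "tr3 (2 ^ n) (twist z x A) (twist z x B) (twist z x C)
      = (\<Sum>i<2 ^ n. \<Sum>j<2 ^ n. \<Sum>k<2 ^ n. (par z i * par z i) * (par z j * par z j) * (par z k * par z k)
           * F (i XOR x) (j XOR x) (k XOR x))"
    unfolding tr3_def twist_def F_def by (intro sum.cong refl) (simp only: mult_ac)
  also have "\<dots> = (\<Sum>i<2 ^ n. \<Sum>j<2 ^ n. \<Sum>k<2 ^ n. F i (j XOR x) (k XOR x))"
    unfolding par_square mult_1_left
    by (rule sum_xor_reindex[OF assms, of "\<lambda>i. \<Sum>j<2 ^ n. \<Sum>k<2 ^ n. F i (j XOR x) (k XOR x)"])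
  also have "\<dots> = (\<Sum>i<2 ^ n. \<Sum>j<2 ^ n. \<Sum>k<2 ^ n. F i j (k XOR x))"
    by (rule sum.cong[OF refl]) (rule sum_xor_reindex[OF assms, of "\<lambda>j. \<Sum>k<2 ^ n. F i j (k XOR x)" for i])
  also have "\<dots> = (\<Sum>i<2 ^ n. \<Sum>j<2 ^ n. \<Sum>k<2 ^ n. F i j k)"
    by (rule sum.cong[OF refl], rule sum.cong[OF refl])
      (rule sum_xor_reindex[OF assms, of "\<lambda>k. F i j k" for i j])
  also have "\<dots> = (\<Sum>i<2 ^ n. \<Sum>k<2 ^ n. \<Sum>j<2 ^ n. F i j k)"
    by (intro sum.cong[OF refl] sum.swap)
  also have "\<dots> = tr3 (2 ^ n) C B A" unfolding tr3_def F_def by (simp add: mult_ac)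
  finally show ?thesis .
qed

text \<open>The transposition inside \<open>twist\<close> reverses products of three matrices, which
  merely exchanges the two 3-cycle terms. The Haar value is therefore the same for every
  outcome.\<close>

lemma sym_trace_twist:
  assumes "x < 2 ^ n"
  shows "sym_trace (2 ^ n) (twist z x P) (twist z x Q) (twist z x R) = sym_trace (2 ^ n) P Q R"
  unfolding sym_trace_def tr1_twist[OF assms] tr2_twist[OF assms] tr3_twist[OF assms] by simp

section \<open>Trace bounds for positive semidefinite matrices\<close>

lemma cmod_sum_cauchy_schwarz:
  fixes f g :: "nat \<Rightarrow> complex"
  shows "(cmod (\<Sum>i<n. f i * g i))\<^sup>2 \<le> (\<Sum>i<n. (cmod (f i))\<^sup>2) * (\<Sum>i<n. (cmod (g i))\<^sup>2)"
proof -
  have "cmod (\<Sum>i<n. f i * g i) \<le> (\<Sum>i<n. cmod (f i) * cmod (g i))"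
    by (rule order_trans[OF norm_sum]) (simp add: norm_mult)
  then have "(cmod (\<Sum>i<n. f i * g i))\<^sup>2 \<le> (\<Sum>i<n. cmod (f i) * cmod (g i))\<^sup>2"
    by (intro power_mono) auto
  also have "\<dots> \<le> (\<Sum>i<n. (cmod (f i))\<^sup>2) * (\<Sum>i<n. (cmod (g i))\<^sup>2)"
    by (rule Cauchy_Schwarz_ineq_sum)
  finally show ?thesis .
qed

lemma sesq_rank_one:
  assumes "\<And>i j. i < n \<Longrightarrow> j < n \<Longrightarrow> A i j = (\<Sum>k<n. u k i * cnj (u k j))"
  shows "sesq n A v = complex_of_real (\<Sum>k<n. (cmod (ip n (u k) v))\<^sup>2)"
proof -
  have "sesq n A v = (\<Sum>i<n. \<Sum>j<n. \<Sum>k<n. (cnj (u k j) * v j) * (u k i * cnj (v i)))"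
    unfolding sesq_def
    by (intro sum.cong refl) (simp add: assms sum_distrib_left sum_distrib_right mult_ac)
  also have "\<dots> = (\<Sum>i<n. \<Sum>k<n. \<Sum>j<n. (cnj (u k j) * v j) * (u k i * cnj (v i)))"
    by (intro sum.cong[OF refl] sum.swap)
  also have "\<dots> = (\<Sum>k<n. \<Sum>i<n. \<Sum>j<n. (cnj (u k j) * v j) * (u k i * cnj (v i)))"
    by (rule sum.swap)
  also have "\<dots> = (\<Sum>k<n. ip n (u k) v * cnj (ip n (u k) v))"
  proof (intro sum.cong refl)
    fix k
    have "(\<Sum>i<n. \<Sum>j<n. (cnj (u k j) * v j) * (u k i * cnj (v i))) = (\<Sum>j<n. \<Sum>i<n. (cnj (u k j) * v j) * (u k i * cnj (v i)))"
      by (rule sum.swap)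
    then show "(\<Sum>i<n. \<Sum>j<n. (cnj (u k j) * v j) * (u k i * cnj (v i))) = ip n (u k) v * cnj (ip n (u k) v)"
      unfolding ip_def by (simp add: sum_product)
  qed
  finally show ?thesis unfolding of_real_sum by (simp only: complex_norm_square)
qed

lemma tr1_rank_one:
  assumes "\<And>i j. i < n \<Longrightarrow> j < n \<Longrightarrow> A i j = (\<Sum>k<n. u k i * cnj (u k j))"
  shows "tr1 n A = complex_of_real (\<Sum>k<n. \<Sum>i<n. (cmod (u k i))\<^sup>2)"
proof -
  have "tr1 n A = (\<Sum>i<n. \<Sum>k<n. u k i * cnj (u k i))"
    unfolding tr1_def by (intro sum.cong refl) (simp add: assms)
  also have "\<dots> = (\<Sum>k<n. \<Sum>i<n. u k i * cnj (u k i))" by (rule sum.swap)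
  finally show ?thesis unfolding of_real_sum by (simp only: complex_norm_square)
qed

lemma psd_tr1:
  assumes "psd_on n A" shows "tr1 n A = complex_of_real (Re (tr1 n A))" "0 \<le> Re (tr1 n A)"
proof -
  obtain u where u: "\<And>i j. i < n \<Longrightarrow> j < n \<Longrightarrow> A i j = (\<Sum>k<n. u k i * cnj (u k j))"
    using psd_on_rank_one[OF assms] by blast
  have "tr1 n A = complex_of_real (\<Sum>k<n. \<Sum>i<n. (cmod (u k i))\<^sup>2)" by (rule tr1_rank_one[OF u])
  then show "tr1 n A = complex_of_real (Re (tr1 n A))" "0 \<le> Re (tr1 n A)"
    by (simp_all only: Re_complex_of_real) (intro sum_nonneg zero_le_power2)
qed

lemma psd_sesq:
  assumes "psd_on n A"
  shows "sesq n A v = complex_of_real (Re (sesq n A v))" "0 \<le> Re (sesq n A v)"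
    "Re (sesq n A v) \<le> Re (tr1 n A) * (\<Sum>i<n. (cmod (v i))\<^sup>2)"
proof -
  obtain u where u: "\<And>i j. i < n \<Longrightarrow> j < n \<Longrightarrow> A i j = (\<Sum>k<n. u k i * cnj (u k j))"
    using psd_on_rank_one[OF assms] by blast
  have s: "sesq n A v = complex_of_real (\<Sum>k<n. (cmod (ip n (u k) v))\<^sup>2)" by (rule sesq_rank_one[OF u])
  have t: "tr1 n A = complex_of_real (\<Sum>k<n. \<Sum>i<n. (cmod (u k i))\<^sup>2)" by (rule tr1_rank_one[OF u])
  show "sesq n A v = complex_of_real (Re (sesq n A v))" unfolding s by (simp only: Re_complex_of_real)
  show "0 \<le> Re (sesq n A v)" unfolding s by (simp only: Re_complex_of_real) (intro sum_nonneg zero_le_power2)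
  have "(\<Sum>k<n. (cmod (ip n (u k) v))\<^sup>2) \<le> (\<Sum>k<n. (\<Sum>i<n. (cmod (u k i))\<^sup>2) * (\<Sum>i<n. (cmod (v i))\<^sup>2))"
  proof (rule sum_mono)
    fix k
    show "(cmod (ip n (u k) v))\<^sup>2 \<le> (\<Sum>i<n. (cmod (u k i))\<^sup>2) * (\<Sum>i<n. (cmod (v i))\<^sup>2)"
      unfolding ip_def using cmod_sum_cauchy_schwarz[of "\<lambda>i. cnj (u k i)" v n] by simp
  qed
  then show "Re (sesq n A v) \<le> Re (tr1 n A) * (\<Sum>i<n. (cmod (v i))\<^sup>2)"
    unfolding s t by (simp only: Re_complex_of_real sum_distrib_right)
qed

text \<open>With A a sum of |u_k><u_k|, the trace of AB is the sum of <u_k|B|u_k>, to which the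
  bounds for single forms apply.\<close>

lemma psd_tr2:
  assumes A: "psd_on n A" and B: "psd_on n B"
  shows "tr2 n A B = complex_of_real (Re (tr2 n A B))" "0 \<le> Re (tr2 n A B)"
    "Re (tr2 n A B) \<le> Re (tr1 n A) * Re (tr1 n B)"
proof -
  obtain u where u: "\<And>i j. i < n \<Longrightarrow> j < n \<Longrightarrow> A i j = (\<Sum>k<n. u k i * cnj (u k j))"
    using psd_on_rank_one[OF A] by blast
  have t: "tr1 n A = complex_of_real (\<Sum>k<n. \<Sum>i<n. (cmod (u k i))\<^sup>2)" by (rule tr1_rank_one[OF u])
  have "tr2 n A B = (\<Sum>i<n. \<Sum>j<n. \<Sum>k<n. cnj (u k j) * B j i * u k i)"
    unfolding tr2_def by (intro sum.cong refl) (simp add: u sum_distrib_left sum_distrib_right mult_ac)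
  also have "\<dots> = (\<Sum>i<n. \<Sum>k<n. \<Sum>j<n. cnj (u k j) * B j i * u k i)"
    by (intro sum.cong[OF refl] sum.swap)
  also have "\<dots> = (\<Sum>k<n. \<Sum>i<n. \<Sum>j<n. cnj (u k j) * B j i * u k i)" by (rule sum.swap)
  also have "\<dots> = (\<Sum>k<n. sesq n B (u k))"
    unfolding sesq_def by (intro sum.cong[OF refl] sum.swap)
  also have "\<dots> = (\<Sum>k<n. complex_of_real (Re (sesq n B (u k))))"
    by (intro sum.cong refl psd_sesq(1)[OF B])
  finally have s: "tr2 n A B = complex_of_real (\<Sum>k<n. Re (sesq n B (u k)))" by simp
  show "tr2 n A B = complex_of_real (Re (tr2 n A B))" unfolding s by (simp only: Re_complex_of_real)
  show "0 \<le> Re (tr2 n A B)" unfolding s by (simp only: Re_complex_of_real) (intro sum_nonneg psd_sesq(2)[OF B])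
  have "(\<Sum>k<n. Re (sesq n B (u k))) \<le> (\<Sum>k<n. Re (tr1 n B) * (\<Sum>i<n. (cmod (u k i))\<^sup>2))"
    by (intro sum_mono psd_sesq(3)[OF B])
  then show "Re (tr2 n A B) \<le> Re (tr1 n A) * Re (tr1 n B)"
    unfolding s t by (simp only: Re_complex_of_real sum_distrib_left[symmetric] mult.commute)
qed

lemma tr2_self:
  assumes "herm_on n B"
  shows "tr2 n B B = complex_of_real (\<Sum>i<n. \<Sum>j<n. (cmod (B i j))\<^sup>2)"
proof -
  have "tr2 n B B = (\<Sum>i<n. \<Sum>j<n. B i j * cnj (B i j))"
    unfolding tr2_def
  proof (intro sum.cong refl)
    fix i j assume "i \<in> {..<n}" "j \<in> {..<n}"
    then have "B j i = cnj (B i j)" using assms[unfolded herm_on_def, rule_format, of i j] by simp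
    then show "B i j * B j i = B i j * cnj (B i j)" by (simp only:)
  qed
  then show ?thesis unfolding of_real_sum by (simp only: complex_norm_square)
qed

text \<open>The trace of A B^2 is the sum of the squared norms of B u_k, each at most the squared
  Frobenius norm of B times that of u_k. B is only Hermitian because the bound is applied to O_0,
  which is not positive semidefinite.\<close>

lemma psd_tr3_le:
  assumes A: "psd_on n A" and B: "herm_on n B"
  shows "Re (tr3 n A B B) \<le> Re (tr1 n A) * Re (tr2 n B B)"
proof -
  obtain u where u: "\<And>i j. i < n \<Longrightarrow> j < n \<Longrightarrow> A i j = (\<Sum>k<n. u k i * cnj (u k j))"
    using psd_on_rank_one[OF A] by blast
  have t: "tr1 n A = complex_of_real (\<Sum>k<n. \<Sum>i<n. (cmod (u k i))\<^sup>2)" by (rule tr1_rank_one[OF u])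
  define y where "y k l = (\<Sum>i<n. B l i * u k i)" for k l
  have yc: "(\<Sum>j<n. cnj (u k j) * B j l) = cnj (y k l)" if l: "l < n" for k l
  proof -
    have "cnj (y k l) = (\<Sum>j<n. cnj (B l j) * cnj (u k j))" unfolding y_def by simp
    also have "\<dots> = (\<Sum>j<n. cnj (u k j) * B j l)"
    proof (intro sum.cong refl)
      fix j assume "j \<in> {..<n}"
      then have "B j l = cnj (B l j)" using B[unfolded herm_on_def, rule_format, of l j] l by simp
      then show "cnj (B l j) * cnj (u k j) = cnj (u k j) * B j l" by simp
    qed
    finally show ?thesis ..
  qed
  have "tr3 n A B B = (\<Sum>i<n. \<Sum>j<n. \<Sum>l<n. \<Sum>k<n. (cnj (u k j) * B j l) * (B l i * u k i))"
    unfolding tr3_def by (intro sum.cong refl) (simp add: u sum_distrib_left sum_distrib_right mult_ac)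
  also have "\<dots> = (\<Sum>i<n. \<Sum>j<n. \<Sum>k<n. \<Sum>l<n. (cnj (u k j) * B j l) * (B l i * u k i))"
    by (intro sum.cong[OF refl] sum.swap)
  also have "\<dots> = (\<Sum>i<n. \<Sum>k<n. \<Sum>j<n. \<Sum>l<n. (cnj (u k j) * B j l) * (B l i * u k i))"
    by (intro sum.cong[OF refl] sum.swap)
  also have "\<dots> = (\<Sum>k<n. \<Sum>i<n. \<Sum>j<n. \<Sum>l<n. (cnj (u k j) * B j l) * (B l i * u k i))" by (rule sum.swap)
  also have "\<dots> = (\<Sum>k<n. \<Sum>l<n. y k l * cnj (y k l))"
  proof (rule sum.cong[OF refl])
    fix k
    have "(\<Sum>i<n. \<Sum>j<n. \<Sum>l<n. (cnj (u k j) * B j l) * (B l i * u k i))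
        = (\<Sum>i<n. \<Sum>l<n. \<Sum>j<n. (cnj (u k j) * B j l) * (B l i * u k i))"
      by (intro sum.cong[OF refl] sum.swap)
    also have "\<dots> = (\<Sum>l<n. \<Sum>i<n. \<Sum>j<n. (cnj (u k j) * B j l) * (B l i * u k i))" by (rule sum.swap)
    also have "\<dots> = (\<Sum>l<n. \<Sum>i<n. cnj (y k l) * (B l i * u k i))"
      by (intro sum.cong refl) (simp add: sum_distrib_right[symmetric] yc)
    also have "\<dots> = (\<Sum>l<n. y k l * cnj (y k l))"
      unfolding sum_distrib_left[symmetric] y_def[symmetric] by (simp only: mult.commute)
    finally show "(\<Sum>i<n. \<Sum>j<n. \<Sum>l<n. (cnj (u k j) * B j l) * (B l i * u k i)) = (\<Sum>l<n. y k l * cnj (y k l))" .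
  qed
  finally have s: "tr3 n A B B = complex_of_real (\<Sum>k<n. \<Sum>l<n. (cmod (y k l))\<^sup>2)"
    unfolding of_real_sum by (simp only: complex_norm_square)
  have "(\<Sum>k<n. \<Sum>l<n. (cmod (y k l))\<^sup>2)
      \<le> (\<Sum>k<n. \<Sum>l<n. (\<Sum>i<n. (cmod (B l i))\<^sup>2) * (\<Sum>i<n. (cmod (u k i))\<^sup>2))"
    unfolding y_def by (intro sum_mono cmod_sum_cauchy_schwarz)
  also have "\<dots> = (\<Sum>k<n. \<Sum>i<n. (cmod (u k i))\<^sup>2) * (\<Sum>l<n. \<Sum>i<n. (cmod (B l i))\<^sup>2)"
    by (simp only: sum_distrib_left[symmetric] sum_distrib_right[symmetric] mult.commute)
  finally show ?thesis unfolding s t tr2_self[OF B] by (simp only: Re_complex_of_real)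
qed

section \<open>Traces after subtracting a multiple of the identity\<close>

lemma tr2_shift:
  "tr2 n (\<lambda>i j. A i j - c * idm i j) B = tr2 n A B - c * tr1 n B"
proof -
  have "tr2 n (\<lambda>i j. A i j - c * idm i j) B = tr2 n A B - c * tr2 n idm B"
    unfolding tr2_def by (simp add: algebra_simps sum_subtractf sum_distrib_left)
  then show ?thesis by (simp add: tr2_idm)
qed

lemma tr3_shift:
  "tr3 n A (\<lambda>i j. B i j - c * idm i j) C = tr3 n A B C - c * tr2 n A C"
proof -
  have "tr3 n A (\<lambda>i j. B i j - c * idm i j) C = tr3 n A B C - c * tr3 n A idm C"
    unfolding tr3_def by (simp add: algebra_simps sum_subtractf sum_distrib_left)
  then show ?thesis by (simp add: tr3_idm)
qed

lemma tr1_shift: "tr1 n (\<lambda>i j. A i j - c * idm i j) = tr1 n A - c * of_nat n"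
  unfolding tr1_def by (simp add: idm_def sum_subtractf)

lemma tr2_shift_both:
  "tr2 n (\<lambda>i j. A i j - c * idm i j) (\<lambda>i j. A i j - c * idm i j) = tr2 n A A - 2 * c * tr1 n A + c\<^sup>2 * of_nat n"
  unfolding tr2_shift tr1_shift tr2_commute[of n A "\<lambda>i j. A i j - c * idm i j"]
  by (simp add: power2_eq_square algebra_simps)

lemma tr3_shift_both:
  "tr3 n A (\<lambda>i j. B i j - c * idm i j) (\<lambda>i j. B i j - c * idm i j)
     = tr3 n A B B - 2 * c * tr2 n A B + c\<^sup>2 * tr1 n A"
proof -
  let ?C = "\<lambda>i j. B i j - c * idm i j"
  have "tr3 n A B ?C = tr3 n B ?C A" by (rule tr3_cyclic)
  also have "\<dots> = tr3 n B B A - c * tr2 n A B" unfolding tr3_shift tr2_commute[of n B A] ..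
  also have "tr3 n B B A = tr3 n A B B" by (rule tr3_cyclic[symmetric])
  finally have 1: "tr3 n A B ?C = tr3 n A B B - c * tr2 n A B" .
  have 2: "tr2 n A ?C = tr2 n A B - c * tr1 n A"
    unfolding tr2_commute[of n A ?C] tr2_shift tr2_commute[of n B A] ..
  have "tr3 n A ?C ?C = tr3 n A B ?C - c * tr2 n A ?C" by (rule tr3_shift)
  then show ?thesis unfolding 1 2 by (simp add: power2_eq_square algebra_simps)
qed

section \<open>Mean and variance of a single estimate\<close>

lemma sesq_product_rank_one:
  assumes P: "\<And>i j. i < d \<Longrightarrow> j < d \<Longrightarrow> P i j = (\<Sum>k<d. u k i * cnj (u k j))"
    and Q: "\<And>i j. i < d \<Longrightarrow> j < d \<Longrightarrow> Q i j = (\<Sum>k<d. v k i * cnj (v k j))"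
    and R: "\<And>i j. i < d \<Longrightarrow> j < d \<Longrightarrow> R i j = (\<Sum>k<d. w k i * cnj (w k j))"
  shows "Re (sesq d P \<phi>) * Re (sesq d Q \<phi>) * Re (sesq d R \<phi>)
    = (\<Sum>i<d. \<Sum>j<d. \<Sum>k<d. overlap3 d (u i) (v j) (w k) \<phi>)"
proof -
  have p: "sesq d P \<phi> = complex_of_real (\<Sum>k<d. (cmod (ip d (u k) \<phi>))\<^sup>2)" by (rule sesq_rank_one[OF P])
  have q: "sesq d Q \<phi> = complex_of_real (\<Sum>k<d. (cmod (ip d (v k) \<phi>))\<^sup>2)" by (rule sesq_rank_one[OF Q])
  have r: "sesq d R \<phi> = complex_of_real (\<Sum>k<d. (cmod (ip d (w k) \<phi>))\<^sup>2)" by (rule sesq_rank_one[OF R])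
  show ?thesis unfolding p q r Re_complex_of_real sum_product3 overlap3_def ..
qed

lemma hE_psd_product:
  assumes d: "d \<ge> 3" and P: "psd_on d P" and Q: "psd_on d Q" and R: "psd_on d R"
  shows "hE d (\<lambda>\<phi>. Re (sesq d P \<phi>) * Re (sesq d Q \<phi>) * Re (sesq d R \<phi>)) = haar_const d * Re (sym_trace d P Q R)"
proof -
  have "complex_of_real (hE d (\<lambda>\<phi>. Re (sesq d P \<phi>) * Re (sesq d Q \<phi>) * Re (sesq d R \<phi>)))
      = hE d (\<lambda>\<phi>. complex_of_real (Re (sesq d P \<phi>) * Re (sesq d Q \<phi>) * Re (sesq d R \<phi>)))"
    by (rule integral_complex_of_real[symmetric])
  also have "\<dots> = hE d (\<lambda>\<phi>. sesq d P \<phi> * sesq d Q \<phi> * sesq d R \<phi>)"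
    by (simp only: of_real_mult psd_sesq(1)[OF P, symmetric] psd_sesq(1)[OF Q, symmetric] psd_sesq(1)[OF R, symmetric])
  also have "\<dots> = complex_of_real (haar_const d) * sym_trace d P Q R" by (rule haar_sesq_product[OF d])
  finally have "Re (complex_of_real (hE d (\<lambda>\<phi>. Re (sesq d P \<phi>) * Re (sesq d Q \<phi>) * Re (sesq d R \<phi>))))
    = Re (complex_of_real (haar_const d) * sym_trace d P Q R)" by (rule arg_cong)
  then show ?thesis by simp
qed

lemma overlap3_bound:
  assumes "\<And>i. i < d \<Longrightarrow> cmod (\<phi> i) \<le> 1"
  shows "norm (overlap3 d u v w \<phi>) \<le> (\<Sum>i<d. cmod (u i))\<^sup>2 * (\<Sum>i<d. cmod (v i))\<^sup>2 * (\<Sum>i<d. cmod (w i))\<^sup>2"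
proof -
  have b: "cmod (ip d u \<phi>) \<le> (\<Sum>i<d. cmod (u i))" for u
    unfolding ip_def
    by (rule order_trans[OF norm_sum]) (auto intro!: sum_mono simp: norm_mult mult_left_le assms)
  show ?thesis unfolding overlap3_def real_norm_def
    by (subst abs_of_nonneg) (auto intro!: mult_mono power_mono b)
qed

lemma design_psd:
  assumes d: "d \<ge> 3" and unit: "\<And>k. k \<in> set_pmf S \<Longrightarrow> unit_state d (psi k)"
    and des: "relative_approx_design d 3 \<epsilon> S psi"
    and P: "psd_on d P" and Q: "psd_on d Q" and R: "psd_on d R"
  defines "X \<equiv> measure_pmf.expectation S (\<lambda>k. Re (sesq d P (\<lambda>i. psi k $ i)) * Re (sesq d Q (\<lambda>i. psi k $ i)) * Re (sesq d R (\<lambda>i. psi k $ i)))"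
  shows "(1 - \<epsilon>) * (haar_const d * Re (sym_trace d P Q R)) \<le> X" "X \<le> (1 + \<epsilon>) * (haar_const d * Re (sym_trace d P Q R))"
proof -
  obtain u where u: "\<And>i j. i < d \<Longrightarrow> j < d \<Longrightarrow> P i j = (\<Sum>k<d. u k i * cnj (u k j))"
    using psd_on_rank_one[OF P] by blast
  obtain v where v: "\<And>i j. i < d \<Longrightarrow> j < d \<Longrightarrow> Q i j = (\<Sum>k<d. v k i * cnj (v k j))"
    using psd_on_rank_one[OF Q] by blast
  obtain w where w: "\<And>i j. i < d \<Longrightarrow> j < d \<Longrightarrow> R i j = (\<Sum>k<d. w k i * cnj (w k j))"
    using psd_on_rank_one[OF R] by blast
  have d0: "d > 0" using d by simp
  let ?f = "\<lambda>i j k. overlap3 d (u i) (v j) (w k)"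
  have prod: "Re (sesq d P \<phi>) * Re (sesq d Q \<phi>) * Re (sesq d R \<phi>) = (\<Sum>i<d. \<Sum>j<d. \<Sum>k<d. ?f i j k \<phi>)" for \<phi>
    by (rule sesq_product_rank_one[OF u v w])
  have iS: "integrable (measure_pmf S) (\<lambda>k. ?f a b c (\<lambda>i. psi k $ i))" for a b c
    by (rule integrable_pmf_bounded, rule overlap3_bound, rule cmod_unit_state_le[OF unit])
  have iH: "integrable (haar_state_measure d) (?f a b c)" for a b c
    unfolding overlap3_def ip_def by (intro haar_bounded_integrable haar_bounded_intros) auto
  have X: "X = (\<Sum>i<d. \<Sum>j<d. \<Sum>k<d. measure_pmf.expectation S (\<lambda>l. ?f i j k (\<lambda>i. psi l $ i)))"
    unfolding X_def prod by (rule integral_sum3) (rule iS)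
  have H: "haar_const d * Re (sym_trace d P Q R) = (\<Sum>i<d. \<Sum>j<d. \<Sum>k<d. hE d (?f i j k))"
    unfolding hE_psd_product[OF d P Q R, symmetric] prod by (rule integral_sum3) (rule iH)
  show "(1 - \<epsilon>) * (haar_const d * Re (sym_trace d P Q R)) \<le> X"
    unfolding X H sum_distrib_left by (intro sum_mono design_rank_one(1)[OF d0 unit des])
  show "X \<le> (1 + \<epsilon>) * (haar_const d * Re (sym_trace d P Q R))"
    unfolding X H sum_distrib_left by (intro sum_mono design_rank_one(2)[OF d0 unit des])
qed

text \<open>At \<open>\<epsilon> = 0\<close> the left-hand side is the exact Haar value \<open>(N+1)/(N+2) (Tr O_0^2 + 2 Tr (\<rho> O_0^2))\<close>,
  written with \<open>T = Tr O\<close>, \<open>q = Tr O^2\<close>, \<open>r = Tr (\<rho> O)\<close>, \<open>s = Tr (\<rho> O^2)\<close>.\<close>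
lemma variance_arithmetic:
  fixes N \<epsilon> T q r s :: real
  assumes N: "N \<ge> 4" and e: "\<epsilon> \<ge> 0" and r: "0 \<le> r" "r \<le> T" and q: "0 \<le> q" "q \<le> T\<^sup>2" and s: "s \<le> q"
    and q0: "0 \<le> q - T\<^sup>2 / N" and s0: "s - 2 * (T / N) * r + (T / N)\<^sup>2 \<le> q - T\<^sup>2 / N"
  shows "(N + 1) / (N + 2) * ((1 + \<epsilon>) * (T\<^sup>2 + q + 2 * r * T + 2 * s)
      - (1 - \<epsilon>) * (2 * (T / N) * ((N + 2) * (T + r)))
      + (1 + \<epsilon>) * ((T / N)\<^sup>2 * ((N + 2) * (N + 1))))
    \<le> 3 * (q - T\<^sup>2 / N) + 13 * \<epsilon> * T\<^sup>2"
proof -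
  define a where "a = (N + 1) / (N + 2)"
  define c where "c = T / N"
  have a: "0 \<le> a" "a \<le> 1" using N by (simp_all add: a_def)
  have T: "T \<ge> 0" using r by simp
  have cN: "c * N = T" "a * (N + 2) = N + 1" using N by (simp_all add: c_def a_def)
  have c0: "c \<ge> 0" using T N by (simp add: c_def)
  \<comment> \<open>(N + 1) c = T + c, and c is at most T / 4 because N is at least 4.\<close>
  have c1: "(N + 1) * c \<le> 5/4 * T"
  proof -
    have "4 * c \<le> N * c" using N c0 by (intro mult_right_mono) auto
    then show ?thesis using cN(1) by (simp add: algebra_simps)
  qed
  \<comment> \<open>The part free of \<epsilon> collapses to Tr(O_0^2) + 2 Tr(\<rho> O_0^2), and
    \<open>s0\<close> bounds the second trace by the first; hence the constant 3.\<close>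
  have id: "T\<^sup>2 + q + 2 * r * T + 2 * s - 2 * c * ((N + 2) * (T + r)) + c\<^sup>2 * ((N + 2) * (N + 1))
       = (q - T\<^sup>2 / N) + 2 * (s - 2 * c * r + c\<^sup>2)"
    using N unfolding c_def by (simp add: field_simps power2_eq_square)
  have "a * ((q - T\<^sup>2 / N) + 2 * (s - 2 * c * r + c\<^sup>2)) \<le> a * (3 * (q - T\<^sup>2 / N))"
    using s0 a unfolding c_def by (intro mult_left_mono) auto
  also have "\<dots> \<le> 1 * (3 * (q - T\<^sup>2 / N))" using a q0 by (intro mult_right_mono) auto
  finally have main: "a * (T\<^sup>2 + q + 2 * r * T + 2 * s - 2 * c * ((N + 2) * (T + r)) + c\<^sup>2 * ((N + 2) * (N + 1)))
       \<le> 3 * (q - T\<^sup>2 / N)" unfolding id by simp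
  have rT: "r * T \<le> T\<^sup>2" using r T by (simp add: power2_eq_square mult_right_mono)
  have "a * (T\<^sup>2 + q + 2 * r * T + 2 * s) \<le> a * (6 * T\<^sup>2)" using a rT q s by (intro mult_left_mono) auto
  also have "\<dots> \<le> 1 * (6 * T\<^sup>2)" using a by (intro mult_right_mono) auto
  finally have e1: "a * (T\<^sup>2 + q + 2 * r * T + 2 * s) \<le> 6 * T\<^sup>2" by simp
  have "a * (2 * c * ((N + 2) * (T + r))) = (a * (N + 2)) * (2 * c * (T + r))" by (simp only: mult_ac)
  also have "\<dots> = ((N + 1) * c) * (2 * (T + r))" unfolding cN(2) by (simp only: mult_ac)
  also have "\<dots> \<le> (5/4 * T) * (2 * (T + T))" by (rule mult_mono[OF c1]) (use r T in auto)
  finally have e2: "a * (2 * c * ((N + 2) * (T + r))) \<le> 5 * T\<^sup>2" by (simp add: power2_eq_square)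
  have "a * (c\<^sup>2 * ((N + 2) * (N + 1))) = (a * (N + 2)) * (c\<^sup>2 * (N + 1))" by (simp only: mult_ac)
  also have "\<dots> = ((N + 1) * c)\<^sup>2" unfolding cN(2) by (simp add: power2_eq_square algebra_simps)
  also have "\<dots> \<le> (5/4 * T)\<^sup>2" using c1 c0 N by (intro power_mono) auto
  also have "\<dots> \<le> 2 * T\<^sup>2" by (simp add: power2_eq_square)
  finally have e3: "a * (c\<^sup>2 * ((N + 2) * (N + 1))) \<le> 2 * T\<^sup>2" .
  \<comment> \<open>The middle term has a minus sign but carries 1 - \<epsilon>, so all three errors
    enter positively: 6 + 5 + 2 = 13.\<close>
  have "\<epsilon> * (a * (T\<^sup>2 + q + 2 * r * T + 2 * s) + a * (2 * c * ((N + 2) * (T + r))) + a * (c\<^sup>2 * ((N + 2) * (N + 1))))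
     \<le> \<epsilon> * (13 * T\<^sup>2)" using e e1 e2 e3 by (intro mult_left_mono) auto
  then show ?thesis using main unfolding a_def[symmetric] c_def[symmetric] by (simp add: algebra_simps)
qed

text \<open>The mean minimises the mean square deviation, so the explicit centre Tr O / N can
  replace the unknown mean of the estimate.\<close>

lemma pmf_variance_le:
  fixes p :: "real pmf"
  assumes B: "\<And>x. x \<in> set_pmf p \<Longrightarrow> \<bar>x\<bar> \<le> B"
  shows "measure_pmf.expectation p (\<lambda>x. (x - measure_pmf.expectation p (\<lambda>x. x))\<^sup>2)
    \<le> measure_pmf.expectation p (\<lambda>x. (x - c)\<^sup>2)"
proof -
  let ?\<mu> = "measure_pmf.expectation p (\<lambda>x. x)"
  have i: "integrable (measure_pmf p) (\<lambda>x. x)" using B by (intro integrable_pmf_bounded) auto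
  have i2: "integrable (measure_pmf p) (\<lambda>x. (x - ?\<mu>)\<^sup>2)"
  proof (rule integrable_pmf_bounded[of _ _ "(B + \<bar>?\<mu>\<bar>)\<^sup>2"])
    fix x assume "x \<in> set_pmf p"
    then have "\<bar>x - ?\<mu>\<bar> \<le> B + \<bar>?\<mu>\<bar>" using B[of x] by linarith
    from power_mono[OF this, of 2] show "norm ((x - ?\<mu>)\<^sup>2) \<le> (B + \<bar>?\<mu>\<bar>)\<^sup>2" by simp
  qed
  have "measure_pmf.expectation p (\<lambda>x. (x - c)\<^sup>2)
      = measure_pmf.expectation p (\<lambda>x. (x - ?\<mu>)\<^sup>2 + (2 * (?\<mu> - c) * (x - ?\<mu>) + (?\<mu> - c)\<^sup>2))"
    by (intro Bochner_Integration.integral_cong refl) (simp add: power2_eq_square algebra_simps)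
  also have "\<dots> = measure_pmf.expectation p (\<lambda>x. (x - ?\<mu>)\<^sup>2) + (2 * (?\<mu> - c) * (?\<mu> - ?\<mu>) + (?\<mu> - c)\<^sup>2)"
    using i i2 by simp
  finally show ?thesis by simp
qed

lemma shadow_vec_norm:
  assumes x: "x < 2 ^ n" and unit: "(\<Sum>i<2 ^ n. (cmod (\<zeta> i))\<^sup>2) = 1"
  shows "(\<Sum>i<2 ^ n. (cmod (shadow_vec \<zeta> z x i))\<^sup>2) = 1"
proof -
  have par1: "cmod (par z i) = 1" for i unfolding par_def by (simp add: norm_power)
  have "(\<Sum>i<2 ^ n. (cmod (shadow_vec \<zeta> z x i))\<^sup>2) = (\<Sum>i<2 ^ n. (cmod (\<zeta> (i XOR x)))\<^sup>2)"
    unfolding shadow_vec_def by (simp add: norm_mult par1)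
  also have "\<dots> = (\<Sum>i<2 ^ n. (cmod (\<zeta> i))\<^sup>2)" by (rule sum_xor_reindex[OF x])
  finally show ?thesis using unit by simp
qed

locale shadow_protocol =
  fixes n :: nat and Obs \<rho> :: "complex mat" and \<epsilon> :: real
    and S :: "'k pmf" and psi :: "'k \<Rightarrow> complex Matrix.vec"
  assumes n2: "n \<ge> 2" and Obs: "Obs \<in> carrier_mat (2 ^ n) (2 ^ n)" and psd_Obs: "psd_mat Obs"
    and dens: "density_mat n \<rho>" and unit: "\<forall>k \<in> set_pmf S. unit_state (2 ^ n) (psi k)"
    and design: "relative_approx_design (2 ^ n) 3 \<epsilon> S psi"
begin

definition Om :: "nat \<Rightarrow> nat \<Rightarrow> complex" where "Om i j = Obs $$ (i, j)"
definition Rm :: "nat \<Rightarrow> nat \<Rightarrow> complex" where "Rm i j = \<rho> $$ (i, j)"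
definition T where "T = Re (tr1 (2 ^ n) Om)"
definition r where "r = Re (tr2 (2 ^ n) Rm Om)"
definition q where "q = Re (tr2 (2 ^ n) Om Om)"
definition s where "s = Re (tr3 (2 ^ n) Rm Om Om)"
definition obs_val where "obs_val k z x = Re (sesq (2 ^ n) Om (shadow_vec (\<lambda>i. psi k $ i) z x))"
text \<open>N times the probability of the outcome, which is why the weights below are divided by
  2^n.\<close>

definition born where "born k z x = Re (sesq (2 ^ n) Rm (shadow_vec (\<lambda>i. psi k $ i) z x))"

text \<open>The assumption on n enters through this bound and the next: dimension at least 4 for the
  constants in \<open>variance_arithmetic\<close>, at least 3 for the Haar moments.\<close>

lemma N4: "(2::real) ^ n \<ge> 4"
proof -
  have "(2::real) ^ 2 \<le> 2 ^ n" using n2 by (intro power_increasing) auto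
  then show ?thesis by simp
qed

lemma d3: "(2::nat) ^ n \<ge> 3"
proof -
  have "(2::nat) ^ 2 \<le> 2 ^ n" using n2 by (intro power_increasing) auto
  then show ?thesis by simp
qed

lemma psd_O: "psd_on (2 ^ n) Om"
  using psd_mat_psd_on[OF psd_Obs Obs] unfolding Om_def .

lemma psd_R: "psd_on (2 ^ n) Rm"
  using dens psd_mat_psd_on[of \<rho> "2 ^ n"] unfolding Rm_def density_mat_def by auto

lemma tr1_R: "tr1 (2 ^ n) Rm = 1"
  using dens unfolding density_mat_def mtrace_def tr1_def Rm_def by auto

lemma tr1_O: "tr1 (2 ^ n) Om = complex_of_real T"
  unfolding T_def by (rule psd_tr1(1)[OF psd_O])

lemma T0: "T \<ge> 0" unfolding T_def by (rule psd_tr1(2)[OF psd_O])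

lemma r_bounds: "0 \<le> r" "r \<le> T"
  using psd_tr2(2,3)[OF psd_R psd_O] unfolding r_def tr1_R T_def by auto

lemma q_bounds: "0 \<le> q" "q \<le> T\<^sup>2"
  using psd_tr2(2,3)[OF psd_O psd_O] unfolding q_def T_def by (auto simp: power2_eq_square)

lemma tr2_RO: "tr2 (2 ^ n) Rm Om = complex_of_real r"
  unfolding r_def by (rule psd_tr2(1)[OF psd_R psd_O])

lemma tr2_OO: "tr2 (2 ^ n) Om Om = complex_of_real q"
  unfolding q_def by (rule psd_tr2(1)[OF psd_O psd_O])

lemma s_le: "s \<le> q"
  using psd_tr3_le[OF psd_R, of Om] psd_O unfolding s_def q_def tr1_R psd_on_def by auto

definition O0 :: "nat \<Rightarrow> nat \<Rightarrow> complex" where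
  "O0 i j = Om i j - complex_of_real (T / 2 ^ n) * idm i j"

lemma herm_O0: "herm_on (2 ^ n) O0"
  unfolding herm_on_def
proof (intro allI impI)
  fix i j :: nat assume "i < 2 ^ n" "j < 2 ^ n"
  then have "Om j i = cnj (Om i j)" using psd_O unfolding psd_on_def herm_on_def by blast
  then show "O0 j i = cnj (O0 i j)" unfolding O0_def idm_def by simp
qed

lemma tr2_O0: "tr2 (2 ^ n) O0 O0 = complex_of_real (q - T\<^sup>2 / 2 ^ n)"
proof -
  have "tr2 (2 ^ n) O0 O0 = complex_of_real (q - 2 * (T / 2 ^ n) * T + (T / 2 ^ n)\<^sup>2 * 2 ^ n)"
    unfolding O0_def tr2_shift_both tr2_OO tr1_O by simp
  also have "q - 2 * (T / 2 ^ n) * T + (T / 2 ^ n)\<^sup>2 * 2 ^ n = q - T\<^sup>2 / 2 ^ n"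
    by (simp add: field_simps power2_eq_square)
  finally show ?thesis .
qed

lemma tr3_O0: "Re (tr3 (2 ^ n) Rm O0 O0) = s - 2 * (T / 2 ^ n) * r + (T / 2 ^ n)\<^sup>2"
proof -
  have "tr3 (2 ^ n) Rm O0 O0 = tr3 (2 ^ n) Rm Om Om + complex_of_real (- 2 * (T / 2 ^ n) * r + (T / 2 ^ n)\<^sup>2)"
    unfolding O0_def tr3_shift_both tr2_RO tr1_R by simp
  then show ?thesis unfolding s_def by simp
qed

lemma q0: "0 \<le> q - T\<^sup>2 / 2 ^ n"
proof -
  have "q - T\<^sup>2 / 2 ^ n = (\<Sum>i<2 ^ n. \<Sum>j<2 ^ n. (cmod (O0 i j))\<^sup>2)"
    using tr2_self[OF herm_O0] unfolding tr2_O0 of_real_eq_iff .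
  then show ?thesis by (simp add: sum_nonneg)
qed

lemma s0: "s - 2 * (T / 2 ^ n) * r + (T / 2 ^ n)\<^sup>2 \<le> q - T\<^sup>2 / 2 ^ n"
  using psd_tr3_le[OF psd_R herm_O0] unfolding tr3_O0 tr2_O0 tr1_R by simp

lemma unit_norm: "k \<in> set_pmf S \<Longrightarrow> (\<Sum>i<2 ^ n. (cmod (psi k $ i))\<^sup>2) = 1"
  using unit unfolding unit_state_def by auto

lemma ob_bounds:
  assumes "k \<in> set_pmf S" "x < 2 ^ n" shows "0 \<le> obs_val k z x" "obs_val k z x \<le> T"
  using psd_sesq(2,3)[OF psd_O, of "shadow_vec (\<lambda>i. psi k $ i) z x"] shadow_vec_norm[OF assms(2) unit_norm[OF assms(1)], of z]
  unfolding obs_val_def T_def by auto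

lemma wt_bounds:
  assumes "k \<in> set_pmf S" "x < 2 ^ n" shows "0 \<le> born k z x" "born k z x \<le> 1"
  using psd_sesq(2,3)[OF psd_R, of "shadow_vec (\<lambda>i. psi k $ i) z x"] shadow_vec_norm[OF assms(2) unit_norm[OF assms(1)], of z]
  unfolding born_def tr1_R by auto

lemma sum_wt:
  assumes "k \<in> set_pmf S" shows "(\<Sum>z<2 ^ n. \<Sum>x<2 ^ n. born k z x) = 2 ^ n"
proof -
  have "(\<Sum>z<2 ^ n. \<Sum>x<2 ^ n. born k z x) = Re (\<Sum>z<2 ^ n. \<Sum>x<2 ^ n. sesq (2 ^ n) Rm (shadow_vec (\<lambda>i. psi k $ i) z x))"
    unfolding born_def Re_sum ..
  also have "\<dots> = Re (complex_of_real (2 ^ n))"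
    unfolding sum_outcomes[OF unit_norm[OF assms]] using tr1_R unfolding tr1_def by simp
  finally show ?thesis by simp
qed

lemma idm_factor:
  assumes "k \<in> set_pmf S" "x < 2 ^ n"
  shows "Re (sesq (2 ^ n) (twist z x idm) (\<lambda>i. psi k $ i)) = 1"
  unfolding sesq_shadow_vec[OF assms(2), symmetric] sesq_idm
  using shadow_vec_norm[OF assms(2) unit_norm[OF assms(1)]] by simp

lemma kappa: "haar_const (2 ^ n) * (2 ^ n * (2 ^ n + 1) * (2 ^ n + 2)) = 1" "haar_const (2 ^ n) > 0"
proof -
  define D :: real where "D = 2 ^ n * (2 ^ n + 1) * (2 ^ n + 2)"
  have "D > 0" unfolding D_def by (intro mult_pos_pos add_pos_pos) auto
  moreover have "haar_const (2 ^ n) = 1 / D" unfolding haar_const_def D_def by simp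
  ultimately show "haar_const (2 ^ n) * (2 ^ n * (2 ^ n + 1) * (2 ^ n + 2)) = 1" "haar_const (2 ^ n) > 0"
    unfolding D_def[symmetric] by simp_all
qed

text \<open>The design condition is applied to psi itself with the twisted matrices; as twisting
  leaves \<open>sym_trace\<close> unchanged, the bounds do not depend on the outcome.\<close>

lemma design_triple:
  fixes z x :: nat
  assumes x: "x < 2 ^ n" and P: "psd_on (2 ^ n) P" and Q: "psd_on (2 ^ n) Q" and R: "psd_on (2 ^ n) R"
  defines "f \<equiv> \<lambda>A k. Re (sesq (2 ^ n) A (shadow_vec (\<lambda>i. psi k $ i) z x))"
  shows "(1 - \<epsilon>) * (haar_const (2 ^ n) * Re (sym_trace (2 ^ n) P Q R)) \<le> measure_pmf.expectation S (\<lambda>k. f P k * f Q k * f R k)"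
    and "measure_pmf.expectation S (\<lambda>k. f P k * f Q k * f R k) \<le> (1 + \<epsilon>) * (haar_const (2 ^ n) * Re (sym_trace (2 ^ n) P Q R))"
  unfolding f_def sesq_shadow_vec[OF x] sym_trace_twist[OF x, of z P Q R, symmetric]
  using unit by (intro design_psd[OF d3 _ design] psd_on_twist x P Q R; blast)+

lemma expectation_wt_ob:
  assumes x: "x < 2 ^ n"
  shows "(1 - \<epsilon>) * (haar_const (2 ^ n) * ((2 ^ n + 2) * (T + r))) \<le> measure_pmf.expectation S (\<lambda>k. born k z x * obs_val k z x)"
    and "measure_pmf.expectation S (\<lambda>k. born k z x * obs_val k z x) \<le> (1 + \<epsilon>) * (haar_const (2 ^ n) * ((2 ^ n + 2) * (T + r)))"
proof -
  have "sym_trace (2 ^ n) Rm Om idm = complex_of_real ((2 ^ n + 2) * (T + r))"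
    unfolding sym_trace_idm tr1_R tr1_O tr2_RO by simp
  then have F: "Re (sym_trace (2 ^ n) Rm Om idm) = (2 ^ n + 2) * (T + r)" by (simp only: Re_complex_of_real)
  have E: "measure_pmf.expectation S (\<lambda>k. Re (sesq (2 ^ n) Rm (shadow_vec (\<lambda>i. psi k $ i) z x)) *
      Re (sesq (2 ^ n) Om (shadow_vec (\<lambda>i. psi k $ i) z x)) * Re (sesq (2 ^ n) idm (shadow_vec (\<lambda>i. psi k $ i) z x)))
    = measure_pmf.expectation S (\<lambda>k. born k z x * obs_val k z x)"
    by (intro integral_cong_AE AE_pmfI)
       (simp_all add: born_def obs_val_def sesq_shadow_vec[OF x, of idm] idm_factor[OF _ x])
  show "(1 - \<epsilon>) * (haar_const (2 ^ n) * ((2 ^ n + 2) * (T + r))) \<le> measure_pmf.expectation S (\<lambda>k. born k z x * obs_val k z x)"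
    and "measure_pmf.expectation S (\<lambda>k. born k z x * obs_val k z x) \<le> (1 + \<epsilon>) * (haar_const (2 ^ n) * ((2 ^ n + 2) * (T + r)))"
    using design_triple[OF x psd_R psd_O psd_on_idm, of z] unfolding E F by auto
qed

lemma expectation_wt:
  assumes x: "x < 2 ^ n"
  shows "(1 - \<epsilon>) * (haar_const (2 ^ n) * ((2 ^ n + 2) * (2 ^ n + 1))) \<le> measure_pmf.expectation S (\<lambda>k. born k z x)"
    and "measure_pmf.expectation S (\<lambda>k. born k z x) \<le> (1 + \<epsilon>) * (haar_const (2 ^ n) * ((2 ^ n + 2) * (2 ^ n + 1)))"
proof -
  have "sym_trace (2 ^ n) Rm idm idm = complex_of_real ((2 ^ n + 2) * (2 ^ n + 1))"
    unfolding sym_trace_idm tr1_R tr1_idm tr2_idm by simp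
  then have F: "Re (sym_trace (2 ^ n) Rm idm idm) = (2 ^ n + 2) * (2 ^ n + 1)" by (simp only: Re_complex_of_real)
  have E: "measure_pmf.expectation S (\<lambda>k. Re (sesq (2 ^ n) Rm (shadow_vec (\<lambda>i. psi k $ i) z x)) *
      Re (sesq (2 ^ n) idm (shadow_vec (\<lambda>i. psi k $ i) z x)) * Re (sesq (2 ^ n) idm (shadow_vec (\<lambda>i. psi k $ i) z x)))
    = measure_pmf.expectation S (\<lambda>k. born k z x)"
    by (intro integral_cong_AE AE_pmfI)
       (simp_all add: born_def sesq_shadow_vec[OF x, of idm] idm_factor[OF _ x])
  show "(1 - \<epsilon>) * (haar_const (2 ^ n) * ((2 ^ n + 2) * (2 ^ n + 1))) \<le> measure_pmf.expectation S (\<lambda>k. born k z x)"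
    and "measure_pmf.expectation S (\<lambda>k. born k z x) \<le> (1 + \<epsilon>) * (haar_const (2 ^ n) * ((2 ^ n + 2) * (2 ^ n + 1)))"
    using design_triple[OF x psd_R psd_on_idm psd_on_idm, of z] unfolding E F by auto
qed

lemma expectation_wt_ob2:
  assumes x: "x < 2 ^ n"
  shows "measure_pmf.expectation S (\<lambda>k. born k z x * (obs_val k z x)\<^sup>2) \<le> (1 + \<epsilon>) * (haar_const (2 ^ n) * (T\<^sup>2 + q + 2 * r * T + 2 * s))"
proof -
  have "tr3 (2 ^ n) Om Om Rm = tr3 (2 ^ n) Rm Om Om" by (rule tr3_cyclic[symmetric])
  then have "sym_trace (2 ^ n) Rm Om Om = complex_of_real (T\<^sup>2 + q + 2 * r * T) + 2 * tr3 (2 ^ n) Rm Om Om"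
    unfolding sym_trace_def tr1_R tr1_O tr2_RO tr2_OO by (simp add: power2_eq_square)
  then have F: "Re (sym_trace (2 ^ n) Rm Om Om) = T\<^sup>2 + q + 2 * r * T + 2 * s" unfolding s_def by simp
  show ?thesis
    using design_triple(2)[OF x psd_R psd_O psd_O, of z]
    unfolding F born_def[symmetric] obs_val_def[symmetric] by (simp add: power2_eq_square mult.assoc)
qed

text \<open>The two design bounds enclose a common value, and the Haar value that they scale is
  positive.\<close>

lemma eps_nonneg: "\<epsilon> \<ge> 0"
proof -
  have "(1 - \<epsilon>) * (haar_const (2 ^ n) * ((2 ^ n + 2) * (2 ^ n + 1))) \<le> (1 + \<epsilon>) * (haar_const (2 ^ n) * ((2 ^ n + 2) * (2 ^ n + 1)))"
    using expectation_wt[of 0 0] by simp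
  moreover have "0 < haar_const (2 ^ n) * ((2 ^ n + 2) * (2 ^ n + 1))"
    using kappa(2) N4 by (intro mult_pos_pos) auto
  ultimately show ?thesis by (simp add: mult_le_cancel_right)
qed

lemma mtrace_Obs: "mtrace Obs = complex_of_real T"
proof -
  have "mtrace Obs = tr1 (2 ^ n) Om" using Obs unfolding mtrace_def tr1_def Om_def by auto
  then show ?thesis by (simp only: tr1_O)
qed

lemma mtrace_Obs_rho: "Re (mtrace (Obs * \<rho>)) = r"
proof -
  have "\<rho> \<in> carrier_mat (2 ^ n) (2 ^ n)" using dens unfolding density_mat_def by auto
  then have "mtrace (Obs * \<rho>) = tr2 (2 ^ n) Om Rm"
    using Obs mat_mult_entry[OF Obs] unfolding mtrace_def tr2_def Om_def Rm_def by auto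
  then show ?thesis unfolding r_def by (simp only: tr2_commute)
qed

lemma mtrace_traceless: "Re (mtrace (traceless_part Obs * traceless_part Obs)) = q - T\<^sup>2 / 2 ^ n"
proof -
  let ?M = "traceless_part Obs"
  have M: "?M \<in> carrier_mat (2 ^ n) (2 ^ n)" using Obs unfolding traceless_part_def by auto
  have e: "?M $$ (i, j) = O0 i j" if "i < 2 ^ n" "j < 2 ^ n" for i j
    using that Obs unfolding traceless_part_def mtrace_Obs O0_def Om_def idm_def by auto
  have "mtrace (?M * ?M) = (\<Sum>i<2 ^ n. (?M * ?M) $$ (i, i))" using M unfolding mtrace_def by simp
  also have "\<dots> = tr2 (2 ^ n) O0 O0"
    unfolding tr2_def
  proof (intro sum.cong[OF refl])
    fix i :: nat assume i: "i \<in> {..<2 ^ n}"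
    have "(?M * ?M) $$ (i, i) = (\<Sum>j<2 ^ n. ?M $$ (i, j) * ?M $$ (j, i))"
      by (rule mat_mult_entry[OF M M]) (use i in auto)
    also have "\<dots> = (\<Sum>j<2 ^ n. O0 i j * O0 j i)" using i by (intro sum.cong refl) (simp add: e)
    finally show "(?M * ?M) $$ (i, i) = (\<Sum>j<2 ^ n. O0 i j * O0 j i)" .
  qed
  finally show ?thesis unfolding tr2_O0 by simp
qed

lemma estimate_value:
  assumes "k \<in> set_pmf S" "z < 2 ^ n" "x < 2 ^ n"
  shows "Re (mtrace (Obs * classical_shadow n (psi k) x z)) = (2 ^ n + 1) * obs_val k z x - T"
proof -
  have v: "psi k \<in> carrier_vec (2 ^ n)" using assms unit unfolding unit_state_def by auto
  have "sesq (2 ^ n) Om (shadow_vec (\<lambda>i. psi k $ i) z x) = complex_of_real (obs_val k z x)"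
    unfolding obs_val_def by (rule psd_sesq(1)[OF psd_O])
  then have "mtrace (Obs * classical_shadow n (psi k) x z) = complex_of_real ((2 ^ n + 1) * obs_val k z x - T)"
    unfolding estimate_eq[OF Obs v assms(2,3)] mtrace_Obs Om_def by simp
  then show ?thesis by (simp only: Re_complex_of_real)
qed

section \<open>The distribution of one estimate\<close>

abbreviation single where "single \<equiv> single_estimate n S psi Obs \<rho>"

lemma single_alt: "single = bind_pmf S (\<lambda>k. map_pmf
    (\<lambda>(z, x). Re (mtrace (Obs * classical_shadow n (psi k) x z))) (outcome_pmf n \<rho> (psi k)))"
  unfolding single_estimate_def map_pmf_def by (simp add: case_prod_unfold)

lemma set_outcome:
  assumes "k \<in> set_pmf S" "(z, x) \<in> set_pmf (outcome_pmf n \<rho> (psi k))"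
  shows "z < 2 ^ n" "x < 2 ^ n"
  using outcome_pmf_expectation(2)[OF dens, of "psi k"] unit assms by auto

lemma single_bounded:
  assumes "y \<in> set_pmf single"
  shows "\<bar>y\<bar> \<le> (2 ^ n + 1) * T + T"
proof -
  obtain k z x where k: "k \<in> set_pmf S" and zx: "(z, x) \<in> set_pmf (outcome_pmf n \<rho> (psi k))"
    and y: "y = Re (mtrace (Obs * classical_shadow n (psi k) x z))"
    using assms unfolding single_alt by auto
  note zx' = set_outcome[OF k zx]
  have "y = (2 ^ n + 1) * obs_val k z x - T" unfolding y by (rule estimate_value[OF k zx'])
  moreover have "0 \<le> (2 ^ n + 1) * obs_val k z x" using ob_bounds[OF k zx'(2), of z] by simp
  moreover have "(2 ^ n + 1) * obs_val k z x \<le> (2 ^ n + 1) * T"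
    using ob_bounds[OF k zx'(2), of z] by (intro mult_left_mono) auto
  ultimately show ?thesis using T0 by linarith
qed

lemma single_expectation:
  fixes h :: "real \<Rightarrow> real"
  assumes h: "\<And>y. \<bar>y\<bar> \<le> (2 ^ n + 1) * T + T \<Longrightarrow> \<bar>h y\<bar> \<le> B"
  shows "measure_pmf.expectation single h
    = measure_pmf.expectation S (\<lambda>k. \<Sum>z<2 ^ n. \<Sum>x<2 ^ n. born k z x / 2 ^ n * h ((2 ^ n + 1) * obs_val k z x - T))"
proof -
  have "measure_pmf.expectation single h = measure_pmf.expectation S (\<lambda>k. measure_pmf.expectation (map_pmf
    (\<lambda>(z, x). Re (mtrace (Obs * classical_shadow n (psi k) x z))) (outcome_pmf n \<rho> (psi k))) h)"
    unfolding single_alt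
    by (rule integral_bind_pmf_bounded[of _ _ _ B]) (rule h, rule single_bounded, simp only: single_alt)
  also have "\<dots> = measure_pmf.expectation S (\<lambda>k. \<Sum>z<2 ^ n. \<Sum>x<2 ^ n. born k z x / 2 ^ n * h ((2 ^ n + 1) * obs_val k z x - T))"
  proof (rule integral_cong_AE)
    show "AE k in measure_pmf S. measure_pmf.expectation (map_pmf
      (\<lambda>(z, x). Re (mtrace (Obs * classical_shadow n (psi k) x z))) (outcome_pmf n \<rho> (psi k))) h
      = (\<Sum>z<2 ^ n. \<Sum>x<2 ^ n. born k z x / 2 ^ n * h ((2 ^ n + 1) * obs_val k z x - T))"
    proof (rule AE_pmfI)
      fix k assume k: "k \<in> set_pmf S"
      then have u: "unit_state (2 ^ n) (psi k)" using unit by auto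
      show "measure_pmf.expectation (map_pmf
        (\<lambda>(z, x). Re (mtrace (Obs * classical_shadow n (psi k) x z))) (outcome_pmf n \<rho> (psi k))) h
        = (\<Sum>z<2 ^ n. \<Sum>x<2 ^ n. born k z x / 2 ^ n * h ((2 ^ n + 1) * obs_val k z x - T))"
        unfolding integral_map_pmf outcome_pmf_expectation(1)[OF dens u]
        by (intro sum.cong refl) (simp add: estimate_value[OF k] born_def Rm_def[abs_def])
    qed
  qed auto
  finally show ?thesis .
qed

lemma integrable_wt_ob:
  assumes x: "x < 2 ^ n"
  shows "integrable (measure_pmf S) (\<lambda>k. born k z x)" "integrable (measure_pmf S) (\<lambda>k. born k z x * obs_val k z x)"
    "integrable (measure_pmf S) (\<lambda>k. born k z x * (obs_val k z x)\<^sup>2)"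
proof -
  have b: "\<bar>born k z x\<bar> \<le> 1" "\<bar>obs_val k z x\<bar> \<le> T" if "k \<in> set_pmf S" for k
    using wt_bounds[OF that x] ob_bounds[OF that x] by auto
  show "integrable (measure_pmf S) (\<lambda>k. born k z x)"
    by (rule integrable_pmf_bounded[of _ _ 1]) (use b in auto)
  show "integrable (measure_pmf S) (\<lambda>k. born k z x * obs_val k z x)"
  proof (rule integrable_pmf_bounded[of _ _ "1 * T"])
    fix k assume k: "k \<in> set_pmf S"
    show "norm (born k z x * obs_val k z x) \<le> 1 * T"
      using b[OF k] by (simp only: real_norm_def abs_mult) (intro mult_mono; simp)
  qed
  show "integrable (measure_pmf S) (\<lambda>k. born k z x * (obs_val k z x)\<^sup>2)"
  proof (rule integrable_pmf_bounded[of _ _ "1 * T\<^sup>2"])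
    fix k assume k: "k \<in> set_pmf S"
    have "(obs_val k z x)\<^sup>2 \<le> T\<^sup>2" using ob_bounds[OF k x] by (intro power_mono) auto
    then show "norm (born k z x * (obs_val k z x)\<^sup>2) \<le> 1 * T\<^sup>2"
      using b(1)[OF k] by (simp only: real_norm_def abs_mult abs_power2) (intro mult_mono; simp)
  qed
qed

lemma sum_const_outcomes: "(\<Sum>z<(2::nat) ^ n. \<Sum>x<(2::nat) ^ n. c) = (2 ^ n)\<^sup>2 * (c :: real)" for c
  by (simp add: power2_eq_square)

text \<open>Summed over the N^2 outcomes, the prefactors cancel against \<open>haar_const\<close>,
  so before T is subtracted the mean lies between (1 - \<epsilon>) and (1 + \<epsilon>) times T + r.
  At \<epsilon> = 0 it is exactly r after the subtraction; in general the bias is at most \<epsilon>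
  (T + r), and r \<le> T gives the term 2 \<epsilon> Tr(O).\<close>

lemma single_mean:
  "\<bar>measure_pmf.expectation single (\<lambda>y. y) - r\<bar> \<le> 2 * \<epsilon> * T"
proof -
  let ?N = "2 ^ n :: real"
  let ?E = "\<lambda>z x. measure_pmf.expectation S (\<lambda>k. born k z x * obs_val k z x)"
  have "measure_pmf.expectation single (\<lambda>y. y)
    = measure_pmf.expectation S (\<lambda>k. \<Sum>z<2 ^ n. \<Sum>x<2 ^ n. born k z x / ?N * ((?N + 1) * obs_val k z x - T))"
    by (rule single_expectation)
  also have "\<dots> = measure_pmf.expectation S (\<lambda>k. (?N + 1) / ?N * (\<Sum>z<2 ^ n. \<Sum>x<2 ^ n. born k z x * obs_val k z x) - T)"
  proof (intro integral_cong_AE AE_pmfI)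
    fix k assume k: "k \<in> set_pmf S"
    have "(\<Sum>z<2 ^ n. \<Sum>x<2 ^ n. born k z x / ?N * ((?N + 1) * obs_val k z x - T))
      = (\<Sum>z<2 ^ n. \<Sum>x<2 ^ n. (?N + 1) / ?N * (born k z x * obs_val k z x) - T / ?N * born k z x)"
      by (intro sum.cong refl) (simp add: field_simps)
    also have "\<dots> = (?N + 1) / ?N * (\<Sum>z<2 ^ n. \<Sum>x<2 ^ n. born k z x * obs_val k z x) - T / ?N * (\<Sum>z<2 ^ n. \<Sum>x<2 ^ n. born k z x)"
      by (simp only: sum_subtractf sum_distrib_left)
    finally show "(\<Sum>z<2 ^ n. \<Sum>x<2 ^ n. born k z x / ?N * ((?N + 1) * obs_val k z x - T))
      = (?N + 1) / ?N * (\<Sum>z<2 ^ n. \<Sum>x<2 ^ n. born k z x * obs_val k z x) - T"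
      unfolding sum_wt[OF k] by simp
  qed auto
  also have "\<dots> = (?N + 1) / ?N * (\<Sum>z<2 ^ n. \<Sum>x<2 ^ n. ?E z x) - T"
  proof -
    have "measure_pmf.expectation S (\<lambda>k. \<Sum>z<2 ^ n. \<Sum>x<2 ^ n. born k z x * obs_val k z x)
      = (\<Sum>z<2 ^ n. measure_pmf.expectation S (\<lambda>k. \<Sum>x<2 ^ n. born k z x * obs_val k z x))"
      by (intro Bochner_Integration.integral_sum Bochner_Integration.integrable_sum integrable_wt_ob) auto
    also have "\<dots> = (\<Sum>z<2 ^ n. \<Sum>x<2 ^ n. ?E z x)"
      by (intro sum.cong[OF refl] Bochner_Integration.integral_sum integrable_wt_ob) auto
    finally have "measure_pmf.expectation S (\<lambda>k. \<Sum>z<2 ^ n. \<Sum>x<2 ^ n. born k z x * obs_val k z x)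
      = (\<Sum>z<2 ^ n. \<Sum>x<2 ^ n. ?E z x)" .
    moreover have "integrable (measure_pmf S) (\<lambda>k. \<Sum>z<2 ^ n. \<Sum>x<2 ^ n. born k z x * obs_val k z x)"
      by (intro Bochner_Integration.integrable_sum integrable_wt_ob) auto
    ultimately show ?thesis by simp
  qed
  finally have mean: "measure_pmf.expectation single (\<lambda>y. y) = (?N + 1) / ?N * (\<Sum>z<2 ^ n. \<Sum>x<2 ^ n. ?E z x) - T" .
  let ?v = "haar_const (2 ^ n) * ((?N + 2) * (T + r))"
  have norm: "(?N + 1) / ?N * (?N\<^sup>2 * (b * ?v)) = b * (T + r)" for b
  proof -
    have "(?N + 1) / ?N * (?N\<^sup>2 * (b * ?v)) = (haar_const (2 ^ n) * (?N * (?N + 1) * (?N + 2))) * (b * (T + r))"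
      by (simp add: power2_eq_square)
    then show ?thesis unfolding kappa(1) by simp
  qed
  have pos: "0 \<le> (?N + 1) / ?N" by simp
  have "(\<Sum>z<(2::nat) ^ n. \<Sum>x<(2::nat) ^ n. (1 - \<epsilon>) * ?v) \<le> (\<Sum>z<2 ^ n. \<Sum>x<2 ^ n. ?E z x)"
    by (intro sum_mono expectation_wt_ob(1)) auto
  from mult_left_mono[OF this pos] have lo: "(1 - \<epsilon>) * (T + r) \<le> (?N + 1) / ?N * (\<Sum>z<2 ^ n. \<Sum>x<2 ^ n. ?E z x)"
    unfolding sum_const_outcomes norm .
  have "(\<Sum>z<2 ^ n. \<Sum>x<2 ^ n. ?E z x) \<le> (\<Sum>z<(2::nat) ^ n. \<Sum>x<(2::nat) ^ n. (1 + \<epsilon>) * ?v)"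
    by (intro sum_mono expectation_wt_ob(2)) auto
  from mult_left_mono[OF this pos] have hi: "(?N + 1) / ?N * (\<Sum>z<2 ^ n. \<Sum>x<2 ^ n. ?E z x) \<le> (1 + \<epsilon>) * (T + r)"
    unfolding sum_const_outcomes norm .
  have "\<epsilon> * (T + r) \<le> \<epsilon> * (2 * T)" using eps_nonneg r_bounds by (intro mult_left_mono) auto
  then show ?thesis using lo hi unfolding mean by (simp add: algebra_simps abs_le_iff)
qed

lemma single_second_moment:
  "measure_pmf.expectation single (\<lambda>y. (y - T / 2 ^ n)\<^sup>2) \<le> 3 * (q - T\<^sup>2 / 2 ^ n) + 13 * \<epsilon> * T\<^sup>2"
proof -
  let ?N = "2 ^ n :: real"
  let ?c = "T / ?N"
  let ?E0 = "\<lambda>z x. measure_pmf.expectation S (\<lambda>k. born k z x)"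
  let ?E1 = "\<lambda>z x. measure_pmf.expectation S (\<lambda>k. born k z x * obs_val k z x)"
  let ?E2 = "\<lambda>z x. measure_pmf.expectation S (\<lambda>k. born k z x * (obs_val k z x)\<^sup>2)"
  let ?g = "\<lambda>z x k. born k z x * (obs_val k z x)\<^sup>2 - 2 * ?c * (born k z x * obs_val k z x) + ?c\<^sup>2 * born k z x"
  let ?a = "(?N + 1)\<^sup>2 / ?N"
  have ig: "integrable (measure_pmf S) (?g z x)" if "x < 2 ^ n" for z x
    using integrable_wt_ob[OF that, of z] by simp
  have Eg: "measure_pmf.expectation S (?g z x) = ?E2 z x - 2 * ?c * ?E1 z x + ?c\<^sup>2 * ?E0 z x" if "x < 2 ^ n" for z x
    using integrable_wt_ob[OF that, of z] by simp
  have "measure_pmf.expectation single (\<lambda>y. (y - ?c)\<^sup>2)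
    = measure_pmf.expectation S (\<lambda>k. \<Sum>z<2 ^ n. \<Sum>x<2 ^ n. born k z x / ?N * ((?N + 1) * obs_val k z x - T - ?c)\<^sup>2)"
  proof (rule single_expectation)
    fix y assume "\<bar>y\<bar> \<le> (?N + 1) * T + T"
    then have "\<bar>y - ?c\<bar> \<le> (?N + 1) * T + T + \<bar>?c\<bar>" by linarith
    from power_mono[OF this, of 2] show "\<bar>(y - ?c)\<^sup>2\<bar> \<le> ((?N + 1) * T + T + \<bar>?c\<bar>)\<^sup>2" by simp
  qed
  also have "\<dots> = measure_pmf.expectation S (\<lambda>k. \<Sum>z<2 ^ n. \<Sum>x<2 ^ n. ?a * ?g z x k)"
  proof (intro Bochner_Integration.integral_cong sum.cong refl)
    fix k z x
    \<comment> \<open>Centring the estimate at T / N centres \<open>obs_val\<close> at T / N as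
      well, so the square is that of the form of O_0.\<close>
    have "(?N + 1) * obs_val k z x - T - ?c = (?N + 1) * (obs_val k z x - ?c)" by (simp add: field_simps)
    then have "born k z x / ?N * ((?N + 1) * obs_val k z x - T - ?c)\<^sup>2 = ?a * (born k z x * (obs_val k z x - ?c)\<^sup>2)"
      by (simp add: power_mult_distrib)
    also have "born k z x * (obs_val k z x - ?c)\<^sup>2 = ?g z x k" by (simp add: power2_eq_square algebra_simps)
    finally show "born k z x / ?N * ((?N + 1) * obs_val k z x - T - ?c)\<^sup>2 = ?a * ?g z x k" .
  qed
  also have "\<dots> = (\<Sum>z<2 ^ n. measure_pmf.expectation S (\<lambda>k. \<Sum>x<2 ^ n. ?a * ?g z x k))"
    by (intro Bochner_Integration.integral_sum Bochner_Integration.integrable_sum integrable_mult_right ig) auto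
  also have "\<dots> = (\<Sum>z<2 ^ n. \<Sum>x<2 ^ n. measure_pmf.expectation S (\<lambda>k. ?a * ?g z x k))"
    by (intro sum.cong[OF refl] Bochner_Integration.integral_sum integrable_mult_right ig) auto
  also have "\<dots> = (\<Sum>z<2 ^ n. \<Sum>x<2 ^ n. ?a * (?E2 z x - 2 * ?c * ?E1 z x + ?c\<^sup>2 * ?E0 z x))"
    by (intro sum.cong refl) (simp only: integral_mult_right_zero Eg lessThan_iff)
  \<comment> \<open>\<open>?E1\<close> has a nonpositive coefficient, so it takes the lower design
    bound while the other two take the upper one.\<close>
  also have "\<dots> \<le> (\<Sum>z<(2::nat) ^ n. \<Sum>x<(2::nat) ^ n. ?a * ((1 + \<epsilon>) * (haar_const (2 ^ n) * (T\<^sup>2 + q + 2 * r * T + 2 * s))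
      - 2 * ?c * ((1 - \<epsilon>) * (haar_const (2 ^ n) * ((?N + 2) * (T + r))))
      + ?c\<^sup>2 * ((1 + \<epsilon>) * (haar_const (2 ^ n) * ((?N + 2) * (?N + 1))))))"
  proof (intro sum_mono mult_left_mono add_mono diff_mono)
    fix z x :: nat assume x: "x \<in> {..<2 ^ n}"
    show "?E2 z x \<le> (1 + \<epsilon>) * (haar_const (2 ^ n) * (T\<^sup>2 + q + 2 * r * T + 2 * s))"
      using x by (intro expectation_wt_ob2) auto
    show "(1 - \<epsilon>) * (haar_const (2 ^ n) * ((?N + 2) * (T + r))) \<le> ?E1 z x"
      using x by (intro expectation_wt_ob) auto
    show "?E0 z x \<le> (1 + \<epsilon>) * (haar_const (2 ^ n) * ((?N + 2) * (?N + 1)))"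
      using x by (intro expectation_wt) auto
    show "0 \<le> 2 * ?c" using T0 by simp
  qed auto
  also have "\<dots> = (?a * ?N\<^sup>2 * haar_const (2 ^ n)) * ((1 + \<epsilon>) * (T\<^sup>2 + q + 2 * r * T + 2 * s)
      - (1 - \<epsilon>) * (2 * ?c * ((?N + 2) * (T + r))) + (1 + \<epsilon>) * (?c\<^sup>2 * ((?N + 2) * (?N + 1))))"
  proof -
    have "M * (a * (e1 * (\<kappa> * X) - c1 * (e2 * (\<kappa> * Y)) + c2 * (e1 * (\<kappa> * Z))))
      = (a * M * \<kappa>) * (e1 * X - e2 * (c1 * Y) + e1 * (c2 * Z))" for M a e1 e2 \<kappa> X Y Z c1 c2 :: real
      by (simp add: algebra_simps)
    then show ?thesis unfolding sum_const_outcomes .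
  qed
  also have "?a * ?N\<^sup>2 * haar_const (2 ^ n) = (?N + 1) / (?N + 2)"
  proof -
    have "?a * ?N\<^sup>2 * haar_const (2 ^ n) * (?N + 2) = (haar_const (2 ^ n) * (?N * (?N + 1) * (?N + 2))) * (?N + 1)"
      by (simp add: power2_eq_square)
    then have "?a * ?N\<^sup>2 * haar_const (2 ^ n) * (?N + 2) = ?N + 1" unfolding kappa(1) by simp
    moreover have "?N + 2 \<noteq> 0" using N4 by linarith
    ultimately show ?thesis by (metis nonzero_eq_divide_eq)
  qed
  also have "(?N + 1) / (?N + 2) * ((1 + \<epsilon>) * (T\<^sup>2 + q + 2 * r * T + 2 * s)
      - (1 - \<epsilon>) * (2 * ?c * ((?N + 2) * (T + r))) + (1 + \<epsilon>) * (?c\<^sup>2 * ((?N + 2) * (?N + 1))))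
    \<le> 3 * (q - T\<^sup>2 / ?N) + 13 * \<epsilon> * T\<^sup>2"
    by (rule variance_arithmetic[OF N4 eps_nonneg r_bounds q_bounds s_le q0 s0])
  finally show ?thesis .
qed

end

theorem theorem1:
  fixes n :: nat and Obs \<rho> :: "complex mat" and \<gamma> \<delta> \<epsilon> :: real
    and S :: "'k pmf" and psi :: "'k \<Rightarrow> complex Matrix.vec" and L K :: nat
  assumes "n \<ge> 2"
    and "Obs \<in> carrier_mat (2^n) (2^n)" and "psd_mat Obs"
    and "density_mat n \<rho>"
    and "0 < \<gamma>" and "\<gamma> < 1" and "0 < \<delta>" and "\<delta> < 1"
    and "\<forall>k \<in> set_pmf S. unit_state (2^n) (psi k)"
    and "relative_approx_design (2^n) 3 \<epsilon> S psi"
    and "K = nat \<lceil>2 * ln (2 / \<delta>)\<rceil>"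
    and "L = max 1 (nat \<lceil>34 / \<gamma>^2 * (3 * Re (mtrace (traceless_part Obs * traceless_part Obs))
                                   + 10 * \<epsilon> * (Re (mtrace Obs))^2)\<rceil>)"
  shows "measure_pmf.prob (median_of_means L K (single_estimate n S psi Obs \<rho>))
           {e. \<bar>e - Re (mtrace (Obs * \<rho>))\<bar> \<le> \<gamma> + 2 * \<epsilon> * Re (mtrace Obs)} \<ge> 1 - \<delta>"
proof -
  interpret shadow_protocol n Obs \<rho> \<epsilon> S psi
    by unfold_locales (use assms in auto)
  define \<mu> where "\<mu> = measure_pmf.expectation single (\<lambda>y. y)"
  define V where "V = 3 * (q - T\<^sup>2 / 2 ^ n) + 10 * \<epsilon> * T\<^sup>2"
  have T: "Re (mtrace Obs) = T" by (simp add: mtrace_Obs)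
  \<comment> \<open>The \<open>max 1\<close> matters when O_0 = 0 and \<epsilon> = 0: the formula
    then gives no samples at all, and the mean of an empty list would be 0 instead of Tr(O
    \<rho>).\<close>
  have L0: "L > 0" unfolding assms(12) by simp
  have "34 / \<gamma>\<^sup>2 * V \<le> real L"
    unfolding assms(12) mtrace_traceless T V_def[symmetric] by linarith
  then have LV: "34 * V \<le> real L * \<gamma>\<^sup>2" using assms(5) by (simp add: field_simps)
  have "measure_pmf.expectation single (\<lambda>y. (y - \<mu>)\<^sup>2) \<le> measure_pmf.expectation single (\<lambda>y. (y - T / 2 ^ n)\<^sup>2)"
    unfolding \<mu>_def by (rule pmf_variance_le[OF single_bounded])
  also have "\<dots> \<le> 3 * (q - T\<^sup>2 / 2 ^ n) + 13 * \<epsilon> * T\<^sup>2" by (rule single_second_moment)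
  also have "\<dots> \<le> 13 / 10 * V"
    using q0 unfolding V_def by simp
  finally have "25 * measure_pmf.expectation single (\<lambda>y. (y - \<mu>)\<^sup>2) \<le> 65 / 2 * V" by simp
  \<comment> \<open>25 * 13/10 = 65/2: the failure probability 1/25 and the inflation from 10 to 13
    together still fit below 34.\<close>
  also have "\<dots> \<le> 34 * V"
    using q0 eps_nonneg unfolding V_def by (intro mult_right_mono) auto
  finally have var: "25 * measure_pmf.expectation single (\<lambda>y. (y - \<mu>)\<^sup>2) \<le> real L * \<gamma>\<^sup>2" using LV by simp
  show ?thesis unfolding mtrace_Obs_rho T
    by (rule median_of_means_accuracy[OF single_bounded \<mu>_def var L0 assms(5,7,8,11)])
       (use single_mean in \<open>simp_all add: \<mu>_def\<close>)
qed

end
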